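(* Let $n\ge 2$. For each $\boldsymbol{\lambda}\in\mathbb{C}^n$, the meromorphic connection $\nabla_{\boldsymbol{\lambda}}=d+A_{\boldsymbol{\lambda}}$ on the trivial bundle $\mathcal{O}_{\mathbb{P}^n}\oplus\mathcal{O}_{\mathbb{P}^n}$ over the complex projective space $\mathbb{P}^n$ (with $A_{\boldsymbol{\lambda}}$ the explicit matrix of rational $1$-forms given in the context) is flat and has at worst regular singularities.
   Context: A meromorphic rank $2$ connection on a projective manifold $X$ is a rank $2$ vector bundle $E$ with a $\mathbb{C}$-linear map $\nabla\colon E\to E\otimes\Omega^1_X(D)$ satisfying the Leibniz rule, $D$ being the polar divisor; it is flat if $\nabla\cdot\nabla=0$, and regular if local $\nabla$-horizontal sections have moderate growth near the polar divisor (in the sense of Deligne). Definition of $\nabla_{\boldsymbol{\lambda}}$. Let $[x:y:z_1:\dots:z_{n-2}:t]$ be homogeneous coordinates of $\mathbb{P}^n$, and $f(x,y,t):=x^2+y^2+t^2-2(xy+yt+tx)$. For $\boldsymbol{\lambda}=(\lambda_0,\dots,\lambda_{n-1})\in\mathbb{C}^n$ define rational $1$-forms on $\mathbb{P}^n$, written in the affine coordinates $[x:y:z_1:\dots:z_{n-2}:1]$, for $i=1,\dots,n-2$: $$\alpha_0:=-\frac{(2\lambda_0+\lambda_1)dx-(2\lambda_1+\lambda_0)dy}{2}-\frac{\lambda_1(y-1)}{2}\frac{dx}{x}+\frac{\lambda_0(x-1)}{2}\frac{dy}{y},$$ $$\alpha_1:=-\frac14\frac{df(x,y,1)}{f(x,y,1)},\qquad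 \alpha_2:=-\frac{\alpha_0}{f(x,y,1)},$$ $$\alpha_0^i:=\lambda_{i+1}\left(dz_i-\frac{z_i\,d(f(x,y,1)-z_i^2)}{2(f(x,y,1)-z_i^2)}\right),\qquad \alpha_2^i:=-\frac{\alpha_0^i}{f(x,y,1)}.$$ Set $$\mathcal{A}_{11}:=(x-1)\alpha_2+\alpha_1+\frac12\frac{dy}{y},\quad \mathcal{A}_{12}:=\frac{dx+(x-1)^2\alpha_2+2(x-1)\alpha_1+\alpha_0}{y},\quad \mathcal{A}_{21}:=y\alpha_2,$$ $$\mathcal{A}^i_{11}:=(x-1)\alpha_2^i,\quad \mathcal{A}^i_{12}:=\frac{(x-1)^2\alpha_2^i+\alpha_0^i}{y},\quad \mathcal{A}^i_{21}:=y\alpha^i_2,$$ $$A_{\boldsymbol{\lambda}}:=\begin{pmatrix}\mathcal{A}_{11}&\mathcal{A}_{12}\\-\mathcal{A}_{21}&-\mathcal{A}_{11}\end{pmatrix}+\sum_{i=1}^{n-2}\begin{pmatrix}\mathcal{A}^i_{11}&\mathcal{A}^i_{12}\\-\mathcal{A}^i_{21}&-\mathcal{A}^i_{11}\end{pmatrix},\qquad \nabla_{\boldsymbol{\lambda}}:=d+A_{\boldsymbol{\lambda}}.$$ (For $n=2$ there are no $z_i$ and the sum is empty.) *)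

theory Defs
  imports "HOL-Analysis.Analysis"
begin

text \<open>
  Projective space of dimension \<open>n = CARD('n)\<close> is handled through homogeneous coordinates: its points
  are the nonzero vectors of \<open>complex ^ 'n option\<close> up to scaling, with the index \<open>None\<close> for the
  coordinate \<open>t\<close>. A subset of projective space is represented by its cone, a form on projective space
  by its pullback to the cone (a function of a point \<open>X\<close> and a tangent vector \<open>V\<close>), and a
  holomorphic map from a polydisc to projective space by a nowhere vanishing holomorphic lift, which
  always exists.
\<close>

type_synonym 'n homog = "complex ^ 'n option"
type_synonym 'n matrix_form = "'n homog \<Rightarrow> 'n homog \<Rightarrow> complex ^ 2 ^ 2"

section \<open>Holomorphic functions of several variables\<close>

definition holomorphic_sev :: "(complex ^ 'k::finite \<Rightarrow> complex) \<Rightarrow> (complex ^ 'k) set \<Rightarrow> bool"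
  where "holomorphic_sev F U \<longleftrightarrow>
    (\<forall>P\<in>U. \<exists>L. Vector_Spaces.linear (*s) (*) L \<and> (F has_derivative L) (at P))"

definition ext_deriv :: "('a::real_normed_vector \<Rightarrow> 'b::real_normed_vector) \<Rightarrow> 'a \<Rightarrow> 'a \<Rightarrow> 'b"
  where "ext_deriv g X = frechet_derivative g (at X)"

section \<open>Meromorphic connections \<open>d + A\<close> on the trivial rank 2 bundle\<close>

text \<open>
  The matrix \<open>A\<close> of a meromorphic connection is a total function whose values on the zero set of
  the denominators carry no information, so it matters only off nowhere dense sets. The form
  \<open>B\<close> below is the holomorphic extension of \<open>A\<close> to the open set \<open>U\<close>.
\<close>

definition holo_extension ::
    "'n::finite matrix_form \<Rightarrow> 'n matrix_form \<Rightarrow> 'n homog set \<Rightarrow> bool"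
  where "holo_extension A B U \<longleftrightarrow>
    open U \<and>
    (\<forall>X\<in>U. \<forall>i j. Vector_Spaces.linear (*s) (*) (\<lambda>V. B X V $ i $ j)) \<and>
    (\<forall>V i j. holomorphic_sev (\<lambda>X. B X V $ i $ j) U) \<and>
    interior (closure {X\<in>U. B X \<noteq> A X}) = {}"

definition polar_locus :: "'n::finite matrix_form \<Rightarrow> 'n homog set"
  where "polar_locus A = {X. X \<noteq> 0 \<and> \<not> (\<exists>B U. X \<in> U \<and> holo_extension A B U)}"

text \<open>
  The value of the connection matrix at a point outside the polar locus, where any two
  holomorphic extensions agree.
\<close>

definition conn_matrix :: "'n::finite matrix_form \<Rightarrow> 'n matrix_form"
  where "conn_matrix A X = (THE M. \<exists>B U. X \<in> U \<and> holo_extension A B U \<and> M = B X)"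

text \<open>\<open>\<nabla>\<close> on sections, and its extension to vector valued 1-forms, with values in 2-forms.\<close>

definition nabla :: "'n::finite matrix_form \<Rightarrow> ('n homog \<Rightarrow> complex ^ 2) \<Rightarrow>
    'n homog \<Rightarrow> 'n homog \<Rightarrow> complex ^ 2"
  where "nabla A s X V = ext_deriv s X V + conn_matrix A X V *v s X"

definition nabla1 :: "'n::finite matrix_form \<Rightarrow> ('n homog \<Rightarrow> 'n homog \<Rightarrow> complex ^ 2) \<Rightarrow>
    'n homog \<Rightarrow> 'n homog \<Rightarrow> 'n homog \<Rightarrow> complex ^ 2"
  where "nabla1 A \<omega> X V W =
    (ext_deriv (\<lambda>Q. \<omega> Q W) X V - ext_deriv (\<lambda>Q. \<omega> Q V) X W) +
    (conn_matrix A X V *v \<omega> X W - conn_matrix A X W *v \<omega> X V)"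

definition flat_connection :: "'n::finite matrix_form \<Rightarrow> bool"
  where "flat_connection A \<longleftrightarrow>
    (\<forall>U s. open U \<and> 0 \<notin> U \<and> U \<inter> polar_locus A = {} \<and> (\<forall>i. holomorphic_sev (\<lambda>X. s X $ i) U) \<longrightarrow>
      (\<forall>X\<in>U. \<forall>V W. nabla1 A (nabla A s) X V W = 0))"

section \<open>Regular singularities\<close>

definition polydisc :: "real \<Rightarrow> (complex ^ 'n::finite) set"
  where "polydisc r = {w. \<forall>i. norm (w $ i) < r}"

text \<open>
  The polysector cut out of the unit polydisc by the conditions \<open>a i < arg (w $ i) < b i\<close> for
  \<open>i \<in> K\<close>; it avoids the hyperplanes \<open>w $ i = 0\<close>, \<open>i \<in> K\<close>.
\<close>

definition polysector ::
    "'n set \<Rightarrow> ('n \<Rightarrow> real) \<Rightarrow> ('n \<Rightarrow> real) \<Rightarrow> (complex ^ 'n::finite) set"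
  where "polysector K a b = {w \<in> polydisc 1. \<forall>i\<in>K. w $ i \<noteq> 0 \<and>
    (\<exists>\<theta>. a i < \<theta> \<and> \<theta> < b i \<and> w $ i = of_real (norm (w $ i)) * cis \<theta>)}"

text \<open>
  Lifts of holomorphic maps from the unit polydisc to projective space for which the preimage of
  the polar locus is a union of coordinate hyperplanes. The maps are not assumed to be
  immersions: besides the charts of a resolution of the polar divisor they include, for instance,
  discs meeting the polar divisor at the origin only.
\<close>

definition adapted_map ::
    "'n::finite matrix_form \<Rightarrow> 'n set \<Rightarrow> (complex ^ 'n \<Rightarrow> 'n homog) \<Rightarrow> bool"
  where "adapted_map A K \<phi> \<longleftrightarrow>
    (\<forall>j. holomorphic_sev (\<lambda>w. \<phi> w $ j) (polydisc 1)) \<and>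
    (\<forall>w\<in>polydisc 1. \<phi> w \<noteq> 0) \<and>
    (\<forall>w\<in>polydisc 1. \<phi> w \<in> polar_locus A \<longleftrightarrow> (\<exists>i\<in>K. w $ i = 0))"

text \<open>Sections horizontal along \<open>\<phi>\<close>, that is, for the pullback of \<open>\<nabla>\<close> by \<open>\<phi>\<close>.\<close>

definition horizontal_along :: "'n::finite matrix_form \<Rightarrow> (complex ^ 'n \<Rightarrow> 'n homog) \<Rightarrow>
    (complex ^ 'n) set \<Rightarrow> (complex ^ 'n \<Rightarrow> complex ^ 2) \<Rightarrow> bool"
  where "horizontal_along A \<phi> S s \<longleftrightarrow>
    (\<forall>w\<in>S. (s has_derivative (\<lambda>v. - (conn_matrix A (\<phi> w) (ext_deriv \<phi> w v) *v s w))) (at w))"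

text \<open>
  Moderate growth in the sense of Deligne. Near an arbitrary divisor it is tested after pulling
  back to polydiscs in which the divisor becomes a union of coordinate hyperplanes, where it means
  polynomial growth in the inverse distances to these hyperplanes on polysectors (on polysectors
  because horizontal sections are multivalued).
\<close>

definition regular_singularities :: "'n::finite matrix_form \<Rightarrow> bool"
  where "regular_singularities A \<longleftrightarrow>
    (\<forall>K \<phi> a b s.
      adapted_map A K \<phi> \<and> (\<forall>i\<in>K. a i < b i \<and> b i \<le> a i + 2 * pi) \<and>
      horizontal_along A \<phi> (polysector K a b) s \<longrightarrow>
      (\<exists>r>0. \<exists>C. \<exists>N::nat. \<forall>w \<in> polysector K a b \<inter> polydisc r.
         norm (s w) \<le> C / (\<Prod>i\<in>K. norm (w $ i)) ^ N))"

section \<open>The connection \<open>\<nabla>\<^sub>\<lambda>\<close>\<close>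

text \<open>
  A numbering \<open>e\<close> of \<open>'n\<close> by \<open>0, \<dots>, n - 1\<close> names the affine coordinates
  \<open>x = aff e 0\<close>, \<open>y = aff e 1\<close> and \<open>z\<^sub>i = aff e (i + 1)\<close>, and the parameters
  \<open>\<lambda>\<^sub>j = lam $ e j\<close>.
\<close>

definition aff :: "(nat \<Rightarrow> 'n::finite) \<Rightarrow> nat \<Rightarrow> 'n homog \<Rightarrow> complex"
  where "aff e j X = X $ Some (e j) / X $ None"

definition fpoly :: "complex \<Rightarrow> complex \<Rightarrow> complex \<Rightarrow> complex"
  where "fpoly x y t = x\<^sup>2 + y\<^sup>2 + t\<^sup>2 - 2 * (x * y + y * t + t * x)"

definition faff :: "(nat \<Rightarrow> 'n::finite) \<Rightarrow> 'n homog \<Rightarrow> complex"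
  where "faff e X = fpoly (aff e 0 X) (aff e 1 X) 1"

definition alpha0 :: "(nat \<Rightarrow> 'n::finite) \<Rightarrow> complex ^ 'n \<Rightarrow> 'n homog \<Rightarrow> 'n homog \<Rightarrow> complex"
  where "alpha0 e lam X V =
    (let x = aff e 0 X; y = aff e 1 X;
         dx = ext_deriv (aff e 0) X V; dy = ext_deriv (aff e 1) X V;
         l0 = lam $ e 0; l1 = lam $ e 1
     in - (((2 * l0 + l1) * dx - (2 * l1 + l0) * dy) / 2)
        - l1 * (y - 1) / 2 * (dx / x) + l0 * (x - 1) / 2 * (dy / y))"

definition alpha1 :: "(nat \<Rightarrow> 'n::finite) \<Rightarrow> 'n homog \<Rightarrow> 'n homog \<Rightarrow> complex"
  where "alpha1 e X V = - (1 / 4) * (ext_deriv (faff e) X V / faff e X)"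

definition alpha2 :: "(nat \<Rightarrow> 'n::finite) \<Rightarrow> complex ^ 'n \<Rightarrow> 'n homog \<Rightarrow> 'n homog \<Rightarrow> complex"
  where "alpha2 e lam X V = - (alpha0 e lam X V / faff e X)"

definition alpha0z ::
    "(nat \<Rightarrow> 'n::finite) \<Rightarrow> complex ^ 'n \<Rightarrow> nat \<Rightarrow> 'n homog \<Rightarrow> 'n homog \<Rightarrow> complex"
  where "alpha0z e lam i X V =
    (let z = aff e (i + 1)
     in lam $ e (i + 1) *
        (ext_deriv z X V
         - z X * ext_deriv (\<lambda>Q. faff e Q - (z Q)\<^sup>2) X V / (2 * (faff e X - (z X)\<^sup>2))))"

definition alpha2z ::
    "(nat \<Rightarrow> 'n::finite) \<Rightarrow> complex ^ 'n \<Rightarrow> nat \<Rightarrow> 'n homog \<Rightarrow> 'n homog \<Rightarrow> complex"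
  where "alpha2z e lam i X V = - (alpha0z e lam i X V / faff e X)"

definition A_base :: "(nat \<Rightarrow> 'n::finite) \<Rightarrow> complex ^ 'n \<Rightarrow> 'n matrix_form"
  where "A_base e lam X V =
    (let x = aff e 0 X; y = aff e 1 X;
         dx = ext_deriv (aff e 0) X V; dy = ext_deriv (aff e 1) X V;
         a0 = alpha0 e lam X V; a1 = alpha1 e X V; a2 = alpha2 e lam X V;
         A11 = (x - 1) * a2 + a1 + 1 / 2 * (dy / y);
         A12 = (dx + (x - 1)\<^sup>2 * a2 + 2 * (x - 1) * a1 + a0) / y;
         A21 = y * a2
     in vector [vector [A11, A12], vector [- A21, - A11]])"

definition A_z :: "(nat \<Rightarrow> 'n::finite) \<Rightarrow> complex ^ 'n \<Rightarrow> nat \<Rightarrow> 'n matrix_form"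
  where "A_z e lam i X V =
    (let x = aff e 0 X; y = aff e 1 X;
         a0 = alpha0z e lam i X V; a2 = alpha2z e lam i X V;
         A11 = (x - 1) * a2;
         A12 = ((x - 1)\<^sup>2 * a2 + a0) / y;
         A21 = y * a2
     in vector [vector [A11, A12], vector [- A21, - A11]])"

definition A_lambda :: "(nat \<Rightarrow> 'n::finite) \<Rightarrow> complex ^ 'n \<Rightarrow> 'n matrix_form"
  where "A_lambda e lam X V = A_base e lam X V + (\<Sum>i=1..CARD('n) - 2. A_z e lam i X V)"

end

theory Submission
  imports Defs "HOL-Complex_Analysis.Complex_Analysis"
begin

text \<open>
  On the double cover \<open>q\<^sup>2 = f\<close> the connection is diagonal in an explicit frame, up to the scalar form
  \<open>\<omega> / q\<close> with \<open>\<omega> = \<alpha>\<^sub>0 + \<Sum> \<alpha>\<^sub>0\<^sup>i\<close>, and this form is a constant combination of logarithmic differentials of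
  \<open>(P + q) / (P - q)\<close> with \<open>P\<close> linear and \<open>P\<^sup>2 - f\<close> equal to \<open>4 y t\<close>, \<open>4 x t\<close>, \<open>4 x y\<close> or \<open>z\<^sub>i\<^sup>2 - f\<close>. Hence the
  horizontal sections are products of complex powers of \<open>f\<close>, of a coordinate and of the \<open>P \<plusminus> q\<close>, and
  flatness follows. For special \<open>\<lambda>\<close> the connection has no pole along some of the hypersurfaces in question;
  the frame and the linear forms are then chosen such that none of the functions involved vanishes outside
  the polar locus. Moderate growth is a consequence of Schwarz's lemma: a bounded function without zeros on
  a punctured polydisc, or on its universal cover, has a logarithm which on sectors grows at most linearly in
  the logarithms of the distances to the hyperplanes.
\<close>

section \<open>Holomorphic functions of several variables\<close>

text \<open>Two obstacles shape the proof. First, \<open>A_lambda\<close> is a total function with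
  meaningless values on its denominators, and outside \<open>polar_locus\<close> only an unspecified
  holomorphic extension is given. Identities for the connection matrix are therefore checked where
  all denominators are nonzero and carried over by continuity. Second, the test maps for moderate
  growth are arbitrary, and may cross a hypersurface along which the poles cancel; a function
  vanishing there has no logarithm on the pullback. Hence the polar locus must be bounded from
  below, by nonzero residues, and the sections must be written with factors that vanish only on
  proven poles. The freedom to do so has two sources: the quotients (P + q) / (P - q) for the three
  P with P^2 - f = 4 y t, 4 x t, 4 x y have constant product, so a common exponent can be shifted;
  and the frame can be rescaled by one of the P + q or P - q. No resolution of the polar divisor is
  needed: on a convex domain all logarithms exist globally, and for moderate growth that domain is a
  universal cover.\<close>

lemma norm_vector_scalar_mult: "norm (c *s (v :: complex ^ 'k::finite)) = norm c * norm v"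
  unfolding norm_vec_def by (simp add: norm_mult L2_set_right_distrib)

lemma bounded_linear_vector_scalar_mult: "bounded_linear (\<lambda>c. c *s (v :: complex ^ 'k::finite))"
  by (rule bounded_linear_intro[where K = "norm v"])
     (auto simp: norm_vector_scalar_mult vec_eq_iff algebra_simps)

lemma complex_linear_iff:
  "Vector_Spaces.linear (*s) (*) (L :: complex ^ 'k::finite \<Rightarrow> complex) \<longleftrightarrow>
     (\<forall>x y. L (x + y) = L x + L y) \<and> (\<forall>c x. L (c *s x) = c * L x)"
proof -
  have "vector_space ((*s) :: complex \<Rightarrow> complex ^ 'k \<Rightarrow> complex ^ 'k)"
    by (rule vec.vector_space_axioms)
  moreover have "vector_space ((*) :: complex \<Rightarrow> complex \<Rightarrow> complex)"
    by (unfold_locales) (auto simp: algebra_simps)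
  ultimately show ?thesis
    unfolding Vector_Spaces.linear_iff by blast
qed

lemma ext_deriv_eq: "(F has_derivative L) (at X) \<Longrightarrow> ext_deriv F X = L"
  unfolding ext_deriv_def by (metis frechet_derivative_at)

lemma holomorphic_sevI:
  assumes "\<And>X. X \<in> U \<Longrightarrow> (F has_derivative L X) (at X)"
    and "\<And>X c v. X \<in> U \<Longrightarrow> L X (c *s v) = c * L X v"
  shows "holomorphic_sev F U"
  unfolding holomorphic_sev_def complex_linear_iff
proof
  fix X assume "X \<in> U"
  with assms show "\<exists>La. ((\<forall>x y. La (x + y) = La x + La y) \<and> (\<forall>c x. La (c *s x) = c * La x)) \<and>
      (F has_derivative La) (at X)"
    by (intro exI[of _ "L X"]) (auto intro!: linear_add has_derivative_linear)
qed

lemma holomorphic_sev_has_derivative: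
  "holomorphic_sev F U \<Longrightarrow> X \<in> U \<Longrightarrow> (F has_derivative ext_deriv F X) (at X)"
  unfolding holomorphic_sev_def by (metis ext_deriv_eq)

lemma holomorphic_sev_ext_deriv_scale:
  "holomorphic_sev F U \<Longrightarrow> X \<in> U \<Longrightarrow> ext_deriv F X (c *s v) = c * ext_deriv F X v"
  unfolding holomorphic_sev_def complex_linear_iff by (metis ext_deriv_eq)

lemma holomorphic_sev_subset: "holomorphic_sev F U \<Longrightarrow> W \<subseteq> U \<Longrightarrow> holomorphic_sev F W"
  unfolding holomorphic_sev_def by blast

lemma holomorphic_sev_isCont: "holomorphic_sev F U \<Longrightarrow> X \<in> U \<Longrightarrow> isCont F X"
  using holomorphic_sev_has_derivative has_derivative_continuous by blast

lemma holomorphic_sev_continuous_on: "holomorphic_sev F U \<Longrightarrow> continuous_on U F"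
  by (simp add: continuous_at_imp_continuous_on holomorphic_sev_isCont)

lemma holomorphic_sev_diff:
  assumes "holomorphic_sev F U" "holomorphic_sev G U"
  shows "holomorphic_sev (\<lambda>X. F X - G X) U"
  by (rule holomorphic_sevI[where L = "\<lambda>X v. ext_deriv F X v - ext_deriv G X v"])
     (auto intro!: derivative_intros assms[THEN holomorphic_sev_has_derivative]
        simp: assms[THEN holomorphic_sev_ext_deriv_scale] algebra_simps)

lemma holomorphic_sev_mult:
  assumes "holomorphic_sev F U" "holomorphic_sev G U"
  shows "holomorphic_sev (\<lambda>X. F X * G X) U"
proof (rule holomorphic_sevI)
  show "((\<lambda>X. F X * G X) has_derivative (\<lambda>v. F X * ext_deriv G X v + ext_deriv F X v * G X)) (at X)"
    if "X \<in> U" for X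
    using that by (intro has_derivative_mult assms[THEN holomorphic_sev_has_derivative])
qed (simp add: assms[THEN holomorphic_sev_ext_deriv_scale] algebra_simps)

lemma holomorphic_sev_on_line:
  assumes "holomorphic_sev F U" "X + z *s V \<in> U"
  shows "((\<lambda>z. F (X + z *s V)) has_field_derivative ext_deriv F (X + z *s V) V) (at z)"
proof -
  have "((\<lambda>z. X + z *s V) has_derivative (\<lambda>z. z *s V)) (at z)"
    by (auto intro!: derivative_eq_intros
          bounded_linear.has_derivative[OF bounded_linear_vector_scalar_mult])
  from diff_chain_at[OF this holomorphic_sev_has_derivative[OF assms]]
  show ?thesis
    unfolding has_field_derivative_def o_def
    by (rule has_derivative_eq_rhs)
       (auto simp: holomorphic_sev_ext_deriv_scale[OF assms] mult.commute)
qed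

section \<open>Cauchy estimates and second derivatives\<close>

lemma Cauchy_estimate_ext_deriv:
  fixes V :: "complex ^ 'k::finite"
  assumes F: "holomorphic_sev F (ball X R)" and "R > 0"
    and M: "\<And>Y. Y \<in> ball X R \<Longrightarrow> norm (F Y) \<le> M"
  shows "norm (ext_deriv F X V) \<le> 2 * M / R * norm V"
proof (cases "V = 0")
  case True
  have "linear (ext_deriv F X)"
    using holomorphic_sev_has_derivative[OF F, of X] \<open>R > 0\<close> has_derivative_linear by auto
  then show ?thesis using True by (simp add: linear_0)
next
  case False
  \<comment> \<open>Half of the radius that the ball allows, so that the closed disc still maps into
    it; this is the factor 2 in the estimate.\<close>
  define r where "r = R / (2 * norm V)"
  have r: "r > 0" using False \<open>R > 0\<close> by (simp add: r_def)
  have in_ball: "X + z *s V \<in> ball X R" if "z \<in> cball 0 r" for z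
  proof -
    have "norm z * norm V \<le> r * norm V"
      using that by (intro mult_right_mono) auto
    also have "\<dots> = R / 2" using False by (simp add: r_def)
    finally show ?thesis using \<open>R > 0\<close> by (simp add: dist_norm norm_vector_scalar_mult)
  qed
  have der: "((\<lambda>z. F (X + z *s V)) has_field_derivative ext_deriv F (X + z *s V) V) (at z)"
    if "z \<in> cball 0 r" for z
    using holomorphic_sev_on_line[OF F in_ball[OF that]] .
  have "norm ((deriv ^^ 1) (\<lambda>z. F (X + z *s V)) 0) \<le> fact 1 * M / r ^ 1"
  proof (rule Cauchy_inequality)
    show "(\<lambda>z. F (X + z *s V)) holomorphic_on ball 0 r"
      using der by (force simp: holomorphic_on_open)
    show "continuous_on (cball 0 r) (\<lambda>z. F (X + z *s V))"
      using der by (meson DERIV_isCont continuous_at_imp_continuous_on)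
  qed (use r in_ball M in auto)
  moreover have "deriv (\<lambda>z. F (X + z *s V)) 0 = ext_deriv F X V"
    using DERIV_imp_deriv[OF der[of 0]] r by simp
  ultimately show ?thesis by (simp add: r_def field_simps)
qed

text \<open>On the half disc, Cauchy's inequality for circles of radius r/4 bounds the second
  derivative by 2 M / (r/4)^2 = 32 M / r^2, the remainder constant in Taylor's formula of order
  one.\<close>

lemma difference_quotient_estimate:
  assumes g: "g holomorphic_on ball 0 r" and "r > 0"
    and M: "\<And>z. z \<in> ball 0 r \<Longrightarrow> norm (g z) \<le> M" and z: "norm z \<le> r / 4"
  shows "norm (g z - g 0 - deriv g 0 * z) \<le> 32 * M / r\<^sup>2 * (norm z)\<^sup>2"
proof -
  have bound: "norm ((deriv ^^ 2) g w) \<le> 32 * M / r\<^sup>2" if "w \<in> ball 0 (r / 2)" for w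
  proof -
    have sub: "cball w (r / 4) \<subseteq> ball 0 r" 
    proof
      fix x assume "x \<in> cball w (r / 4)"
      then have "norm (w - x) \<le> r / 4" by (simp add: dist_norm)
      moreover have "norm x \<le> norm w + norm (w - x)"
        using norm_triangle_ineq4[of w "w - x"] by simp
      ultimately show "x \<in> ball 0 r" using that \<open>r > 0\<close> by simp
    qed
    have "norm ((deriv ^^ 2) g w) \<le> fact 2 * M / (r / 4) ^ 2"
    proof (rule Cauchy_inequality)
      show "g holomorphic_on ball w (r / 4)"
        using g sub by (meson ball_subset_cball holomorphic_on_subset order_trans)
      show "continuous_on (cball w (r / 4)) g"
        using g sub holomorphic_on_imp_continuous_on continuous_on_subset by blast
      show "norm (g x) \<le> M" if "norm (w - x) = r / 4" for x
        using M sub that by (auto simp: dist_norm subset_iff)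
    qed (use \<open>r > 0\<close> in auto)
    then show ?thesis by (simp add: field_simps power2_eq_square)
  qed
  have "norm ((deriv ^^ 0) g z - (\<Sum>i\<le>1. (deriv ^^ i) g 0 * (z - 0) ^ i / fact i))
      \<le> 32 * M / r\<^sup>2 * norm (z - 0) ^ Suc 1 / fact 1"
  proof (rule complex_Taylor[where S = "ball 0 (r / 2)"])
    fix i :: nat and x :: complex assume x: "x \<in> ball 0 (r / 2)"
    have "(deriv ^^ i) g holomorphic_on ball 0 r"
      using g by (simp add: holomorphic_higher_deriv)
    then have "((deriv ^^ i) g has_field_derivative deriv ((deriv ^^ i) g) x) (at x)"
      using x \<open>r > 0\<close> by (intro holomorphic_derivI[where S = "ball 0 r"]) auto
    then show "((deriv ^^ i) g has_field_derivative (deriv ^^ Suc i) g x) (at x within ball 0 (r / 2))"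
      using has_field_derivative_at_within by auto
  qed (use bound z \<open>r > 0\<close> in \<open>auto simp: numeral_2_eq_2\<close>)
  then show ?thesis by (simp add: numeral_2_eq_2 algebra_simps)
qed

text \<open>The point is that \<open>C\<close> and \<open>N\<close> do not depend on
  \<open>Y\<close>: uniform convergence of the difference quotients is what allows their limit to be
  differentiated.\<close>

lemma partial_derivative_limit:
  assumes F: "holomorphic_sev F (ball X0 R)" and "R > 0"
    and M: "\<And>Y. Y \<in> ball X0 R \<Longrightarrow> norm (F Y) \<le> M"
  obtains C N where "\<And>m Y. m \<ge> N \<Longrightarrow> Y \<in> ball X0 (R / 2) \<Longrightarrow>
    norm (of_nat m * (F (Y + (1 / of_nat m) *s V) - F Y) - ext_deriv F Y V) \<le> C / real m"
proof -
  define r where "r = R / (2 * (norm V + 1))"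
  have r: "r > 0" using \<open>R > 0\<close> by (simp add: r_def add_nonneg_pos)
  obtain N :: nat where N: "real N > 4 / r" using reals_Archimedean2 by blast
  have "norm (of_nat m * (F (Y + (1 / of_nat m) *s V) - F Y) - ext_deriv F Y V)
      \<le> (32 * M / r\<^sup>2) / real m" if m: "m \<ge> N" and Y: "Y \<in> ball X0 (R / 2)" for m Y
  proof -
    have "4 / r > 0" using r by simp
    with N m have mr: "real m > 4 / r" by linarith
    with \<open>4 / r > 0\<close> have m0: "real m > 0" by linarith
    have in_ball: "Y + z *s V \<in> ball X0 R" if "z \<in> ball 0 r" for z
    proof -
      have "norm z * norm V \<le> r * (norm V + 1)"
        using that r by (intro mult_mono) auto
      also have "\<dots> = R / 2"
        by (simp add: r_def divide_simps) (smt (verit) norm_ge_zero)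
      finally have "norm (z *s V) \<le> R / 2" by (simp add: norm_vector_scalar_mult)
      moreover have "norm (X0 - (Y + z *s V)) \<le> norm (X0 - Y) + norm (z *s V)"
        using norm_triangle_ineq4[of "X0 - Y" "z *s V"] by (simp add: algebra_simps)
      ultimately show ?thesis using Y by (simp add: dist_norm)
    qed
    define g where "g z = F (Y + z *s V)" for z
    have der: "(g has_field_derivative ext_deriv F (Y + z *s V) V) (at z)" if "z \<in> ball 0 r" for z
      unfolding g_def using holomorphic_sev_on_line[OF F in_ball[OF that]] .
    have d0: "deriv g 0 = ext_deriv F Y V"
      using DERIV_imp_deriv[OF der[of 0]] r by simp
    have "norm (g (1 / of_nat m) - g 0 - deriv g 0 * (1 / of_nat m))
        \<le> 32 * M / r\<^sup>2 * (norm (1 / of_nat m :: complex))\<^sup>2"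
    proof (rule difference_quotient_estimate)
      show "g holomorphic_on ball 0 r" using der by (force simp: holomorphic_on_open)
      show "norm (1 / of_nat m :: complex) \<le> r / 4"
        using mr m0 r by (simp add: norm_divide field_simps)
    qed (use r in_ball M in \<open>auto simp: g_def\<close>)
    then have "real m * norm (g (1 / of_nat m) - g 0 - deriv g 0 * (1 / of_nat m))
        \<le> real m * (32 * M / r\<^sup>2 * (1 / real m)\<^sup>2)"
      using m0 by (intro mult_left_mono) (auto simp: norm_divide)
    also have "\<dots> = 32 * M / r\<^sup>2 / real m"
      using m0 by (simp add: power2_eq_square)
    finally have "norm (of_nat m * (g (1 / of_nat m) - g 0 - deriv g 0 * (1 / of_nat m)))
        \<le> 32 * M / r\<^sup>2 / real m"
      by (simp add: norm_mult)
    moreover have "of_nat m * (g (1 / of_nat m) - g 0 - deriv g 0 * (1 / of_nat m))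
        = of_nat m * (F (Y + (1 / of_nat m) *s V) - F Y) - ext_deriv F Y V"
      using m0 unfolding d0 by (simp add: g_def algebra_simps)
    ultimately show ?thesis by simp
  qed
  then show thesis by (rule that)
qed

lemma ext_deriv_diff_quotient:
  assumes "holomorphic_sev F U" "Y \<in> U" "Y + A \<in> U"
  shows "((\<lambda>Y. c * (F (Y + A) - F Y)) has_derivative
           (\<lambda>h. c * (ext_deriv F (Y + A) h - ext_deriv F Y h))) (at Y)"
proof -
  have "((\<lambda>Y. Y + A) has_derivative (\<lambda>h. h)) (at Y)"
    by (auto intro!: derivative_eq_intros)
  from diff_chain_at[OF this holomorphic_sev_has_derivative[OF assms(1,3)]]
  show ?thesis
    using holomorphic_sev_has_derivative[OF assms(1,2)]
    by (auto intro!: derivative_intros simp: o_def)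
qed

text \<open>
  The difference quotients of \<open>F\<close> in direction \<open>V\<close> converge uniformly near \<open>X0\<close>, hence by the Cauchy
  estimate so do their derivatives.
\<close>

lemma ext_deriv_differentiable:
  fixes X0 :: "complex ^ 'k::finite"
  assumes F: "holomorphic_sev F U" and "open U" "X0 \<in> U"
  shows "\<exists>L. ((\<lambda>Y. ext_deriv F Y V) has_derivative L) (at X0) \<and>
    (\<forall>h. (\<lambda>m. of_nat m * (ext_deriv F (X0 + (1 / of_nat m) *s V) h - ext_deriv F X0 h)) \<longlonglongrightarrow> L h)"
proof -
  let ?h = "\<lambda>m :: nat. (1 / of_nat m) *s V"
  obtain R0 where R0: "R0 > 0" "ball X0 R0 \<subseteq> U"
    using assms openE by blast
  from holomorphic_sev_isCont[OF F \<open>X0 \<in> U\<close>, unfolded continuous_at_eps_delta]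
  obtain d where d: "d > 0" "\<And>Y. dist Y X0 < d \<Longrightarrow> dist (F Y) (F X0) < 1"
    by (metis zero_less_one)
  define R where "R = min R0 d"
  define M where "M = norm (F X0) + 1"
  have R: "R > 0" "ball X0 R \<subseteq> U" using R0 d by (auto simp: R_def)
  have FR: "holomorphic_sev F (ball X0 R)" using F R(2) holomorphic_sev_subset by blast
  have M: "norm (F Y) \<le> M" if "Y \<in> ball X0 R" for Y
  proof -
    have "norm (F Y - F X0) < 1" using that d(2)[of Y] by (simp add: R_def dist_norm norm_minus_commute)
    then show ?thesis unfolding M_def using norm_triangle_sub[of "F Y" "F X0"] by linarith
  qed
  obtain C N where CN: "\<And>m Y. m \<ge> N \<Longrightarrow> Y \<in> ball X0 (R / 2) \<Longrightarrow>
    norm (of_nat m * (F (Y + ?h m) - F Y) - ext_deriv F Y V) \<le> C / real m"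
    using partial_derivative_limit[OF FR R(1) M] by metis
  obtain N1 :: nat where N1: "real N1 > 4 * norm V / R" using reals_Archimedean2 by blast
  define G where "G m Y = of_nat m * (F (Y + ?h m) - F Y)" for m Y
  define G' where "G' m Y h = of_nat m * (ext_deriv F (Y + ?h m) h - ext_deriv F Y h)"
    for m Y h
  define S where "S = ball X0 (R / 4)"
  have shift: "Y + ?h m \<in> ball X0 R" if "m \<ge> N1" "Y \<in> ball X0 (R / 2)" for m Y
  proof -
    have "4 * norm V / R \<ge> 0" using R by simp
    with N1 that have m: "real m > 4 * norm V / R" "real m > 0" by linarith+
    then have "norm (?h m) \<le> R / 4"
      using R by (simp add: norm_vector_scalar_mult norm_divide field_simps)
    moreover have "norm (X0 - (Y + ?h m)) \<le> norm (X0 - Y) + norm (?h m)"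
      using norm_triangle_ineq4[of "X0 - Y" "?h m"] by (simp add: algebra_simps)
    ultimately show ?thesis using that R by (simp add: dist_norm)
  qed
  have derG: "(G m has_derivative G' m Y) (at Y)" if "m \<ge> N1" "Y \<in> ball X0 (R / 2)" for m Y
    unfolding G_def G'_def using that R
    by (intro ext_deriv_diff_quotient[OF FR] shift) auto
  have holG: "holomorphic_sev (G m) (ball X0 (R / 2))" if "m \<ge> N1" for m
    by (rule holomorphic_sevI[OF derG[OF that]])
       (use that R in \<open>auto simp: G'_def algebra_simps
          holomorphic_sev_ext_deriv_scale[OF FR shift] holomorphic_sev_ext_deriv_scale[OF FR]\<close>)
  have C0: "C \<ge> 0"
  proof -
    have "0 \<le> C / real (Suc N)"
      using CN[of "Suc N" X0] R by (meson centre_in_ball half_gt_zero le_SucI norm_ge_zero order_refl order_trans)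
    then show ?thesis by (simp add: field_simps zero_le_divide_iff)
  qed
  \<comment> \<open>The difference of two quotients is holomorphic and at most 2 C / N2 on a ball of
    radius R/4 about \<open>Y\<close>; the Cauchy estimate multiplies this by 2 / (R/4).\<close>
  have G'_diff: "norm (G' m Y h - G' k Y h) \<le> (16 * C / R) * norm h / real N2"
    if m: "m \<ge> N2" and k: "k \<ge> N2" and N2: "N2 \<ge> N" "N2 \<ge> N1" "N2 > 0" and Y: "Y \<in> S" for m k N2 Y h
  proof -
    have sub: "ball Y (R / 4) \<subseteq> ball X0 (R / 2)"
    proof
      fix x assume "x \<in> ball Y (R / 4)"
      then show "x \<in> ball X0 (R / 2)"
        using Y dist_triangle[of X0 x Y] by (simp add: S_def)
    qed
    have hol: "holomorphic_sev (\<lambda>Y. G m Y - G k Y) (ball Y (R / 4))"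
      using m k N2 by (intro holomorphic_sev_subset[OF holomorphic_sev_diff[OF holG holG] sub]) auto
    have bd: "norm (G m x - G k x) \<le> 2 * C / real N2" if "x \<in> ball Y (R / 4)" for x
    proof -
      have x: "x \<in> ball X0 (R / 2)" using that sub by blast
      have "norm (G m x - G k x) \<le> norm (G m x - ext_deriv F x V) + norm (G k x - ext_deriv F x V)"
        using norm_triangle_ineq4[of "G m x - ext_deriv F x V" "G k x - ext_deriv F x V"] by simp
      also have "\<dots> \<le> C / real m + C / real k"
        unfolding G_def using m k N2 by (intro add_mono CN x) auto
      also have "\<dots> \<le> C / real N2 + C / real N2"
        using m k N2 C0 by (intro add_mono divide_left_mono) auto
      finally show ?thesis by simp
    qed
    have "norm (ext_deriv (\<lambda>Y. G m Y - G k Y) Y h) \<le> 2 * (2 * C / real N2) / (R / 4) * norm h"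
      using R bd by (intro Cauchy_estimate_ext_deriv[OF hol]) auto
    moreover have "ext_deriv (\<lambda>Y. G m Y - G k Y) Y = (\<lambda>h. G' m Y h - G' k Y h)"
      using Y m k N2 R by (intro ext_deriv_eq has_derivative_diff derG) (auto simp: S_def)
    ultimately show ?thesis by (simp add: field_simps)
  qed
  have Cau: "Cauchy (\<lambda>m. G' m Y h)" if Y: "Y \<in> S" for Y h
  proof (rule CauchyI)
    fix e :: real assume "e > 0"
    define B where "B = 16 * C / R * norm h"
    obtain N3 :: nat where N3: "real N3 > B / e" using reals_Archimedean2 by blast
    define N2 where "N2 = Suc (N + N1 + N3)"
    have "norm (G' m Y h - G' k Y h) < e" if "m \<ge> N2" "k \<ge> N2" for m k
    proof -
      have "norm (G' m Y h - G' k Y h) \<le> B / real N2"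
        unfolding B_def using that Y by (intro G'_diff) (auto simp: N2_def)
      also have "real N2 > B / e" using N3 by (simp add: N2_def)
      then have "B / real N2 < e" using \<open>e > 0\<close> by (simp add: N2_def field_simps)
      finally show ?thesis .
    qed
    then show "\<exists>M. \<forall>m\<ge>M. \<forall>n\<ge>M. norm (G' m Y h - G' n Y h) < e" by blast
  qed
  define g' where "g' Y h = lim (\<lambda>m. G' m Y h)" for Y h
  have lim: "(\<lambda>m. G' m Y h) \<longlonglongrightarrow> g' Y h" if "Y \<in> S" for Y h
    unfolding g'_def using Cau[OF that] by (simp add: Cauchy_convergent_iff convergent_LIMSEQ_iff)
  define N0 where "N0 = Suc (N + N1)"
  have X0S: "X0 \<in> S" using R by (simp add: S_def)
  have limG: "(\<lambda>m. G m Y) \<longlonglongrightarrow> ext_deriv F Y V" if "Y \<in> ball X0 (R / 2)" for Y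
  proof (rule LIM_zero_cancel, rule Lim_null_comparison)
    show "\<forall>\<^sub>F m in sequentially. norm (G m Y - ext_deriv F Y V) \<le> C / real m"
      using eventually_ge_at_top[of N] by eventually_elim (auto simp: G_def intro: CN that)
    show "(\<lambda>m. C / real m) \<longlonglongrightarrow> 0" by (rule lim_const_over_n)
  qed
  \<comment> \<open>\<open>G m\<close> is known to be differentiable only for large m, so the
    sequence starts at \<open>N0\<close>.\<close>
  have "\<exists>g. \<forall>Y\<in>S. (\<lambda>m. G (m + N0) Y) \<longlonglongrightarrow> g Y \<and> (g has_derivative g' Y) (at Y within S)"
  proof (rule has_derivative_sequence[of S "\<lambda>m. G (m + N0)"
        "\<lambda>m. G' (m + N0)" g' X0 "ext_deriv F X0 V"])
    show "(G (n + N0) has_derivative G' (n + N0) Y) (at Y within S)" if "Y \<in> S" for n Y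
      by (rule has_derivative_at_withinI, rule derG) (use that R in \<open>auto simp: N0_def S_def\<close>)
    show "(\<lambda>m. G (m + N0) X0) \<longlonglongrightarrow> ext_deriv F X0 V"
      by (rule LIMSEQ_ignore_initial_segment, rule limG) (use R in auto)
    show "\<forall>\<^sub>F m in sequentially. \<forall>Y\<in>S. \<forall>h. norm (G' (m + N0) Y h - g' Y h) \<le> e * norm h"
      if "e > 0" for e :: real
    proof -
      obtain N3 :: nat where N3: "real N3 > 16 * C / R / e" using reals_Archimedean2 by blast
      define N2 where "N2 = Suc (N + N1 + N3)"
      have "norm (G' (m + N0) Y h - g' Y h) \<le> e * norm h" if m: "m \<ge> N2" and Y: "Y \<in> S" for m Y h
      proof (rule Lim_bounded[where f = "\<lambda>k. norm (G' (m + N0) Y h - G' k Y h)" and M = N2])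
        show "(\<lambda>k. norm (G' (m + N0) Y h - G' k Y h)) \<longlonglongrightarrow> norm (G' (m + N0) Y h - g' Y h)"
          by (intro tendsto_intros lim Y)
        show "\<forall>k\<ge>N2. norm (G' (m + N0) Y h - G' k Y h) \<le> e * norm h"
        proof (intro allI impI)
          fix k assume k: "k \<ge> N2"
          have "norm (G' (m + N0) Y h - G' k Y h) \<le> (16 * C / R) * norm h / real N2"
            using m k Y by (intro G'_diff) (auto simp: N2_def)
          also have "\<dots> = (16 * C / R / real N2) * norm h" by simp
          also have "\<dots> \<le> e * norm h"
          proof (rule mult_right_mono)
            have "real N2 > 16 * C / R / e" using N3 by (simp add: N2_def)
            moreover have "real N2 > 0" by (simp add: N2_def)
            ultimately show "16 * C / R / real N2 \<le> e"
              using \<open>e > 0\<close> pos_divide_less_eq[of e "16 * C / R" "real N2"]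
                pos_divide_le_eq[of "real N2" "16 * C / R" e] by (simp add: mult.commute)
          qed simp
          finally show "norm (G' (m + N0) Y h - G' k Y h) \<le> e * norm h" .
        qed
      qed
      then show ?thesis unfolding eventually_sequentially by blast
    qed
  qed (use X0S in \<open>auto simp: S_def\<close>)
  then obtain g where g: "\<And>Y. Y \<in> S \<Longrightarrow> (\<lambda>m. G (m + N0) Y) \<longlonglongrightarrow> g Y"
      "\<And>Y. Y \<in> S \<Longrightarrow> (g has_derivative g' Y) (at Y within S)" by blast
  have geq: "g Y = ext_deriv F Y V" if "Y \<in> S" for Y
    using g(1)[OF that] LIMSEQ_ignore_initial_segment[OF limG, of Y N0] that R
    by (auto intro: LIMSEQ_unique simp: S_def)
  have "(g has_derivative g' X0) (at X0)"
    using g(2)[OF X0S] at_within_open[of X0 S] X0S by (simp add: S_def)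
  then have "((\<lambda>Y. ext_deriv F Y V) has_derivative g' X0) (at X0)"
    by (rule has_derivative_transform_within_open[of _ _ _ _ S]) (use X0S geq in \<open>auto simp: S_def\<close>)
  with lim[OF X0S] show ?thesis unfolding G'_def by blast
qed

text \<open>\<open>ext_deriv_differentiable\<close> provides a derivative that is a priori only real
  linear. It is a pointwise limit of differences of the complex linear maps
  \<open>ext_deriv F (X + V/m)\<close> and \<open>ext_deriv F X\<close>, scaled by m, hence complex
  linear.\<close>

lemma holomorphic_sev_ext_deriv:
  fixes F :: "complex ^ 'k::finite \<Rightarrow> complex"
  assumes F: "holomorphic_sev F U" and "open U"
  shows "holomorphic_sev (\<lambda>Y. ext_deriv F Y V) U"
proof -
  have "\<exists>L. ((\<lambda>Y. ext_deriv F Y V) has_derivative L) (at X) \<and> (\<forall>c h. L (c *s h) = c * L h)"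
    if X: "X \<in> U" for X
  proof -
    obtain L where L: "((\<lambda>Y. ext_deriv F Y V) has_derivative L) (at X)"
      "\<And>h. (\<lambda>m. of_nat m * (ext_deriv F (X + (1 / of_nat m) *s V) h - ext_deriv F X h)) \<longlonglongrightarrow> L h"
      using ext_deriv_differentiable[OF F \<open>open U\<close> X] by blast
    have "L (c *s h) = c * L h" for c h
    proof (rule LIMSEQ_unique)
      have "(\<lambda>m. (1 / of_nat m) *s V) \<longlonglongrightarrow> 0"
        using bounded_linear.tendsto_zero[OF bounded_linear_vector_scalar_mult lim_1_over_n] .
      then have "(\<lambda>m. X + (1 / of_nat m) *s V) \<longlonglongrightarrow> X"
        using tendsto_add[OF tendsto_const[of X]] by fastforce
      then have "\<forall>\<^sub>F m in sequentially. X + (1 / of_nat m) *s V \<in> U"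
        using topological_tendstoD \<open>open U\<close> X by fastforce
      then have ev: "\<forall>\<^sub>F m in sequentially.
          of_nat m * (ext_deriv F (X + (1 / of_nat m) *s V) (c *s h) - ext_deriv F X (c *s h)) =
          c * (of_nat m * (ext_deriv F (X + (1 / of_nat m) *s V) h - ext_deriv F X h))"
        by eventually_elim (use X in \<open>simp add: holomorphic_sev_ext_deriv_scale[OF F] algebra_simps\<close>)
      show "(\<lambda>m. c * (of_nat m * (ext_deriv F (X + (1 / of_nat m) *s V) h - ext_deriv F X h)))
          \<longlonglongrightarrow> L (c *s h)"
        by (rule Lim_transform_eventually[OF L(2) ev])
      show "(\<lambda>m. c * (of_nat m * (ext_deriv F (X + (1 / of_nat m) *s V) h - ext_deriv F X h)))
          \<longlonglongrightarrow> c * L h"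
        by (intro tendsto_intros L(2))
    qed
    with L(1) show ?thesis by blast
  qed
  then obtain L where "\<And>X. X \<in> U \<Longrightarrow> ((\<lambda>Y. ext_deriv F Y V) has_derivative L X) (at X)"
    "\<And>X c h. X \<in> U \<Longrightarrow> L X (c *s h) = c * L X h" by metis
  then show ?thesis by (rule holomorphic_sevI)
qed

text \<open>One sequence has two limits: \<open>?Q\<close> is the W-derivative of the difference
  quotient of F in direction V, and also the difference quotient in direction V of the
  W-derivative.\<close>

lemma ext_deriv_symmetric:
  fixes F :: "complex ^ 'k::finite \<Rightarrow> complex"
  assumes F: "holomorphic_sev F U" and "open U" and X: "X \<in> U"
  shows "ext_deriv (\<lambda>Y. ext_deriv F Y V) X W = ext_deriv (\<lambda>Y. ext_deriv F Y W) X V"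
proof (rule LIMSEQ_unique)
  let ?Q = "\<lambda>m. of_nat m * (ext_deriv F (X + (1 / of_nat m) *s V) W - ext_deriv F X W)"
  obtain L where "((\<lambda>Y. ext_deriv F Y V) has_derivative L) (at X)" "\<And>h. (\<lambda>m. of_nat m *
      (ext_deriv F (X + (1 / of_nat m) *s V) h - ext_deriv F X h)) \<longlonglongrightarrow> L h"
    using ext_deriv_differentiable[OF F \<open>open U\<close> X] by blast
  then show "?Q \<longlonglongrightarrow> ext_deriv (\<lambda>Y. ext_deriv F Y V) X W" by (simp add: ext_deriv_eq)
  have "((\<lambda>z. ext_deriv F (X + z *s V) W) has_field_derivative
      ext_deriv (\<lambda>Y. ext_deriv F Y W) X V) (at 0)"
    using holomorphic_sev_on_line[OF holomorphic_sev_ext_deriv[OF F \<open>open U\<close>], of X 0 V W] X by simp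
  then have "(\<lambda>h. (ext_deriv F (X + h *s V) W - ext_deriv F X W) / h) \<midarrow>0\<rightarrow>
      ext_deriv (\<lambda>Y. ext_deriv F Y W) X V"
    by (simp add: DERIV_def)
  moreover have "filterlim (\<lambda>m. 1 / of_nat m :: complex) (at 0) sequentially"
    unfolding filterlim_at using lim_1_over_n eventually_gt_at_top[of 0]
    by (auto elim!: eventually_mono)
  ultimately have "(\<lambda>m. (ext_deriv F (X + (1 / of_nat m) *s V) W - ext_deriv F X W) / (1 / of_nat m))
      \<longlonglongrightarrow> ext_deriv (\<lambda>Y. ext_deriv F Y W) X V"
    by (rule filterlim_compose)
  then show "?Q \<longlonglongrightarrow> ext_deriv (\<lambda>Y. ext_deriv F Y W) X V" by (simp add: mult.commute)
qed

section \<open>Logarithms and their growth\<close>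

text \<open>Near u the values of l differ from \<open>l u\<close> by less than 1, hence by less than
  pi, so l coincides there with the principal branch \<open>l u + Ln (g x / g u)\<close>.\<close>

lemma has_derivative_logarithm:
  fixes g :: "'a::real_normed_vector \<Rightarrow> complex"
  assumes "open S" "u \<in> S" "continuous_on S l" "\<And>x. x \<in> S \<Longrightarrow> exp (l x) = g x"
    and g: "(g has_derivative g') (at u)"
  shows "(l has_derivative (\<lambda>v. g' v / g u)) (at u)"
proof -
  have "isCont l u" using assms continuous_on_eq_continuous_at by blast
  then obtain d where d: "d > 0" "\<And>x. dist x u < d \<Longrightarrow> dist (l x) (l u) < 1"
    unfolding continuous_at_eps_delta by (metis zero_less_one)
  have g0: "g u \<noteq> 0" using assms(4)[OF \<open>u \<in> S\<close>] by (metis exp_not_eq_zero)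
  have eq: "l u + Ln (g x / g u) = l x" if "x \<in> S \<inter> ball u d" for x
  proof -
    have "norm (l x - l u) < 1" using d(2)[of x] that by (simp add: dist_norm norm_minus_commute)
    then have "\<bar>Im (l x - l u)\<bar> < 1" using abs_Im_le_cmod order.strict_trans1 by blast
    then have "Ln (exp (l x - l u)) = l x - l u" using pi_gt3 by (intro Ln_exp) auto
    then show ?thesis using that assms(2,4) by (simp add: exp_diff)
  qed
  have "((\<lambda>x. Ln (g x / g u)) has_derivative (\<lambda>v. (g' v / g u) * inverse 1)) (at u)"
  proof -
    have "((\<lambda>x. g x / g u) has_derivative (\<lambda>v. g' v / g u)) (at u)"
      using bounded_linear.has_derivative[OF bounded_linear_divide g] .
    moreover have "(Ln has_derivative (\<lambda>h. h)) (at (g u / g u))"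
      using g0 has_field_derivative_Ln[of 1]
      by (simp add: has_field_derivative_def mult_1_left[abs_def])
    ultimately show ?thesis
      using diff_chain_at[of "\<lambda>x. g x / g u" "\<lambda>v. g' v / g u" u Ln "\<lambda>h. h"] g0
      by (simp add: o_def)
  qed
  then have "((\<lambda>x. l u + Ln (g x / g u)) has_derivative (\<lambda>v. g' v / g u)) (at u)"
    by (auto intro!: derivative_eq_intros)
  then show ?thesis
    by (rule has_derivative_transform_within_open[of _ _ _ _ "S \<inter> ball u d"])
       (use eq assms(1,2) d in auto)
qed

lemma holomorphic_sev_logarithm:
  fixes g :: "complex ^ 'k::finite \<Rightarrow> complex"
  assumes "open S" "convex S" and g: "holomorphic_sev g S" and "\<And>x. x \<in> S \<Longrightarrow> g x \<noteq> 0"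
  obtains l where "holomorphic_sev l S" "\<And>x. x \<in> S \<Longrightarrow> exp (l x) = g x"
proof -
  obtain l where l: "continuous_on S l" "\<And>x. x \<in> S \<Longrightarrow> g x = exp (l x)"
    using continuous_logarithm_on_contractible[of S g] assms convex_imp_contractible
      holomorphic_sev_continuous_on by metis
  have "holomorphic_sev l S"
    by (rule holomorphic_sevI[OF has_derivative_logarithm[OF \<open>open S\<close> _ l(1)]])
       (auto simp: l(2) holomorphic_sev_ext_deriv_scale[OF g] simp flip: l(2)
          intro: holomorphic_sev_has_derivative[OF g])
  with l that show thesis by metis
qed

text \<open>Schwarz's lemma for maps between half planes, in the form of a linear growth bound.\<close>

lemma half_plane_linear_growth:
  assumes H: "H holomorphic_on {z. Re z > 0}" and m: "\<And>z. Re z > 0 \<Longrightarrow> Re (H z) \<le> m" and "t \<ge> 1"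
  shows "norm (H (of_real t)) \<le> t * (norm (H 1) + 2 * (\<bar>m\<bar> + 1))"
proof -
  \<comment> \<open>The shift by m + 1 puts the values strictly into the left half plane.
    \<open>c\<close> is the Cayley transform of the unit disc to the right half plane, and
    \<open>k\<close> follows \<open>G\<close> and \<open>c\<close> by the Moebius map of the left
    half plane to the disc sending \<open>w0\<close> to 0, so that Schwarz's lemma applies to
    \<open>k\<close>.\<close>
  define G where "G z = H z - of_real (m + 1)" for z
  define w0 where "w0 = G 1"
  define c where "c \<xi> = (1 + \<xi>) / (1 - \<xi>)" for \<xi> :: complex
  define k where "k \<xi> = (G (c \<xi>) - w0) / (G (c \<xi>) + cnj w0)" for \<xi>
  have ReG: "Re (G z) < 0" if "Re z > 0" for z using m[OF that] by (simp add: G_def)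
  have w0: "Re w0 < 0" unfolding w0_def by (rule ReG) simp
  have c_pos: "Re (c \<xi>) > 0" if "norm \<xi> < 1" for \<xi>
  proof -
    have "(Re \<xi>)\<^sup>2 + (Im \<xi>)\<^sup>2 < 1"
      using that by (simp add: cmod_def)
    moreover have "\<xi> \<noteq> 1" using that by auto
    then have "(1 - Re \<xi>)\<^sup>2 + (Im \<xi>)\<^sup>2 > 0"
      by (metis complex_eq_iff diff_eq_diff_eq diff_self one_complex.sel sum_power2_gt_zero_iff
          eq_iff_diff_eq_0)
    ultimately show ?thesis
      unfolding c_def Re_divide
      by (simp add: power2_eq_square algebra_simps divide_simps)
  qed
  have den: "G (c \<xi>) + cnj w0 \<noteq> 0" if "norm \<xi> < 1" for \<xi>
  proof -
    have "Re (G (c \<xi>) + cnj w0) < 0" using ReG[OF c_pos[OF that]] w0 by simp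
    then show ?thesis by (metis less_irrefl zero_complex.sel(1))
  qed
  have k_small: "norm (k \<xi>) < 1" if "norm \<xi> < 1" for \<xi>
  proof -
    have "(Re (G (c \<xi>) - w0))\<^sup>2 < (Re (G (c \<xi>) + cnj w0))\<^sup>2"
    proof -
      have "Re (G (c \<xi>)) * Re w0 > 0"
        using ReG[OF c_pos[OF that]] w0 by (simp add: mult_neg_neg)
      then show ?thesis by (simp add: power2_eq_square algebra_simps)
    qed
    then have "norm (G (c \<xi>) - w0) < norm (G (c \<xi>) + cnj w0)"
      by (simp add: cmod_def)
    then show ?thesis using den[OF that] by (simp add: k_def norm_divide)
  qed
  have c0: "c 0 = 1" by (simp add: c_def)
  define \<xi> where "\<xi> = complex_of_real ((t - 1) / (t + 1))"
  have nx: "norm \<xi> = (t - 1) / (t + 1)" using \<open>t \<ge> 1\<close> by (simp add: \<xi>_def del: of_real_divide)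
  have x1: "norm \<xi> < 1" using \<open>t \<ge> 1\<close> by (simp add: nx)
  have ct: "c \<xi> = of_real t"
  proof -
    have "c \<xi> = of_real ((1 + (t - 1) / (t + 1)) / (1 - (t - 1) / (t + 1)))"
      by (simp add: c_def \<xi>_def)
    also have "(1 + (t - 1) / (t + 1)) / (1 - (t - 1) / (t + 1)) = t"
      using \<open>t \<ge> 1\<close> by (simp add: field_simps)
    finally show ?thesis .
  qed
  have "norm (k \<xi>) \<le> norm \<xi>"
  proof (rule Schwarz_Lemma(1)[OF _ _ k_small x1])
    have c_hol: "c holomorphic_on ball 0 1"
      unfolding c_def by (intro holomorphic_intros) auto
    have "G holomorphic_on {z. Re z > 0}"
      unfolding G_def by (intro holomorphic_intros H)
    then have "(G \<circ> c) holomorphic_on ball 0 1"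
      using c_pos by (intro holomorphic_on_compose_gen[OF c_hol]) auto
    then have "(\<lambda>\<xi>. G (c \<xi>)) holomorphic_on ball 0 1" by (simp add: o_def)
    then show "k holomorphic_on ball 0 1"
      unfolding k_def using den by (intro holomorphic_intros) auto
    show "k 0 = 0" by (simp add: k_def c0 w0_def)
  qed
  then have kx: "norm (k \<xi>) \<le> (t - 1) / (t + 1)" by (simp add: nx)
  \<comment> \<open>Solving for G gives |G| <= |w0| (1 + |k|) / (1 - |k|), and |k| <= (t - 1) / (t +
    1) turns the last quotient into t.\<close>
  have "G (c \<xi>) * (1 - k \<xi>) = w0 + k \<xi> * cnj w0"
    using den[OF x1] by (simp add: k_def field_simps)
  then have "norm (G (c \<xi>)) * norm (1 - k \<xi>) \<le> norm w0 + norm (k \<xi>) * norm w0"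
    by (metis complex_mod_cnj norm_mult norm_triangle_ineq)
  also have "\<dots> \<le> norm w0 * (2 * t / (t + 1))"
  proof -
    have "norm (k \<xi>) * norm w0 \<le> (t - 1) / (t + 1) * norm w0"
      using kx by (intro mult_right_mono) auto
    then show ?thesis using \<open>t \<ge> 1\<close> by (simp add: field_simps)
  qed
  finally have 1: "norm (G (c \<xi>)) * norm (1 - k \<xi>) \<le> norm w0 * (2 * t / (t + 1))" .
  have "1 - (t - 1) / (t + 1) \<le> norm (1 - k \<xi>)"
    using kx norm_triangle_ineq2[of 1 "k \<xi>"] by simp
  then have "2 / (t + 1) \<le> norm (1 - k \<xi>)" using \<open>t \<ge> 1\<close> by (simp add: field_simps)
  then have "norm (G (c \<xi>)) * (2 / (t + 1)) \<le> norm (G (c \<xi>)) * norm (1 - k \<xi>)"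
    by (intro mult_left_mono) auto
  with 1 have "norm (G (c \<xi>)) * (2 / (t + 1)) \<le> (t * norm w0) * (2 / (t + 1))"
    by (simp add: mult_ac)
  then have "norm (G (c \<xi>)) \<le> t * norm w0"
    by (rule mult_right_le_imp_le) (use \<open>t \<ge> 1\<close> in simp)
  moreover have "norm w0 \<le> norm (H 1) + (\<bar>m\<bar> + 1)"
  proof -
    have "norm w0 \<le> norm (H 1) + norm (complex_of_real (m + 1))"
      unfolding w0_def G_def by (rule norm_triangle_ineq4)
    then show ?thesis by (simp del: of_real_add)
  qed
  then have "t * norm w0 \<le> t * (norm (H 1) + (\<bar>m\<bar> + 1))" using \<open>t \<ge> 1\<close> by (intro mult_left_mono) auto
  moreover have "norm (H (of_real t)) \<le> norm (G (c \<xi>)) + (\<bar>m\<bar> + 1)"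
  proof -
    have "norm (H (of_real t)) = norm (G (c \<xi>) + complex_of_real (m + 1))"
      by (simp add: G_def ct)
    also have "\<dots> \<le> norm (G (c \<xi>)) + norm (complex_of_real (m + 1))" by (rule norm_triangle_ineq)
    finally show ?thesis by (simp del: of_real_add)
  qed
  moreover have "\<bar>m\<bar> + 1 \<le> t * (\<bar>m\<bar> + 1)"
    using mult_right_mono[OF \<open>t \<ge> 1\<close>, of "\<bar>m\<bar> + 1"] by simp
  ultimately show ?thesis by (simp add: algebra_simps)
qed

text \<open>
  The universal cover of the complement of the hyperplanes \<open>w $ i = 0\<close>, \<open>i \<in> K\<close>, in a polydisc of
  radius \<open>exp (- c)\<close>, with \<open>u $ i\<close> a logarithm of \<open>w $ i\<close> for \<open>i \<in> K\<close>.
\<close>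

definition log_polydisc :: "'k set \<Rightarrow> real \<Rightarrow> (complex ^ 'k::finite) set"
  where "log_polydisc K c = {u. \<forall>i. if i \<in> K then Re (u $ i) < - c else norm (u $ i) < exp (- c)}"

section \<open>Growth of logarithms on the universal cover\<close>

lemma open_log_polydisc: "open (log_polydisc K c)"
proof -
  have "log_polydisc K c = (\<Inter>i. {u. if i \<in> K then Re (u $ i) < - c else norm (u $ i) < exp (- c)})"
    by (auto simp: log_polydisc_def)
  also have "open \<dots>"
  proof (intro open_INT ballI)
    fix i
    show "open {u :: complex ^ 'a. if i \<in> K then Re (u $ i) < - c else norm (u $ i) < exp (- c)}"
      by (cases "i \<in> K") (auto intro!: open_Collect_less continuous_intros)
  qed simp
  finally show ?thesis .
qed

lemma convex_log_polydisc: "convex (log_polydisc K c)"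
  unfolding convex_alt
proof (intro ballI allI impI)
  fix x y :: "complex ^ 'a" and s :: real
  assume xy: "x \<in> log_polydisc K c" "y \<in> log_polydisc K c" and s: "0 \<le> s \<and> s \<le> 1"
  have "if i \<in> K then Re (((1 - s) *\<^sub>R x + s *\<^sub>R y) $ i) < - c
      else norm (((1 - s) *\<^sub>R x + s *\<^sub>R y) $ i) < exp (- c)" for i
  proof (cases "i \<in> K")
    case True
    then show ?thesis using xy s convex_bound_lt[of "Re (x $ i)" "- c" "Re (y $ i)" "1 - s" s]
      by (auto simp: log_polydisc_def dest!: spec[of _ i])
  next
    case False
    have "norm (((1 - s) *\<^sub>R x + s *\<^sub>R y) $ i) \<le> (1 - s) * norm (x $ i) + s * norm (y $ i)"
      using norm_triangle_ineq[of "(1 - s) *\<^sub>R x $ i" "s *\<^sub>R y $ i"] s by simp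
    also have "\<dots> < exp (- c)"
      using False xy s convex_bound_lt[of "norm (x $ i)" "exp (- c)" "norm (y $ i)" "1 - s" s]
      by (auto simp: log_polydisc_def dest!: spec[of _ i])
    finally show ?thesis using False by simp
  qed
  then show "(1 - s) *\<^sub>R x + s *\<^sub>R y \<in> log_polydisc K c"
    unfolding log_polydisc_def by blast
qed

lemma log_polydisc_1_subset: "log_polydisc K 1 \<subseteq> (log_polydisc K 0 :: (complex ^ 'k::finite) set)"
proof
  fix x :: "complex ^ 'k" assume x: "x \<in> log_polydisc K 1"
  have "r < 1" if "r < exp (- 1)" for r :: real
    using that by (rule order.strict_trans) simp
  then have "if i \<in> K then Re (x $ i) < - 0 else norm (x $ i) < exp (- 0)" for i
    using x unfolding log_polydisc_def mem_Collect_eq by (auto dest!: spec[of _ i] split: if_splits)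
  then show "x \<in> log_polydisc K 0" unfolding log_polydisc_def by blast
qed

lemma compact_vec_Pi:
  fixes T :: "'k::finite \<Rightarrow> complex set"
  assumes "\<And>i. compact (T i)"
  shows "compact {u :: complex ^ 'k. \<forall>i. u $ i \<in> T i}"
proof -
  have "closed (\<Inter>i. (\<lambda>u :: complex ^ 'k. u $ i) -` T i)"
    by (intro closed_INT ballI continuous_closed_vimage compact_imp_closed assms)
       (auto intro: continuous_intros)
  then have "closed {u :: complex ^ 'k. \<forall>i. u $ i \<in> T i}"
    by (simp add: vimage_def Collect_all_eq)
  moreover have "bounded {u :: complex ^ 'k. \<forall>i. u $ i \<in> T i}"
  proof -
    have "\<forall>i. \<exists>M. \<forall>z\<in>T i. norm z \<le> M" using assms compact_imp_bounded bounded_iff by blast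
    then obtain M where M: "\<And>i z. z \<in> T i \<Longrightarrow> norm z \<le> M i" by metis
    have "norm u \<le> (\<Sum>i\<in>UNIV. M i)" if "\<forall>i. u $ i \<in> T i" for u :: "complex ^ 'k"
    proof -
      have "norm u \<le> (\<Sum>i\<in>UNIV. norm (u $ i))"
        unfolding norm_vec_def by (rule L2_set_le_sum) auto
      also have "\<dots> \<le> (\<Sum>i\<in>UNIV. M i)" using that M by (intro sum_mono) auto
      finally show ?thesis .
    qed
    then show ?thesis unfolding bounded_iff by blast
  qed
  ultimately show ?thesis by (simp add: compact_eq_bounded_closed)
qed

text \<open>Each u in question lies, with a point v of a compact set, on a complex half plane inside
  \<open>log_polydisc K 1\<close>. On the compact set l is bounded by continuity, and
  \<open>half_plane_linear_growth\<close> controls it from v to u. The bounds on the imaginary parts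
  make the set compact.\<close>

lemma log_polydisc_linear_growth:
  fixes l :: "complex ^ 'k::finite \<Rightarrow> complex"
  assumes l: "holomorphic_sev l (log_polydisc K 0)"
    and m: "\<And>u. u \<in> log_polydisc K 1 \<Longrightarrow> Re (l u) \<le> m"
  shows "\<exists>C\<ge>0. \<forall>u. (\<forall>i. if i \<in> K then Re (u $ i) \<le> - 2 \<and> a i \<le> Im (u $ i) \<and> Im (u $ i) \<le> b i
        else norm (u $ i) \<le> exp (- 2)) \<longrightarrow>
      norm (l u) \<le> C * (1 + (\<Sum>i\<in>K. - Re (u $ i)))"
proof -
  define T where "T i = (if i \<in> K then cbox (Complex (- 2) (a i)) (Complex (- 2) (b i))
      else cball 0 (exp (- 2)))" for i
  define Base where "Base = {u :: complex ^ 'k. \<forall>i. u $ i \<in> T i}"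
  have "compact Base" unfolding Base_def by (rule compact_vec_Pi) (simp add: T_def)
  have Base_sub: "Base \<subseteq> log_polydisc K 0"
  proof
    fix u assume u: "u \<in> Base"
    have "if i \<in> K then Re (u $ i) < - 0 else norm (u $ i) < exp (- 0)" for i
    proof (cases "i \<in> K")
      case True
      then show ?thesis using u
        by (auto simp: Base_def T_def in_cbox_complex_iff dest!: spec[of _ i])
    next
      case False
      then have "norm (u $ i) \<le> exp (- 2)" using u by (auto simp: Base_def T_def dest!: spec[of _ i])
      also have "\<dots> < exp (- 0 :: real)" by simp
      finally show ?thesis using False by simp
    qed
    then show "u \<in> log_polydisc K 0" unfolding log_polydisc_def by blast
  qed
  have "compact (l ` Base)"
    using \<open>compact Base\<close> Base_sub holomorphic_sev_continuous_on[OF l]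
    by (meson compact_continuous_image continuous_on_subset)
  then obtain B0 where B0: "\<And>u. u \<in> Base \<Longrightarrow> norm (l u) \<le> B0"
    using compact_imp_bounded by (fastforce simp: bounded_iff)
  define C where "C = \<bar>B0\<bar> + 2 * (\<bar>m\<bar> + 1)"
  have "norm (l u) \<le> 2 * C * (1 + (\<Sum>i\<in>K. - Re (u $ i)))"
    if u: "\<forall>i. if i \<in> K then Re (u $ i) \<le> - 2 \<and> a i \<le> Im (u $ i) \<and> Im (u $ i) \<le> b i
        else norm (u $ i) \<le> exp (- 2)" for u
  proof -
    define v where "v = (\<chi> i. if i \<in> K then Complex (- 2) (Im (u $ i)) else u $ i)"
    define d where "d = (\<chi> i. if i \<in> K then complex_of_real (Re (u $ i) + 2) else 0)"
    \<comment> \<open>\<open>D\<close> exceeds every depth - Re (u $ i) - 2. Moving by (z - 1) / D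
      with Re z > 0 therefore raises a real part from - 2 by less than 1, and the half plane stays
      inside \<open>log_polydisc K 1\<close>.\<close>
    define D where "D = 1 + (\<Sum>i\<in>K. - Re (u $ i) - 2)"
    have u2: "Re (u $ i) \<le> - 2" if "i \<in> K" for i
      using u[rule_format, of i] that by simp
    have D1: "(\<Sum>i\<in>K. - Re (u $ i) - 2) \<ge> 0"
      using u2 by (intro sum_nonneg) fastforce
    then have Dpos: "D > 0" by (simp add: D_def)
    have Di: "- Re (u $ i) - 2 < D" if "i \<in> K" for i
    proof -
      have "- Re (u $ i) - 2 \<le> (\<Sum>i\<in>K. - Re (u $ i) - 2)"
        by (rule member_le_sum) (use that u2 in fastforce)+
      then show ?thesis by (simp add: D_def)
    qed
    \<comment> \<open>z = 1 is the base point v and z = 1 + D is u.\<close>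
    define H where "H z = l (v + ((z - 1) / of_real D) *s d)" for z
    have vB: "v \<in> Base"
      using u by (auto simp: Base_def T_def v_def in_cbox_complex_iff)
    have in1: "v + ((z - 1) / of_real D) *s d \<in> log_polydisc K 1" if "Re z > 0" for z
    proof -
      have "if i \<in> K then Re ((v + ((z - 1) / of_real D) *s d) $ i) < - 1
          else norm ((v + ((z - 1) / of_real D) *s d) $ i) < exp (- 1)" for i
      proof (cases "i \<in> K")
        case True
        define e where "e = - (Re (u $ i) + 2)"
        have e: "e \<ge> 0" "e < D" using u2[OF True] Di[OF True] by (auto simp: e_def)
        have "Re ((v + ((z - 1) / of_real D) *s d) $ i) = - 2 - (Re z - 1) / D * e"
          using True by (simp add: v_def d_def e_def Re_divide_of_real algebra_simps)
            (simp flip: add_divide_distrib)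
        also have "\<dots> < - 1"
        proof -
          have "(1 - Re z) * e \<le> 1 * e" using that e by (intro mult_right_mono) auto
          then have "(1 - Re z) * e < D" using e by linarith
          then have "(1 - Re z) * e / D < 1" using e by simp
          then show ?thesis by (simp add: diff_divide_distrib left_diff_distrib)
        qed
        finally show ?thesis using True by simp
      next
        case False
        then have "norm ((v + ((z - 1) / of_real D) *s d) $ i) \<le> exp (- 2)"
          using u by (auto simp: v_def d_def split: if_splits)
        also have "\<dots> < exp (- 1 :: real)" by simp
        finally show ?thesis using False by simp
      qed
      then show ?thesis unfolding log_polydisc_def by blast
    qed
    have "norm (H (of_real (1 + D))) \<le> (1 + D) * (norm (H 1) + 2 * (\<bar>m\<bar> + 1))"
    proof (rule half_plane_linear_growth)
      have "(H has_field_derivative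
          ext_deriv l (v + ((z - 1) / of_real D) *s d) d * (1 / of_real D)) (at z)" if "Re z > 0" for z
        unfolding H_def
        by (rule DERIV_chain2[where f = "\<lambda>z. l (v + z *s d)" and g = "\<lambda>z. (z - 1) / of_real D"])
           (use log_polydisc_1_subset in1[OF that] Dpos in \<open>auto intro!: holomorphic_sev_on_line[OF l] derivative_eq_intros\<close>)
      then show "H holomorphic_on {z. Re z > 0}"
        by (subst holomorphic_on_open) (auto simp: open_halfspace_Re_gt)
      show "Re (H z) \<le> m" if "Re z > 0" for z
        unfolding H_def by (rule m[OF in1[OF that]])
      show "1 + D \<ge> 1" using D1 by (simp add: D_def)
    qed
    moreover have "H 1 = l v" by (simp add: H_def)
    moreover have "H (of_real (1 + D)) = l u"
    proof -
      have "v + ((of_real (1 + D) - 1) / of_real D) *s d = u"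
        using D1 by (auto simp: v_def d_def D_def vec_eq_iff complex_eq_iff)
      then show ?thesis by (simp add: H_def)
    qed
    moreover have "(1 + D) * (norm (l v) + 2 * (\<bar>m\<bar> + 1)) \<le> (1 + D) * C"
      using B0[OF vB] D1 by (intro mult_left_mono) (auto simp: C_def D_def)
    moreover have "(1 + D) * C \<le> (2 * (1 + (\<Sum>i\<in>K. - Re (u $ i)))) * C"
    proof (rule mult_right_mono)
      have "(\<Sum>i\<in>K. - Re (u $ i) - 2) \<le> (\<Sum>i\<in>K. - Re (u $ i))" by (intro sum_mono) auto
      then show "1 + D \<le> 2 * (1 + (\<Sum>i\<in>K. - Re (u $ i)))"
        using D1 by (simp add: D_def)
    qed (simp add: C_def)
    ultimately show ?thesis by (simp add: algebra_simps)
  qed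
  then show ?thesis by (intro exI[of _ "2 * C"]) (auto simp: C_def)
qed

section \<open>The connection matrix in homogeneous coordinates\<close>

definition hx :: "(nat \<Rightarrow> 'n::finite) \<Rightarrow> 'n homog \<Rightarrow> complex" where "hx e X = X $ Some (e 0)"
definition hy :: "(nat \<Rightarrow> 'n::finite) \<Rightarrow> 'n homog \<Rightarrow> complex" where "hy e X = X $ Some (e 1)"
definition ht :: "'n::finite homog \<Rightarrow> complex" where "ht X = X $ None"

definition fhom :: "(nat \<Rightarrow> 'n::finite) \<Rightarrow> 'n homog \<Rightarrow> complex"
  where "fhom e X = fpoly (hx e X) (hy e X) (ht X)"

text \<open>
  Up to a factor 4, the forms \<open>(linf e k X)\<^sup>2 - fhom e X\<close> are \<open>xy\<close>, \<open>yt\<close>, \<open>xt\<close> for \<open>k = 0, 1, 2\<close>; for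
  \<open>k = i + 2 \<ge> 3\<close> the form \<open>linf e k\<close> is the coordinate \<open>z\<^sub>i\<close>.
\<close>

definition linf :: "(nat \<Rightarrow> 'n::finite) \<Rightarrow> nat \<Rightarrow> 'n homog \<Rightarrow> complex"
  where "linf e k X =
    (if k = 0 then ht X - hx e X - hy e X else if k = 1 then hx e X - hy e X - ht X
     else if k = 2 then hy e X - hx e X - ht X else X $ Some (e (k - 1)))"

definition dfhom :: "(nat \<Rightarrow> 'n::finite) \<Rightarrow> 'n homog \<Rightarrow> 'n homog \<Rightarrow> complex"
  where "dfhom e X V = 2 * (linf e 1 X * hx e V + linf e 2 X * hy e V + linf e 0 X * ht V)"

text \<open>\<open>sig e k / sqrt f\<close> is half the logarithmic derivative of \<open>(linf e k + sqrt f) / (linf e k - sqrt f)\<close>.\<close>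

definition sig :: "(nat \<Rightarrow> 'n::finite) \<Rightarrow> nat \<Rightarrow> 'n homog \<Rightarrow> 'n homog \<Rightarrow> complex"
  where "sig e k X V =
    (linf e k X * dfhom e X V / 2 - fhom e X * linf e k V) / ((linf e k X)\<^sup>2 - fhom e X)"

text \<open>With \<open>c = coeff_lam e lam\<close> this is, at generic points, \<open>ht X\<close>
  times the scalar form \<omega> of the overview.\<close>

definition tau :: "(nat \<Rightarrow> 'n::finite) \<Rightarrow> (nat \<Rightarrow> complex) \<Rightarrow> 'n homog \<Rightarrow> 'n homog \<Rightarrow> complex"
  where "tau e c X V = (\<Sum>k\<le>CARD('n). c k * sig e k X V)"

text \<open>The form \<open>sig e 0\<close> does not occur in the connection. Its index is reserved
  because the linear relation \<open>sig_sum\<close> allows weight to be moved to it.\<close>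

definition coeff_lam :: "(nat \<Rightarrow> 'n::finite) \<Rightarrow> complex ^ 'n \<Rightarrow> nat \<Rightarrow> complex"
  where "coeff_lam e lam k = (if k = 0 then 0 else if k = 1 then - (lam $ e 0) else lam $ e (k - 1))"

definition conn11 :: "(nat \<Rightarrow> 'n::finite) \<Rightarrow> (nat \<Rightarrow> complex) \<Rightarrow> 'n homog \<Rightarrow> 'n homog \<Rightarrow> complex"
  where "conn11 e c X V = - dfhom e X V / (4 * fhom e X) + hy e V / (2 * hy e X)
    - (hx e X - ht X) * tau e c X V / fhom e X"

definition conn12 :: "(nat \<Rightarrow> 'n::finite) \<Rightarrow> (nat \<Rightarrow> complex) \<Rightarrow> 'n homog \<Rightarrow> 'n homog \<Rightarrow> complex"
  where "conn12 e c X V = (hx e V - ht V) / hy e X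
    - (hx e X - ht X) * dfhom e X V / (2 * hy e X * fhom e X)
    + (fhom e X - (hx e X - ht X)\<^sup>2) * tau e c X V / (hy e X * fhom e X)"

definition conn21 :: "(nat \<Rightarrow> 'n::finite) \<Rightarrow> (nat \<Rightarrow> complex) \<Rightarrow> 'n homog \<Rightarrow> 'n homog \<Rightarrow> complex"
  where "conn21 e c X V = hy e X * tau e c X V / fhom e X"

text \<open>All candidates for components of the polar divisor are excluded at once, whatever
  \<open>lam\<close> is, so that every denominator can be cleared.\<close>

definition generic :: "(nat \<Rightarrow> 'n::finite) \<Rightarrow> 'n homog \<Rightarrow> bool"
  where "generic e X \<longleftrightarrow> hx e X \<noteq> 0 \<and> hy e X \<noteq> 0 \<and> ht X \<noteq> 0 \<and> fhom e X \<noteq> 0 \<and>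
    (\<forall>k\<in>{3..CARD('n)}. (linf e k X)\<^sup>2 \<noteq> fhom e X)"

lemma linf_simps [simp]:
  "linf e 0 X = ht X - hx e X - hy e X"
  "linf e (Suc 0) X = hx e X - hy e X - ht X"
  "linf e 2 X = hy e X - hx e X - ht X"
  by (simp_all add: linf_def)

lemma linf_coordinate: "k \<ge> 3 \<Longrightarrow> linf e k X = X $ Some (e (k - 1))"
  by (simp add: linf_def)

lemma linf_square_minus_fhom:
  "(linf e 0 X)\<^sup>2 - fhom e X = 4 * (hx e X * hy e X)"
  "(linf e 1 X)\<^sup>2 - fhom e X = 4 * (hy e X * ht X)"
  "(linf e 2 X)\<^sup>2 - fhom e X = 4 * (hx e X * ht X)"
  by (simp_all add: fhom_def fpoly_def power2_eq_square algebra_simps)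

lemma hom_linear:
  "hx e (X + Y) = hx e X + hx e Y" "hx e (c *s X) = c * hx e X"
  "hy e (X + Y) = hy e X + hy e Y" "hy e (c *s X) = c * hy e X"
  "ht (X + Y) = ht X + ht Y" "ht (c *s X) = c * ht X"
  "linf e k (X + Y) = linf e k X + linf e k Y" "linf e k (c *s X) = c * linf e k X"
  by (simp_all add: hx_def hy_def ht_def linf_def algebra_simps)

lemma dfhom_linear:
  "dfhom e X (V + W) = dfhom e X V + dfhom e X W" "dfhom e X (c *s V) = c * dfhom e X V"
  by (simp_all add: dfhom_def hom_linear algebra_simps)

lemma hom_has_derivative:
  assumes "(\<psi> has_derivative \<psi>') F"
  shows "((\<lambda>u. hx e (\<psi> u)) has_derivative (\<lambda>v. hx e (\<psi>' v))) F"
    "((\<lambda>u. hy e (\<psi> u)) has_derivative (\<lambda>v. hy e (\<psi>' v))) F"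
    "((\<lambda>u. ht (\<psi> u)) has_derivative (\<lambda>v. ht (\<psi>' v))) F"
    "((\<lambda>u. linf e k (\<psi> u)) has_derivative (\<lambda>v. linf e k (\<psi>' v))) F"
  unfolding hx_def hy_def ht_def linf_def
  by (cases "k = 0"; cases "k = 1"; cases "k = 2";
      auto intro!: derivative_intros assms bounded_linear.has_derivative[OF bounded_linear_vec_nth])+

lemma fhom_has_derivative:
  assumes "(\<psi> has_derivative \<psi>') (at u within S)"
  shows "((\<lambda>u. fhom e (\<psi> u)) has_derivative (\<lambda>v. dfhom e (\<psi> u) (\<psi>' v))) (at u within S)"
  unfolding fhom_def fpoly_def
  by (rule has_derivative_eq_rhs, (rule derivative_intros hom_has_derivative[OF assms])+)
     (auto simp: fun_eq_iff dfhom_def algebra_simps)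

lemma hom_tendsto [tendsto_intros]:
  assumes "(\<psi> \<longlongrightarrow> X) F"
  shows "((\<lambda>u. hx e (\<psi> u)) \<longlongrightarrow> hx e X) F" "((\<lambda>u. hy e (\<psi> u)) \<longlongrightarrow> hy e X) F"
    "((\<lambda>u. ht (\<psi> u)) \<longlongrightarrow> ht X) F" "((\<lambda>u. linf e k (\<psi> u)) \<longlongrightarrow> linf e k X) F"
    "((\<lambda>u. fhom e (\<psi> u)) \<longlongrightarrow> fhom e X) F" "((\<lambda>u. dfhom e (\<psi> u) V) \<longlongrightarrow> dfhom e X V) F"
  unfolding hx_def hy_def ht_def linf_def fhom_def fpoly_def dfhom_def
  by (auto intro!: tendsto_intros assms)

lemma sig_tendsto [tendsto_intros]:
  assumes "(\<psi> \<longlongrightarrow> X) F" "(linf e k X)\<^sup>2 \<noteq> fhom e X"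
  shows "((\<lambda>u. sig e k (\<psi> u) V) \<longlongrightarrow> sig e k X V) F"
  unfolding sig_def using assms by (auto intro!: tendsto_intros)

lemma tau_tendsto:
  fixes X :: "'n::finite homog"
  assumes "(\<psi> \<longlongrightarrow> X) F" "\<And>k. k \<le> CARD('n) \<Longrightarrow> c k \<noteq> 0 \<Longrightarrow> (linf e k X)\<^sup>2 \<noteq> fhom e X"
  shows "((\<lambda>u. tau e c (\<psi> u) V) \<longlongrightarrow> tau e c X V) F"
  unfolding tau_def
proof (rule tendsto_sum)
  fix k assume "k \<in> {..CARD('n)}"
  then show "((\<lambda>u. c k * sig e k (\<psi> u) V) \<longlongrightarrow> c k * sig e k X V) F"
    using assms by (cases "c k = 0") (auto intro!: tendsto_intros)
qed

lemma tau_split: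
  assumes "CARD('n) \<ge> 2"
  shows "tau e c (X :: 'n::finite homog) V = c 0 * sig e 0 X V + c 1 * sig e 1 X V + c 2 * sig e 2 X V
    + (\<Sum>k=3..CARD('n). c k * sig e k X V)"
proof -
  have "{..CARD('n)} = insert 0 (insert 1 (insert 2 {3..CARD('n)}))" using assms by auto
  then show ?thesis unfolding tau_def by (simp add: add.assoc)
qed

lemma genericD:
  fixes X :: "'n::finite homog"
  assumes "generic e X"
  shows "hx e X \<noteq> 0" "hy e X \<noteq> 0" "ht X \<noteq> 0" "fhom e X \<noteq> 0"
    "k \<le> CARD('n) \<Longrightarrow> (linf e k X)\<^sup>2 \<noteq> fhom e X"
proof -
  show nz: "hx e X \<noteq> 0" "hy e X \<noteq> 0" "ht X \<noteq> 0" "fhom e X \<noteq> 0"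
    using assms by (auto simp: generic_def)
  assume k: "k \<le> CARD('n)"
  consider "k = 0" | "k = 1" | "k = 2" | "k \<ge> 3" by linarith
  then show "(linf e k X)\<^sup>2 \<noteq> fhom e X"
  proof cases
    case 4
    then show ?thesis using assms k by (simp add: generic_def)
  qed (use nz linf_square_minus_fhom[of e X] in fastforce)+
qed

text \<open>For k <= 2 the denominator of \<open>sig\<close> is a product of two coordinates, and
  this is the partial fraction decomposition. Its coefficients supply the residues along the
  coordinate hyperplanes.\<close>

lemma sig_formula:
  "hx e X \<noteq> 0 \<Longrightarrow> hy e X \<noteq> 0 \<Longrightarrow> sig e 0 X V =
    ht V + linf e 2 X * hx e V / (2 * hx e X) + linf e 1 X * hy e V / (2 * hy e X)"
  "hy e X \<noteq> 0 \<Longrightarrow> ht X \<noteq> 0 \<Longrightarrow> sig e 1 X V =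
    hx e V + linf e 0 X * hy e V / (2 * hy e X) + linf e 2 X * ht V / (2 * ht X)"
  "hx e X \<noteq> 0 \<Longrightarrow> ht X \<noteq> 0 \<Longrightarrow> sig e 2 X V =
    hy e V + linf e 0 X * hx e V / (2 * hx e X) + linf e 1 X * ht V / (2 * ht X)"
  unfolding sig_def linf_square_minus_fhom
  by (simp_all add: dfhom_def fhom_def fpoly_def divide_simps, simp_all add: power2_eq_square algebra_simps)

section \<open>From the affine forms to homogeneous coordinates\<close>

lemma aff_has_derivative:
  assumes "ht X \<noteq> 0"
  shows "(aff e j has_derivative
    (\<lambda>V. (V $ Some (e j) * ht X - X $ Some (e j) * ht V) / (ht X)\<^sup>2)) (at X)"
  unfolding aff_def ht_def
  by (rule has_derivative_eq_rhs, (rule derivative_intros bounded_linear.has_derivative[OF bounded_linear_vec_nth])+)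
     (use assms in \<open>auto simp: ht_def fun_eq_iff field_simps power2_eq_square\<close>)

lemma faff_eq: "ht X \<noteq> 0 \<Longrightarrow> faff e X = fhom e X / (ht X)\<^sup>2"
  by (simp add: faff_def aff_def fhom_def fpoly_def hx_def hy_def ht_def field_simps power2_eq_square)

lemma faff_has_derivative:
  assumes "ht X \<noteq> 0"
  shows "(faff e has_derivative
    (\<lambda>V. dfhom e X V / (ht X)\<^sup>2 - 2 * fhom e X * ht V / (ht X)^3)) (at X)"
proof -
  have fp: "((\<lambda>u. fpoly (x u) (y u) 1) has_derivative
      (\<lambda>v. (2 * x u - 2 * y u - 2) * x' v + (2 * y u - 2 * x u - 2) * y' v)) (at u)"
    if "(x has_derivative x') (at u)" "(y has_derivative y') (at u)"
    for x y :: "'a homog \<Rightarrow> complex" and x' y' u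
    unfolding fpoly_def
    by (rule has_derivative_eq_rhs, (rule derivative_intros that)+) (simp add: fun_eq_iff algebra_simps)
  have "(faff e has_derivative (\<lambda>V. (2 * aff e 0 X - 2 * aff e 1 X - 2) *
        ((hx e V * ht X - hx e X * ht V) / (ht X)\<^sup>2) + (2 * aff e 1 X - 2 * aff e 0 X - 2) *
        ((hy e V * ht X - hy e X * ht V) / (ht X)\<^sup>2))) (at X)"
    unfolding faff_def[abs_def] hx_def hy_def
    by (rule fp) (rule aff_has_derivative[OF assms])+
  then show ?thesis
    by (rule has_derivative_eq_rhs)
       (use assms in \<open>auto simp: fun_eq_iff aff_def dfhom_def fhom_def fpoly_def hx_def hy_def ht_def
          field_simps power2_eq_square power3_eq_cube\<close>)
qed

lemma alpha0_eq:
  assumes "hx e X \<noteq> 0" "hy e X \<noteq> 0" "ht X \<noteq> 0"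
  shows "alpha0 e lam X V = (- (lam $ e 0) * sig e 1 X V + lam $ e 1 * sig e 2 X V) / ht X"
  using assms
  unfolding alpha0_def Let_def ext_deriv_eq[OF aff_has_derivative[OF assms(3)]] aff_def
    sig_formula(2)[OF assms(2,3)] sig_formula(3)[OF assms(1,3)]
    hx_def[symmetric] hy_def[symmetric] ht_def[symmetric]
  by (simp add: divide_simps) (simp add: power2_eq_square algebra_simps)

lemma alpha0z_eq:
  assumes t: "ht X \<noteq> 0" and i: "i \<ge> 1" and z: "(linf e (i + 2) X)\<^sup>2 \<noteq> fhom e X"
  shows "alpha0z e lam i X V = lam $ e (i + 1) * sig e (i + 2) X V / ht X"
proof -
  define Z dZ where "Z = X $ Some (e (i + 1))" and "dZ = V $ Some (e (i + 1))"
  have Z: "linf e (i + 2) X = Z" "linf e (i + 2) V = dZ"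
    using i by (simp_all add: linf_coordinate Z_def dZ_def)
  have az: "aff e (i + 1) X = Z / ht X" by (simp add: aff_def Z_def ht_def)
  have dz: "ext_deriv (aff e (i + 1)) X V = (dZ * ht X - Z * ht V) / (ht X)\<^sup>2"
    by (simp add: ext_deriv_eq[OF aff_has_derivative[OF t]] Z_def dZ_def)
  have "((\<lambda>Q. faff e Q - (aff e (i + 1) Q)\<^sup>2) has_derivative
      (\<lambda>V. dfhom e X V / (ht X)\<^sup>2 - 2 * fhom e X * ht V / (ht X)^3 - 2 * aff e (i + 1) X *
        ((V $ Some (e (i + 1)) * ht X - X $ Some (e (i + 1)) * ht V) / (ht X)\<^sup>2))) (at X)"
    by (rule has_derivative_eq_rhs,
        (rule derivative_intros aff_has_derivative[OF t] faff_has_derivative[OF t])+)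
       (simp add: fun_eq_iff algebra_simps)
  from ext_deriv_eq[OF this] have df: "ext_deriv (\<lambda>Q. faff e Q - (aff e (i + 1) Q)\<^sup>2) X V = dfhom e X V / (ht X)\<^sup>2
      - 2 * fhom e X * ht V / (ht X)^3 - 2 * (Z / ht X) * ((dZ * ht X - Z * ht V) / (ht X)\<^sup>2)"
    unfolding az by (simp add: Z_def dZ_def)
  define F D T dT where "F = fhom e X" and "D = dfhom e X V" and "T = ht X" and "dT = ht V"
  have nz: "Z\<^sup>2 - F \<noteq> 0" "F - Z\<^sup>2 \<noteq> 0" "T \<noteq> 0" using z t unfolding Z F_def T_def by auto
  have "(dZ * T - Z * dT) / T\<^sup>2 - Z / T * (D / T\<^sup>2 - 2 * F * dT / T^3 - 2 * (Z / T) *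
      ((dZ * T - Z * dT) / T\<^sup>2)) / (2 * (F / T\<^sup>2 - (Z / T)\<^sup>2)) = (Z * D / 2 - F * dZ) / (Z\<^sup>2 - F) / T"
  proof -
    have "F / T\<^sup>2 - (Z / T)\<^sup>2 = (F - Z\<^sup>2) / T\<^sup>2" by (simp add: power_divide diff_divide_distrib)
    moreover have "Z / T * (D / T\<^sup>2 - 2 * F * dT / T^3 - 2 * (Z / T) * ((dZ * T - Z * dT) / T\<^sup>2))
        = Z * (D * T - 2 * F * dT - 2 * Z * (dZ * T - Z * dT)) / (T\<^sup>2 * T\<^sup>2)"
      using nz by (simp add: field_simps power2_eq_square power3_eq_cube)
    ultimately have "(dZ * T - Z * dT) / T\<^sup>2 - Z / T * (D / T\<^sup>2 - 2 * F * dT / T^3 - 2 * (Z / T) *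
      ((dZ * T - Z * dT) / T\<^sup>2)) / (2 * (F / T\<^sup>2 - (Z / T)\<^sup>2)) =
      (dZ * T - Z * dT) / T\<^sup>2 - Z * (D * T - 2 * F * dT - 2 * Z * (dZ * T - Z * dT)) / (T\<^sup>2 * T\<^sup>2) / (2 * ((F - Z\<^sup>2) / T\<^sup>2))"
      by simp
    also have "\<dots> = (2 * (dZ * T - Z * dT) * (F - Z\<^sup>2) - Z * (D * T - 2 * F * dT - 2 * Z * (dZ * T - Z * dT)))
        / (2 * T\<^sup>2 * (F - Z\<^sup>2))"
      using nz by (simp add: divide_simps) (simp add: numeral_eq_Suc algebra_simps)
    also have "\<dots> = (2 * F * dZ - Z * D) * T / (2 * T\<^sup>2 * (F - Z\<^sup>2))"
      by (simp add: power2_eq_square algebra_simps)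
    also have "\<dots> = (Z * D / 2 - F * dZ) / (Z\<^sup>2 - F) / T"
      using nz by (simp add: divide_simps) (simp add: power2_eq_square algebra_simps)
    finally show ?thesis .
  qed
  then show ?thesis
    unfolding alpha0z_def Let_def df dz az faff_eq[OF t] sig_def Z F_def D_def T_def dT_def
    by simp
qed

definition conn_mat :: "(nat \<Rightarrow> 'n::finite) \<Rightarrow> (nat \<Rightarrow> complex) \<Rightarrow> 'n matrix_form"
  where "conn_mat e c X V =
    vector [vector [conn11 e c X V, conn12 e c X V], vector [conn21 e c X V, - conn11 e c X V]]"

lemma conn_mat_nth [simp]:
  "conn_mat e c X V $ 1 $ 1 = conn11 e c X V" "conn_mat e c X V $ 1 $ 2 = conn12 e c X V"
  "conn_mat e c X V $ 2 $ 1 = conn21 e c X V" "conn_mat e c X V $ 2 $ 2 = - conn11 e c X V"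
  by (simp_all add: conn_mat_def)

text \<open>The entries are affine in the \<open>alpha\<close> forms, and each \<open>alpha2\<close>
  is \<open>- alpha0 / faff\<close>. So \<open>lam\<close> enters only through the sum
  \<open>w\<close> of all \<open>alpha0\<close> forms, which in homogeneous coordinates is
  \<open>tau / ht\<close>.\<close>

lemma A_lambda_generic:
  fixes X :: "'n::finite homog"
  assumes n: "CARD('n) \<ge> 2" and gen: "generic e X"
  shows "A_lambda e lam X V = conn_mat e (coeff_lam e lam) X V"
proof -
  note nz = genericD[OF gen]
  define w where "w = alpha0 e lam X V + (\<Sum>i=1..CARD('n) - 2. alpha0z e lam i X V)"
  define \<tau> where "\<tau> = tau e (coeff_lam e lam) X V"
  have "(\<Sum>i=1..CARD('n) - 2. alpha0z e lam i X V) =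
      (\<Sum>i=1..CARD('n) - 2. coeff_lam e lam (i + 2) * sig e (i + 2) X V) / ht X"
    unfolding sum_divide_distrib
  proof (rule sum.cong)
    fix i assume i: "i \<in> {1..CARD('n) - 2}"
    then have "i \<ge> 1" "i + 2 \<le> CARD('n)" by auto
    then show "alpha0z e lam i X V = coeff_lam e lam (i + 2) * sig e (i + 2) X V / ht X"
      using nz by (subst alpha0z_eq) (auto simp: coeff_lam_def)
  qed simp
  also have "(\<Sum>i=1..CARD('n) - 2. coeff_lam e lam (i + 2) * sig e (i + 2) X V) =
      (\<Sum>k=3..CARD('n). coeff_lam e lam k * sig e k X V)"
    by (rule sum.reindex_bij_witness[of _ "\<lambda>k. k - 2" "\<lambda>i. i + 2"]) auto
  finally have w: "w = \<tau> / ht X"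
    unfolding w_def \<tau>_def tau_split[OF n] alpha0_eq[OF nz(1-3)]
    by (simp add: coeff_lam_def add_divide_distrib)
  define x where "x = aff e 0 X"
  define y where "y = aff e 1 X"
  have a2: "alpha2 e lam X V + (\<Sum>i=1..CARD('n) - 2. alpha2z e lam i X V) = - (w / faff e X)"
    unfolding w_def alpha2_def alpha2z_def by (simp add: sum_negf sum_divide_distrib add_divide_distrib)
  have comp: "A_lambda e lam X V $ i $ j = A_base e lam X V $ i $ j + (\<Sum>k=1..CARD('n) - 2. A_z e lam k X V $ i $ j)"
    for i j by (simp add: A_lambda_def)
  have x: "x = hx e X / ht X" and y: "y = hy e X / ht X"
    by (simp_all add: x_def y_def aff_def hx_def hy_def ht_def)
  have dx: "ext_deriv (aff e 0) X V = (hx e V * ht X - hx e X * ht V) / (ht X)\<^sup>2"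
    and dy: "ext_deriv (aff e 1) X V = (hy e V * ht X - hy e X * ht V) / (ht X)\<^sup>2"
    by (simp_all add: ext_deriv_eq[OF aff_has_derivative[OF nz(3)]] hx_def hy_def)
  have a1: "alpha1 e X V = - dfhom e X V / (4 * fhom e X) + ht V / (2 * ht X)"
    unfolding alpha1_def ext_deriv_eq[OF faff_has_derivative[OF nz(3)]] faff_eq[OF nz(3)]
    using nz by (simp add: field_simps power2_eq_square power3_eq_cube)
  have wf: "w / faff e X = ht X * \<tau> / fhom e X"
    unfolding w faff_eq[OF nz(3)] by (simp add: power2_eq_square)
  have "A_lambda e lam X V $ 1 $ 1 = (x - 1) * (alpha2 e lam X V + (\<Sum>i=1..CARD('n) - 2. alpha2z e lam i X V))
      + alpha1 e X V + 1 / 2 * (ext_deriv (aff e 1) X V / y)"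
    unfolding comp by (simp add: A_base_def A_z_def Let_def x_def y_def sum_distrib_left algebra_simps)
  also have "\<dots> = conn11 e (coeff_lam e lam) X V"
    unfolding a2 wf a1 dy x y conn11_def \<tau>_def[symmetric] using nz
    by (simp add: field_simps power2_eq_square)
  finally have 1: "A_lambda e lam X V $ 1 $ 1 = conn11 e (coeff_lam e lam) X V" .
  have 2: "A_lambda e lam X V $ 2 $ 2 = - A_lambda e lam X V $ 1 $ 1"
    unfolding comp by (simp add: A_base_def A_z_def Let_def sum_negf)
  have "A_lambda e lam X V $ 2 $ 1 = - y * (alpha2 e lam X V + (\<Sum>i=1..CARD('n) - 2. alpha2z e lam i X V))"
    unfolding comp by (simp add: A_base_def A_z_def Let_def y_def sum_distrib_left sum_negf algebra_simps)
  also have "\<dots> = conn21 e (coeff_lam e lam) X V"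
    unfolding a2 wf y conn21_def \<tau>_def[symmetric] using nz by (simp add: field_simps)
  finally have 3: "A_lambda e lam X V $ 2 $ 1 = conn21 e (coeff_lam e lam) X V" .
  have "A_lambda e lam X V $ 1 $ 2 = (ext_deriv (aff e 0) X V
      + (x - 1)\<^sup>2 * (alpha2 e lam X V + (\<Sum>i=1..CARD('n) - 2. alpha2z e lam i X V))
      + 2 * (x - 1) * alpha1 e X V + w) / y"
    unfolding comp w_def
    by (simp add: A_base_def A_z_def Let_def x_def y_def sum_distrib_left sum.distrib
        add_divide_distrib distrib_left sum_divide_distrib)
  also have "\<dots> = conn12 e (coeff_lam e lam) X V"
    unfolding a2 wf unfolding w a1 dx x y conn12_def \<tau>_def[symmetric] using nz
    by (simp add: divide_simps) (simp add: power2_eq_square algebra_simps)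
  finally have 4: "A_lambda e lam X V $ 1 $ 2 = conn12 e (coeff_lam e lam) X V" .
  show ?thesis unfolding vec_eq_iff forall_2 using 1 2 3 4 by simp
qed

section \<open>Holomorphic extensions and the polar locus\<close>

definition is_polyfun :: "(complex \<Rightarrow> complex) \<Rightarrow> bool"
  where "is_polyfun f \<longleftrightarrow> (\<exists>p. \<forall>s. f s = poly p s)"

named_theorems polyfun_intros

lemma is_polyfun_const [polyfun_intros]: "is_polyfun (\<lambda>s. c)"
  unfolding is_polyfun_def by (rule exI[of _ "[:c:]"]) simp

lemma is_polyfun_id [polyfun_intros]: "is_polyfun (\<lambda>s. s)"
  unfolding is_polyfun_def by (rule exI[of _ "[:0, 1:]"]) simp

lemma is_polyfun_add [polyfun_intros]: "is_polyfun f \<Longrightarrow> is_polyfun g \<Longrightarrow> is_polyfun (\<lambda>s. f s + g s)"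
  unfolding is_polyfun_def by (metis poly_add)

lemma is_polyfun_diff [polyfun_intros]: "is_polyfun f \<Longrightarrow> is_polyfun g \<Longrightarrow> is_polyfun (\<lambda>s. f s - g s)"
  unfolding is_polyfun_def by (metis poly_diff)

lemma is_polyfun_mult [polyfun_intros]: "is_polyfun f \<Longrightarrow> is_polyfun g \<Longrightarrow> is_polyfun (\<lambda>s. f s * g s)"
  unfolding is_polyfun_def by (metis poly_mult)

lemma is_polyfun_power [polyfun_intros]: "is_polyfun f \<Longrightarrow> is_polyfun (\<lambda>s. f s ^ m)"
  unfolding is_polyfun_def by (metis poly_power)

lemma is_polyfun_isCont: "is_polyfun f \<Longrightarrow> isCont f s"
  unfolding is_polyfun_def by (metis continuous_poly continuous_ident ext)

text \<open>A nonzero polynomial has finitely many roots. This takes the place of an identity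
  theorem: along a polynomial curve, a condition valid at one explicit end point s = 1 holds
  arbitrarily close to the start s = 0.\<close>

lemma polyfun_eventually_nonzero:
  assumes "is_polyfun f" "f 1 \<noteq> 0"
  shows "\<forall>\<^sub>F s in at 0. f s \<noteq> 0"
proof -
  obtain p where p: "\<And>s. f s = poly p s" using assms(1) unfolding is_polyfun_def by blast
  with assms(2) have "p \<noteq> 0" by auto
  then have fin: "finite {s. f s = 0}" unfolding p by (rule poly_roots_finite)
  then have "open (- ({s. f s = 0} - {0}))" by (intro open_Compl finite_imp_closed) auto
  then show ?thesis by (rule eventually_at_topological[THEN iffD2, OF exI, of _ _, OF conjI]) auto
qed

definition polycurve :: "(complex \<Rightarrow> 'n::finite homog) \<Rightarrow> bool"
  where "polycurve \<gamma> \<longleftrightarrow> (\<forall>j. is_polyfun (\<lambda>s. \<gamma> s $ j))"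

lemma polycurve_tendsto:
  assumes "polycurve \<gamma>" shows "(\<gamma> \<longlongrightarrow> \<gamma> 0) (at 0)"
  using assms unfolding polycurve_def
  by (intro vec_tendstoI) (metis is_polyfun_isCont isCont_def)

lemma polycurve_hom [polyfun_intros]:
  assumes "polycurve \<gamma>"
  shows "is_polyfun (\<lambda>s. hx e (\<gamma> s))" "is_polyfun (\<lambda>s. hy e (\<gamma> s))" "is_polyfun (\<lambda>s. ht (\<gamma> s))"
    "is_polyfun (\<lambda>s. fhom e (\<gamma> s))" "is_polyfun (\<lambda>s. linf e k (\<gamma> s))"
proof -
  have c: "is_polyfun (\<lambda>s. \<gamma> s $ j)" for j using assms by (simp add: polycurve_def)
  show h: "is_polyfun (\<lambda>s. hx e (\<gamma> s))" "is_polyfun (\<lambda>s. hy e (\<gamma> s))" "is_polyfun (\<lambda>s. ht (\<gamma> s))"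
    unfolding hx_def hy_def ht_def by (rule c)+
  show "is_polyfun (\<lambda>s. fhom e (\<gamma> s))"
    unfolding fhom_def fpoly_def by (intro polyfun_intros h)
  show "is_polyfun (\<lambda>s. linf e k (\<gamma> s))"
    unfolding linf_def by (cases "k = 0"; cases "k = 1"; cases "k = 2") (auto intro!: polyfun_intros c h)
qed

lemma polycurve_line: "polycurve (\<lambda>s. X + s *s (W - X))"
  by (simp add: polycurve_def polyfun_intros)

lemma polycurve_eventually_in:
  assumes "polycurve \<gamma>" "open U" "\<gamma> 0 \<in> U"
  shows "\<forall>\<^sub>F s in at 0. \<gamma> s \<in> U"
  using polycurve_tendsto[OF assms(1)] assms(2,3) topological_tendstoD by blast

definition hpoint :: "(nat \<Rightarrow> 'n::finite) \<Rightarrow> complex \<Rightarrow> complex \<Rightarrow> complex \<Rightarrow> ('n \<Rightarrow> complex) \<Rightarrow> 'n homog"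
  where "hpoint e a b c z =
    (\<chi> j. case j of None \<Rightarrow> c | Some i \<Rightarrow> if i = e 0 then a else if i = e 1 then b else z i)"

locale numbering =
  fixes e :: "nat \<Rightarrow> 'n::finite"
  assumes card_ge_2: "CARD('n) \<ge> 2"
    and bij: "bij_betw e {..<CARD('n)} UNIV"
begin

lemma numbering_eq_iff: "j < CARD('n) \<Longrightarrow> k < CARD('n) \<Longrightarrow> e j = e k \<longleftrightarrow> j = k"
  using bij by (auto simp: bij_betw_def inj_on_def)

lemma hpoint_hom [simp]:
  "hx e (hpoint e a b c z) = a" "hy e (hpoint e a b c z) = b" "ht (hpoint e a b c z) = c"
  "k \<in> {3..CARD('n)} \<Longrightarrow> linf e k (hpoint e a b c z) = z (e (k - 1))"
proof -
  show "hx e (hpoint e a b c z) = a" "hy e (hpoint e a b c z) = b" "ht (hpoint e a b c z) = c"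
    using numbering_eq_iff[of 0 1] card_ge_2 by (auto simp: hpoint_def hx_def hy_def ht_def)
  assume k: "k \<in> {3..CARD('n)}"
  then have "k - 1 < CARD('n)" "k - 1 \<noteq> 0" "k - 1 \<noteq> 1" by auto
  then have "e (k - 1) \<noteq> e 0" "e (k - 1) \<noteq> e 1"
    using numbering_eq_iff[of "k - 1" 0] numbering_eq_iff[of "k - 1" 1] card_ge_2 by auto
  then show "linf e k (hpoint e a b c z) = z (e (k - 1))"
    using k by (simp add: hpoint_def linf_coordinate)
qed

lemma fhom_hpoint [simp]: "fhom e (hpoint e a b c z) = fpoly a b c"
  by (simp add: fhom_def)

lemma polycurve_eventually:
  assumes "polycurve \<gamma>"
  shows "hx e (\<gamma> 1) \<noteq> 0 \<Longrightarrow> \<forall>\<^sub>F s in at 0. hx e (\<gamma> s) \<noteq> 0"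
    "hy e (\<gamma> 1) \<noteq> 0 \<Longrightarrow> \<forall>\<^sub>F s in at 0. hy e (\<gamma> s) \<noteq> 0"
    "ht (\<gamma> 1) \<noteq> 0 \<Longrightarrow> \<forall>\<^sub>F s in at 0. ht (\<gamma> s) \<noteq> 0"
    "fhom e (\<gamma> 1) \<noteq> 0 \<Longrightarrow> \<forall>\<^sub>F s in at 0. fhom e (\<gamma> s) \<noteq> 0"
    "\<forall>k\<in>K. (linf e k (\<gamma> 1))\<^sup>2 \<noteq> fhom e (\<gamma> 1) \<Longrightarrow> finite K \<Longrightarrow>
      \<forall>\<^sub>F s in at 0. \<forall>k\<in>K. (linf e k (\<gamma> s))\<^sup>2 \<noteq> fhom e (\<gamma> s)"
proof -
  assume K: "\<forall>k\<in>K. (linf e k (\<gamma> 1))\<^sup>2 \<noteq> fhom e (\<gamma> 1)" "finite K"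
  have "\<forall>\<^sub>F s in at 0. (linf e k (\<gamma> s))\<^sup>2 \<noteq> fhom e (\<gamma> s)" if "k \<in> K" for k
    using polyfun_eventually_nonzero[of "\<lambda>s. (linf e k (\<gamma> s))\<^sup>2 - fhom e (\<gamma> s)"] K(1) that assms
    by (simp add: polyfun_intros)
  then show "\<forall>\<^sub>F s in at 0. \<forall>k\<in>K. (linf e k (\<gamma> s))\<^sup>2 \<noteq> fhom e (\<gamma> s)"
    using K(2) by (simp add: eventually_ball_finite_distrib)
qed (rule polyfun_eventually_nonzero; simp add: polyfun_intros assms)+

lemma eventually_generic:
  obtains W where "\<forall>\<^sub>F s in at 0. generic e (X + s *s (W - X))"
proof
  \<comment> \<open>At this end point f = - 3, while every z_i^2 is 25.\<close>
  let ?W = "hpoint e 1 1 1 (\<lambda>_. 5)"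
  let ?p = "\<lambda>s. X + s *s (?W - X)"
  note pc = polycurve_line[of X ?W]
  have 1: "?p 1 = ?W" by simp
  have F: "fpoly 1 1 1 = - 3" by (simp add: fpoly_def)
  have "\<forall>\<^sub>F s in at 0. \<forall>k\<in>{3..CARD('n)}. (linf e k (?p s))\<^sup>2 \<noteq> fhom e (?p s)"
    by (rule polycurve_eventually(5)[OF pc]) (unfold 1, simp_all add: F)
  moreover have "\<forall>\<^sub>F s in at 0. hx e (?p s) \<noteq> 0" 
    by (rule polycurve_eventually[OF pc]) (unfold 1, simp)
  moreover have "\<forall>\<^sub>F s in at 0. hy e (?p s) \<noteq> 0" 
    by (rule polycurve_eventually[OF pc]) (unfold 1, simp)
  moreover have "\<forall>\<^sub>F s in at 0. ht (?p s) \<noteq> 0" 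
    by (rule polycurve_eventually[OF pc]) (unfold 1, simp)
  moreover have "\<forall>\<^sub>F s in at 0. fhom e (?p s) \<noteq> 0"
    by (rule polycurve_eventually[OF pc]) (unfold 1, simp add: F)
  ultimately show "\<forall>\<^sub>F s in at 0. generic e (?p s)"
    by eventually_elim (simp add: generic_def)
qed

text \<open>Some line through X consists of generic points near X, except possibly X itself. All
  identities proved at generic points reach the other regular points in this way.\<close>

lemma continuous_zero_generic:
  fixes g :: "'n homog \<Rightarrow> complex"
  assumes g: "isCont g X" and U: "open U" "X \<in> U" and "\<And>Y. Y \<in> U \<Longrightarrow> generic e Y \<Longrightarrow> g Y = 0"
  shows "g X = 0"
proof -
  obtain W where W: "\<forall>\<^sub>F s in at 0. generic e (X + s *s (W - X))" by (rule eventually_generic)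
  note pc = polycurve_line[of X W]
  have "((\<lambda>s. g (X + s *s (W - X))) \<longlongrightarrow> g X) (at 0)"
    using isCont_tendsto_compose[OF g polycurve_tendsto[OF pc, simplified]] by simp
  moreover have "((\<lambda>s. g (X + s *s (W - X))) \<longlongrightarrow> 0) (at (0::complex))"
  proof (rule tendsto_eventually)
    show "\<forall>\<^sub>F s in at 0. g (X + s *s (W - X)) = 0"
      using W polycurve_eventually_in[OF pc U(1)] U(2) assms(4) by (auto elim: eventually_elim2)
  qed
  ultimately show ?thesis using tendsto_unique[OF trivial_limit_at] by blast
qed

lemma open_generic: "open {X. generic e X}"
proof -
  have cont: "continuous_on UNIV (hx e)" "continuous_on UNIV (hy e)" "continuous_on UNIV (ht :: 'n homog \<Rightarrow> _)"
    "continuous_on UNIV (fhom e)" "continuous_on UNIV (linf e k)" for k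
    unfolding continuous_on_def by (auto intro!: tendsto_intros)
  have "{X. generic e X} = {X. hx e X \<noteq> 0} \<inter> {X. hy e X \<noteq> 0} \<inter> {X. ht X \<noteq> 0} \<inter> {X. fhom e X \<noteq> 0} \<inter>
      (\<Inter>k\<in>{3..CARD('n)}. {X. (linf e k X)\<^sup>2 \<noteq> fhom e X})"
    by (auto simp: generic_def)
  also have "open \<dots>"
    by (intro open_Int open_INT ballI open_Collect_neq continuous_intros cont finite_atLeastAtMost)
  finally show ?thesis .
qed

lemma conn_mat_isCont:
  assumes "generic e X"
  shows "isCont (\<lambda>X. conn_mat e c X V $ i $ j) X"
proof -
  note nz = genericD[OF assms]
  have t: "((\<lambda>X. tau e c X V) \<longlongrightarrow> tau e c X V) (at X)"
    by (rule tau_tendsto) (use nz in auto)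
  have "isCont (\<lambda>X. conn11 e c X V) X" "isCont (\<lambda>X. conn12 e c X V) X" "isCont (\<lambda>X. conn21 e c X V) X"
    unfolding isCont_def conn11_def conn12_def conn21_def
    using nz by (auto intro!: tendsto_intros t)
  then show ?thesis
    using exhaust_2[of i] exhaust_2[of j] by auto
qed

section \<open>Independence of the holomorphic extension\<close>

abbreviation "conn lam \<equiv> conn_matrix (A_lambda e lam)"
abbreviation "polar lam \<equiv> polar_locus (A_lambda e lam)"

text \<open>By continuity a mismatch at X would persist on an open set of generic points, where
  \<open>A_lambda\<close> is \<open>conn_mat\<close>; but \<open>B\<close> and
  \<open>A_lambda\<close> differ only on a set whose closure has empty interior.\<close>

lemma holo_extension_generic:
  assumes B: "holo_extension (A_lambda e lam) B U" and X: "X \<in> U" "generic e X"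
  shows "B X V = conn_mat e (coeff_lam e lam) X V"
proof (rule ccontr)
  assume "B X V \<noteq> conn_mat e (coeff_lam e lam) X V"
  then obtain i j where ij: "B X V $ i $ j \<noteq> conn_mat e (coeff_lam e lam) X V $ i $ j"
    by (auto simp: vec_eq_iff)
  define g where "g Y = B Y V $ i $ j - conn_mat e (coeff_lam e lam) Y V $ i $ j" for Y
  have hol: "holomorphic_sev (\<lambda>X. B X V $ i $ j) U" and U: "open U"
    and int: "interior (closure {X \<in> U. B X \<noteq> A_lambda e lam X}) = {}"
    using B by (auto simp: holo_extension_def)
  have "isCont g X"
    unfolding g_def using holomorphic_sev_isCont[OF hol X(1)] conn_mat_isCont[OF X(2)]
    by (rule continuous_diff)
  moreover have "g X \<noteq> 0" using ij by (simp add: g_def)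
  ultimately obtain W where W: "open W" "X \<in> W" "\<And>Y. Y \<in> W \<Longrightarrow> g Y \<noteq> 0"
    unfolding continuous_at_open by (metis Compl_iff insertCI open_Compl closed_singleton singletonD)
  define W' where "W' = W \<inter> U \<inter> {X. generic e X}"
  have "open W'" unfolding W'_def using W U open_generic by blast
  moreover have "W' \<subseteq> closure {X \<in> U. B X \<noteq> A_lambda e lam X}"
  proof
    fix Y assume Y: "Y \<in> W'"
    then have "B Y V $ i $ j \<noteq> A_lambda e lam Y V $ i $ j"
      using W(3)[of Y] A_lambda_generic[OF card_ge_2] by (simp add: g_def W'_def)
    then show "Y \<in> closure {X \<in> U. B X \<noteq> A_lambda e lam X}"
      using Y by (intro subsetD[OF closure_subset]) (auto simp: W'_def)
  qed
  ultimately have "W' \<subseteq> {}" using int interior_maximal by blast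
  moreover have "X \<in> W'" using W X by (simp add: W'_def)
  ultimately show False by blast
qed

text \<open>Two extensions agree at the generic points of their common domain, hence at X by
  continuity; this justifies the definite description in \<open>conn_matrix\<close>.\<close>

lemma conn_matrix_eq:
  assumes B: "holo_extension (A_lambda e lam) B U" and X: "X \<in> U"
  shows "conn lam X = B X"
  unfolding conn_matrix_def
proof (rule the_equality)
  show "\<exists>B' U. X \<in> U \<and> holo_extension (A_lambda e lam) B' U \<and> B X = B' X" using assms by blast
  fix M assume "\<exists>B' U. X \<in> U \<and> holo_extension (A_lambda e lam) B' U \<and> M = B' X"
  then obtain B' U' where B': "X \<in> U'" "holo_extension (A_lambda e lam) B' U'" "M = B' X" by blast
  have "B' X V $ i $ j - B X V $ i $ j = 0" for V i j
  proof (rule continuous_zero_generic[where U = "U \<inter> U'" and g = "\<lambda>X. B' X V $ i $ j - B X V $ i $ j"])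
    have "holomorphic_sev (\<lambda>X. B X V $ i $ j) U" "holomorphic_sev (\<lambda>X. B' X V $ i $ j) U'"
      using B B'(2) by (auto simp: holo_extension_def)
    then show "isCont (\<lambda>X. B' X V $ i $ j - B X V $ i $ j) X"
      using X B'(1) by (intro continuous_diff holomorphic_sev_isCont)
    show "open (U \<inter> U')" using B B'(2) by (auto simp: holo_extension_def)
    show "B' Y V $ i $ j - B Y V $ i $ j = 0" if "Y \<in> U \<inter> U'" "generic e Y" for Y
      using holo_extension_generic[OF B _ that(2)] holo_extension_generic[OF B'(2) _ that(2)] that by simp
  qed (use X B' in auto)
  then show "M = B X" unfolding B'(3) by (auto simp: fun_eq_iff vec_eq_iff)
qed

text \<open>Here \<open>conn lam\<close> itself serves as the holomorphic extension, in place of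
  some chosen \<open>B\<close>.\<close>

definition regular_on :: "complex ^ 'n \<Rightarrow> 'n homog set \<Rightarrow> bool"
  where "regular_on lam U \<longleftrightarrow> open U \<and>
    (\<forall>X\<in>U. \<forall>i j. Vector_Spaces.linear (*s) (*) (\<lambda>V. conn lam X V $ i $ j)) \<and>
    (\<forall>V i j. holomorphic_sev (\<lambda>X. conn lam X V $ i $ j) U) \<and>
    (\<forall>X\<in>U. \<forall>V. generic e X \<longrightarrow>
      conn lam X V = conn_mat e (coeff_lam e lam) X V)"

lemma regular_on_neighbourhood:
  assumes "X \<noteq> 0" "X \<notin> polar lam"
  obtains U where "X \<in> U" "regular_on lam U"
proof -
  obtain B U where B: "X \<in> U" "holo_extension (A_lambda e lam) B U"
    using assms by (auto simp: polar_locus_def)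
  have eq: "conn lam Y = B Y" if "Y \<in> U" for Y
    by (rule conn_matrix_eq[OF B(2) that])
  have hol: "holomorphic_sev (\<lambda>X. conn lam X V $ i $ j) U" for V i j
  proof (rule holomorphic_sevI)
    have h: "holomorphic_sev (\<lambda>X. B X V $ i $ j) U" and "open U"
      using B by (auto simp: holo_extension_def)
    show "((\<lambda>X. conn lam X V $ i $ j) has_derivative
        ext_deriv (\<lambda>X. B X V $ i $ j) Y) (at Y)" if "Y \<in> U" for Y
      by (rule has_derivative_transform_within_open[OF holomorphic_sev_has_derivative[OF h that] \<open>open U\<close> that])
         (simp add: eq)
    show "ext_deriv (\<lambda>X. B X V $ i $ j) Y (c *s v) = c * ext_deriv (\<lambda>X. B X V $ i $ j) Y v"
      if "Y \<in> U" for Y c v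
      by (rule holomorphic_sev_ext_deriv_scale[OF h that])
  qed
  have "regular_on lam U"
    unfolding regular_on_def using B(2) hol holo_extension_generic[OF B(2)]
    by (simp add: eq holo_extension_def)
  with B(1) that show thesis by blast
qed

end

lemma hom_diff:
  "hx e (X - Y) = hx e X - hx e Y" "hy e (X - Y) = hy e X - hy e Y"
  "ht (X - Y) = ht X - ht Y" "linf e k (X - Y) = linf e k X - linf e k Y"
  by (simp_all add: hx_def hy_def ht_def linf_def algebra_simps)

context numbering
begin

section \<open>Residues along the components of the polar divisor\<close>

lemma regular_on_isCont:
  assumes "regular_on lam U" "X \<in> U"
  shows "isCont (\<lambda>X. conn lam X V $ i $ j) X"
  using assms holomorphic_sev_isCont unfolding regular_on_def by blast

lemma regular_on_generic:
  assumes "regular_on lam U" "X \<in> U" "generic e X"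
  shows "conn lam X V = conn_mat e (coeff_lam e lam) X V"
  using assms unfolding regular_on_def by blast

lemma coeff_lam_simps [simp]:
  "coeff_lam e lam 0 = 0" "coeff_lam e lam (Suc 0) = - (lam $ e 0)" "coeff_lam e lam 2 = lam $ e 1"
  by (simp_all add: coeff_lam_def)

lemma polycurve_hpoint:
  assumes "is_polyfun a" "is_polyfun b" "is_polyfun c" "\<And>i. is_polyfun (\<lambda>s. z s i)"
  shows "polycurve (\<lambda>s. hpoint e (a s) (b s) (c s) (z s))"
  unfolding polycurve_def
proof
  fix j :: "'n option"
  show "is_polyfun (\<lambda>s. hpoint e (a s) (b s) (c s) (z s) $ j)"
  proof (cases j)
    case (Some i)
    then show ?thesis
      using assms by (cases "i = e 0"; cases "i = e 1") (simp_all add: hpoint_def)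
  qed (simp add: hpoint_def assms)
qed

text \<open>
  On the quadric \<open>f = 0\<close> the residue of the connection matrix has the eigenvalues \<open>1/4\<close> and \<open>- 1/4\<close>,
  so there is always a pole.
\<close>

lemma regular_on_fhom_nonzero:
  assumes reg: "regular_on lam U" and X: "X \<in> U"
  shows "fhom e X \<noteq> 0"
proof
  assume F0: "fhom e X = 0"
  define C where "C i j V Y = conn lam Y V $ i $ j" for i j Y V
  have C_lim: "(C i j V \<longlongrightarrow> C i j V Y) (at Y)" if "Y \<in> U" for i j V Y
    using regular_on_isCont[OF reg that] unfolding C_def isCont_def .
  have U: "open U" using reg by (simp add: regular_on_def)
  \<comment> \<open>\<open>tau\<close>, and with it \<open>lam\<close>, cancels in y C11 + (x - t)
    C21. On f = 0 the relation leaves y df = 0.\<close>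
  have rel: "fhom e Y * (hy e Y * C 1 1 V Y + (hx e Y - ht Y) * C 2 1 V Y)
      + hy e Y * dfhom e Y V / 4 - fhom e Y * hy e V / 2 = 0" if Y: "Y \<in> U" for Y V
  proof (rule continuous_zero_generic[where U = U and g = "\<lambda>Y. fhom e Y * (hy e Y * C 1 1 V Y
      + (hx e Y - ht Y) * C 2 1 V Y) + hy e Y * dfhom e Y V / 4 - fhom e Y * hy e V / 2"])
    show "isCont (\<lambda>Y. fhom e Y * (hy e Y * C 1 1 V Y
      + (hx e Y - ht Y) * C 2 1 V Y) + hy e Y * dfhom e Y V / 4 - fhom e Y * hy e V / 2) Y"
      unfolding isCont_def by (intro tendsto_intros C_lim Y) simp_all
    show "fhom e Z * (hy e Z * C 1 1 V Z + (hx e Z - ht Z) * C 2 1 V Z)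
      + hy e Z * dfhom e Z V / 4 - fhom e Z * hy e V / 2 = 0" if "Z \<in> U" "generic e Z" for Z
      unfolding C_def regular_on_generic[OF reg that] conn_mat_nth conn11_def conn21_def
      using genericD[OF that(2)] by (simp add: field_simps)
  qed (use U Y in auto)
  \<comment> \<open>The conic f = 0 has the parametrization (u^2, v^2, (u + v)^2). It lets X move
    within f = 0, towards u = v = 1, to a point of U with y nonzero.\<close>
  obtain u0 v0 where uv: "hx e X = u0\<^sup>2" "hy e X = v0\<^sup>2" "ht X = (u0 + v0)\<^sup>2"
  proof -
    define p where "p = csqrt (hx e X)"
    define q where "q = csqrt (hy e X)"
    have pq: "hx e X = p\<^sup>2" "hy e X = q\<^sup>2" by (simp_all add: p_def q_def)
    have "(ht X - (p + q)\<^sup>2) * (ht X - (p - q)\<^sup>2) = fhom e X"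
      unfolding fhom_def fpoly_def pq by (simp add: power2_eq_square algebra_simps)
    with F0 have "ht X = (p + q)\<^sup>2 \<or> ht X = (p + - q)\<^sup>2" by auto
    with pq that[of p q] that[of p "- q"] show thesis by auto
  qed
  define u where "u s = u0 + s * (1 - u0)" for s
  define v where "v s = v0 + s * (1 - v0)" for s
  define \<gamma> where "\<gamma> s = hpoint e ((u s)\<^sup>2) ((v s)\<^sup>2) ((u s + v s)\<^sup>2) (\<lambda>i. X $ Some i)" for s
  have g0: "\<gamma> 0 = X"
    using uv by (simp add: \<gamma>_def u_def v_def vec_eq_iff hpoint_def hx_def hy_def ht_def split: option.split)
  have pc: "polycurve \<gamma>"
    unfolding \<gamma>_def u_def v_def by (intro polycurve_hpoint polyfun_intros)
  have Fg: "fhom e (\<gamma> s) = 0" for s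
    by (simp add: \<gamma>_def fpoly_def power2_eq_square algebra_simps)
  have "\<forall>\<^sub>F s in at 0. \<gamma> s \<in> U \<and> hy e (\<gamma> s) \<noteq> 0"
    using polycurve_eventually_in[OF pc U] polycurve_eventually(2)[OF pc] X g0
    by (intro eventually_conj) (auto simp: \<gamma>_def v_def)
  then obtain s where s: "\<gamma> s \<in> U" "hy e (\<gamma> s) \<noteq> 0"
    using eventually_happens'[OF trivial_limit_at] by blast
  have d0: "dfhom e (\<gamma> s) V = 0" for V
    using rel[OF s(1), of V] s(2) by (simp add: Fg)
  have "linf e 1 (\<gamma> s) = 0" "linf e 0 (\<gamma> s) = 0"
    using d0[of "hpoint e 1 0 0 (\<lambda>_. 0)"] d0[of "hpoint e 0 0 1 (\<lambda>_. 0)"] by (simp_all del: linf_simps add: dfhom_def)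
  moreover have "linf e 1 (\<gamma> s) + linf e 0 (\<gamma> s) = - 2 * hy e (\<gamma> s)" by simp
  ultimately have "- 2 * hy e (\<gamma> s) = 0" by simp
  with s show False by simp
qed

text \<open>Moves X inside U off the unwanted components. One of a, b, c may be 0: if X lies on the
  same coordinate hyperplane, so does the whole line. Since f = 1 at W, the value 5 for all z_i
  avoids the quadrics f = z_i^2.\<close>

lemma line_in_regular_set:
  assumes "open U" "X \<in> U" and W: "W = hpoint e a b c (\<lambda>_. 5)" and F: "fpoly a b c = 1"
  obtains s where "X + s *s (W - X) \<in> U" "a \<noteq> 0 \<Longrightarrow> hx e (X + s *s (W - X)) \<noteq> 0"
    "b \<noteq> 0 \<Longrightarrow> hy e (X + s *s (W - X)) \<noteq> 0" "c \<noteq> 0 \<Longrightarrow> ht (X + s *s (W - X)) \<noteq> 0"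
    "\<And>k. k \<in> {3..CARD('n)} \<Longrightarrow> (linf e k (X + s *s (W - X)))\<^sup>2 \<noteq> fhom e (X + s *s (W - X))"
proof -
  let ?p = "\<lambda>s. X + s *s (W - X)"
  note pc = polycurve_line[of X W]
  have 1: "?p 1 = W" by simp
  have "\<forall>\<^sub>F s in at 0. ?p s \<in> U"
    using assms by (intro polycurve_eventually_in[OF pc]) auto
  moreover have "\<forall>\<^sub>F s in at 0. a \<noteq> 0 \<longrightarrow> hx e (?p s) \<noteq> 0"
  proof (cases "a = 0")
    case False
    then have "\<forall>\<^sub>F s in at 0. hx e (?p s) \<noteq> 0"
      by (intro polycurve_eventually(1)[OF pc]) (unfold 1, simp add: W)
    then show ?thesis by eventually_elim simp
  qed simp
  moreover have "\<forall>\<^sub>F s in at 0. b \<noteq> 0 \<longrightarrow> hy e (?p s) \<noteq> 0"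
  proof (cases "b = 0")
    case False
    then have "\<forall>\<^sub>F s in at 0. hy e (?p s) \<noteq> 0"
      by (intro polycurve_eventually(2)[OF pc]) (unfold 1, simp add: W)
    then show ?thesis by eventually_elim simp
  qed simp
  moreover have "\<forall>\<^sub>F s in at 0. c \<noteq> 0 \<longrightarrow> ht (?p s) \<noteq> 0"
  proof (cases "c = 0")
    case False
    then have "\<forall>\<^sub>F s in at 0. ht (?p s) \<noteq> 0"
      by (intro polycurve_eventually(3)[OF pc]) (unfold 1, simp add: W)
    then show ?thesis by eventually_elim simp
  qed simp
  moreover have "\<forall>\<^sub>F s in at 0. \<forall>k\<in>{3..CARD('n)}.
      (linf e k (?p s))\<^sup>2 \<noteq> fhom e (?p s)"
    by (rule polycurve_eventually(5)[OF pc]) (unfold 1, simp_all add: W F)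
  ultimately have "\<forall>\<^sub>F s in at 0. ?p s \<in> U \<and> (a \<noteq> 0 \<longrightarrow> hx e (?p s) \<noteq> 0) \<and>
      (b \<noteq> 0 \<longrightarrow> hy e (?p s) \<noteq> 0) \<and> (c \<noteq> 0 \<longrightarrow> ht (?p s) \<noteq> 0) \<and>
      (\<forall>k\<in>{3..CARD('n)}. (linf e k (?p s))\<^sup>2 \<noteq> fhom e (?p s))"
    by eventually_elim blast
  then show thesis using that eventually_happens'[OF trivial_limit_at] by blast
qed

text \<open>
  In the next three lemmas a coordinate hyperplane without pole is excluded by computing the residue
  along it at a point of \<open>U\<close> lying on no other component of the polar divisor.
\<close>

lemma regular_on_hx_nonzero:
  assumes reg: "regular_on lam U" and X: "X \<in> U" and lam: "lam $ e 1 \<noteq> 0"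
  shows "hx e X \<noteq> 0"
proof
  assume x0: "hx e X = 0"
  define C where "C i j V Y = conn lam Y V $ i $ j" for i j Y V
  define c where "c = coeff_lam e lam"
  have C_lim: "(C i j V \<longlongrightarrow> C i j V Y) (at Y)" if "Y \<in> U" for i j V Y
    using regular_on_isCont[OF reg that] unfolding C_def isCont_def .
  have U: "open U" using reg by (simp add: regular_on_def)
  define W where "W = hpoint e 0 1 2 (\<lambda>_. 5)"
  obtain s where s: "X + s *s (W - X) \<in> U" "hy e (X + s *s (W - X)) \<noteq> 0" "ht (X + s *s (W - X)) \<noteq> 0"
    "\<And>k. k \<in> {3..CARD('n)} \<Longrightarrow> (linf e k (X + s *s (W - X)))\<^sup>2 \<noteq> fhom e (X + s *s (W - X))"
    by (rule line_in_regular_set[OF U X W_def]) (auto simp: fpoly_def)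
  define Y where "Y = X + s *s (W - X)"
  note Y = s[folded Y_def]
  have xY: "hx e Y = 0" by (simp add: Y_def hom_linear hom_diff x0 W_def)
  define V where "V = hpoint e 1 0 0 (\<lambda>_. 0)"
  have V: "hx e V = 1" "hy e V = 0" "ht V = 0" by (simp_all add: V_def)
  let ?S = "\<lambda>Z. \<Sum>k=3..CARD('n). c k * sig e k Z V"
  \<comment> \<open>Multiplication by x clears the pole. Only the summand with
    \<open>sig e 2\<close> contributes at Y, with the residue \<open>linf e 0 / 2\<close>, whose
    square is f / 4 on x = 0.\<close>
  define g where "g Z = hx e Z * C 2 1 V Z * fhom e Z - hy e Z * (hx e Z * (c 1 * sig e 1 Z V)
    + c 2 * (linf e 0 Z / 2) + hx e Z * ?S Z)" for Z
  have "g Y = 0"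
  proof (rule continuous_zero_generic[OF _ U Y(1)])
    have "(linf e 1 Y)\<^sup>2 \<noteq> fhom e Y" using linf_square_minus_fhom(2)[of e Y] Y by auto
    then show "isCont g Y"
      using Y(4) unfolding g_def isCont_def
      by (intro tendsto_intros C_lim Y(1)) auto
    show "g Z = 0" if Z: "Z \<in> U" "generic e Z" for Z
    proof -
      note nz = genericD[OF Z(2)]
      have "tau e c Z V = c 1 * sig e 1 Z V + c 2 * (linf e 0 Z / (2 * hx e Z))
          + ?S Z"
        unfolding tau_split[OF card_ge_2] sig_formula(3)[OF nz(1,3)] V by (simp add: c_def)
      then have "hx e Z * tau e c Z V = hx e Z * (c 1 * sig e 1 Z V) + c 2 * (linf e 0 Z / 2)
          + hx e Z * ?S Z"
        using nz by (simp del: linf_simps add: distrib_left)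
      moreover have "hx e Z * C 2 1 V Z * fhom e Z = hy e Z * (hx e Z * tau e c Z V)"
        unfolding C_def regular_on_generic[OF reg Z] conn_mat_nth conn21_def c_def using nz by simp
      ultimately show ?thesis by (simp add: g_def)
    qed
  qed
  then have "linf e 0 Y = 0" using Y lam by (simp add: g_def xY c_def)
  then have "fhom e Y = 0" using linf_square_minus_fhom(1)[of e Y] xY by simp
  with regular_on_fhom_nonzero[OF reg Y(1)] show False by simp
qed

lemma regular_on_ht_nonzero:
  assumes reg: "regular_on lam U" and X: "X \<in> U" and lam: "lam $ e 0 + lam $ e 1 \<noteq> 0"
  shows "ht X \<noteq> 0"
proof
  assume x0: "ht X = 0"
  define C where "C i j V Y = conn lam Y V $ i $ j" for i j Y V
  define c where "c = coeff_lam e lam"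
  have C_lim: "(C i j V \<longlongrightarrow> C i j V Y) (at Y)" if "Y \<in> U" for i j V Y
    using regular_on_isCont[OF reg that] unfolding C_def isCont_def .
  have U: "open U" using reg by (simp add: regular_on_def)
  define W where "W = hpoint e 1 2 0 (\<lambda>_. 5)"
  obtain s where s: "X + s *s (W - X) \<in> U" "hx e (X + s *s (W - X)) \<noteq> 0" "hy e (X + s *s (W - X)) \<noteq> 0"
    "\<And>k. k \<in> {3..CARD('n)} \<Longrightarrow> (linf e k (X + s *s (W - X)))\<^sup>2 \<noteq> fhom e (X + s *s (W - X))"
    by (rule line_in_regular_set[OF U X W_def]) (auto simp: fpoly_def)
  define Y where "Y = X + s *s (W - X)"
  note Y = s[folded Y_def]
  have xY: "ht Y = 0" by (simp add: Y_def hom_linear hom_diff x0 W_def)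
  define V where "V = hpoint e 0 0 1 (\<lambda>_. 0)"
  have V: "hx e V = 0" "hy e V = 0" "ht V = 1" by (simp_all add: V_def)
  let ?S = "\<lambda>Z. \<Sum>k=3..CARD('n). c k * sig e k Z V"
  \<comment> \<open>Both \<open>sig e 1\<close> and \<open>sig e 2\<close> have a pole along t = 0.
    There \<open>linf e 2 = - linf e 1\<close>, so the two residues combine to a multiple of lam_0 +
    lam_1.\<close>
  define g where "g Z = ht Z * C 2 1 V Z * fhom e Z - hy e Z * (c 1 * (linf e 2 Z / 2)
    + c 2 * (linf e 1 Z / 2) + ht Z * ?S Z)" for Z
  have "g Y = 0"
  proof (rule continuous_zero_generic[OF _ U Y(1)])
    show "isCont g Y"
      using Y(4) unfolding g_def isCont_def
      by (intro tendsto_intros C_lim Y(1)) auto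
    show "g Z = 0" if Z: "Z \<in> U" "generic e Z" for Z
    proof -
      note nz = genericD[OF Z(2)]
      have "tau e c Z V = c 1 * (linf e 2 Z / (2 * ht Z)) + c 2 * (linf e 1 Z / (2 * ht Z))
          + ?S Z"
        unfolding tau_split[OF card_ge_2] sig_formula(3)[OF nz(1,3)] sig_formula(2)[OF nz(2,3)] V
        by (simp add: c_def)
      then have "ht Z * tau e c Z V = c 1 * (linf e 2 Z / 2) + c 2 * (linf e 1 Z / 2)
          + ht Z * ?S Z"
        using nz by (simp del: linf_simps add: distrib_left)
      moreover have "ht Z * C 2 1 V Z * fhom e Z = hy e Z * (ht Z * tau e c Z V)"
        unfolding C_def regular_on_generic[OF reg Z] conn_mat_nth conn21_def c_def using nz by simp
      ultimately show ?thesis by (simp add: g_def)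
    qed
  qed
  then have "c 1 * (linf e 2 Y / 2) + c 2 * (linf e 1 Y / 2) = 0"
    using Y(3) by (simp del: linf_simps add: g_def xY)
  moreover have "linf e 2 Y = - linf e 1 Y" by (simp add: xY)
  ultimately have "(lam $ e 0 + lam $ e 1) * linf e 1 Y = 0"
    by (simp del: linf_simps add: c_def field_simps)
  then have "linf e 1 Y = 0" using lam by simp
  then have "fhom e Y = 0" using linf_square_minus_fhom(2)[of e Y] xY by simp
  with regular_on_fhom_nonzero[OF reg Y(1)] show False by simp
qed

lemma regular_on_hy_nonzero:
  assumes reg: "regular_on lam U" and X: "X \<in> U" and lam: "lam $ e 0 \<noteq> 1"
  shows "hy e X \<noteq> 0"
proof
  assume x0: "hy e X = 0"
  define C where "C i j V Y = conn lam Y V $ i $ j" for i j Y V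
  define c where "c = coeff_lam e lam"
  have C_lim: "(C i j V \<longlongrightarrow> C i j V Y) (at Y)" if "Y \<in> U" for i j V Y
    using regular_on_isCont[OF reg that] unfolding C_def isCont_def .
  have U: "open U" using reg by (simp add: regular_on_def)
  define W where "W = hpoint e 1 0 2 (\<lambda>_. 5)"
  obtain s where s: "X + s *s (W - X) \<in> U" "hx e (X + s *s (W - X)) \<noteq> 0" "ht (X + s *s (W - X)) \<noteq> 0"
    "\<And>k. k \<in> {3..CARD('n)} \<Longrightarrow> (linf e k (X + s *s (W - X)))\<^sup>2 \<noteq> fhom e (X + s *s (W - X))"
    by (rule line_in_regular_set[OF U X W_def]) (auto simp: fpoly_def)
  define Y where "Y = X + s *s (W - X)"
  note Y = s[folded Y_def]
  have xY: "hy e Y = 0" by (simp add: Y_def hom_linear hom_diff x0 W_def)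
  define V where "V = hpoint e 0 1 0 (\<lambda>_. 0)"
  have V: "hx e V = 0" "hy e V = 1" "ht V = 0" by (simp_all add: V_def)
  let ?S = "\<lambda>Z. \<Sum>k=3..CARD('n). c k * sig e k Z V"
  \<comment> \<open>The factor y in \<open>conn21\<close> hides this pole, so the diagonal entry is
    used. Its residue along y = 0 is (1 - lam_0) / 2, where 1/2 comes from the term dy / (2 y);
    hence the exceptional value 1.\<close>
  define g where "g Z = hy e Z * C 1 1 V Z * fhom e Z + hy e Z * dfhom e Z V / 4 - fhom e Z / 2
    + (hx e Z - ht Z) * (c 1 * (linf e 0 Z / 2) + hy e Z * (c 2 * sig e 2 Z V)
    + hy e Z * ?S Z)" for Z
  have "g Y = 0"
  proof (rule continuous_zero_generic[OF _ U Y(1)])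
    have "(linf e 2 Y)\<^sup>2 \<noteq> fhom e Y" using linf_square_minus_fhom(3)[of e Y] Y by auto
    then show "isCont g Y"
      using Y(4) unfolding g_def isCont_def
      by (intro tendsto_intros C_lim Y(1)) auto
    show "g Z = 0" if Z: "Z \<in> U" "generic e Z" for Z
    proof -
      note nz = genericD[OF Z(2)]
      have "tau e c Z V = c 1 * (linf e 0 Z / (2 * hy e Z)) + c 2 * sig e 2 Z V
          + ?S Z"
        unfolding tau_split[OF card_ge_2] sig_formula(2)[OF nz(2,3)] V by (simp add: c_def)
      then have "hy e Z * tau e c Z V = c 1 * (linf e 0 Z / 2) + hy e Z * (c 2 * sig e 2 Z V)
          + hy e Z * ?S Z"
        using nz by (simp del: linf_simps add: distrib_left)
      moreover have "hy e Z * C 1 1 V Z * fhom e Z = - hy e Z * dfhom e Z V / 4 + fhom e Z / 2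
          - (hx e Z - ht Z) * (hy e Z * tau e c Z V)"
        unfolding C_def regular_on_generic[OF reg Z] conn_mat_nth conn11_def c_def[symmetric] V
        using nz by (simp add: field_simps)
      ultimately show ?thesis by (simp add: g_def)
    qed
  qed
  then have "- fhom e Y = (hx e Y - ht Y) * (lam $ e 0 * linf e 0 Y)"
    by (simp del: linf_simps add: g_def xY c_def)
  moreover have "linf e 0 Y = - (hx e Y - ht Y)" by (simp add: xY)
  moreover have "fhom e Y = (hx e Y - ht Y) * (hx e Y - ht Y)"
    by (simp add: fhom_def fpoly_def xY power2_eq_square algebra_simps)
  ultimately have "(1 - lam $ e 0) * fhom e Y = 0"
    by (auto simp del: linf_simps simp add: left_diff_distrib mult_ac)
  then have "fhom e Y = 0" using lam by simp
  with regular_on_fhom_nonzero[OF reg Y(1)] show False by simp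
qed

text \<open>In the direction of the coordinate z_i, which f does not involve, \<open>sig e m\<close>
  is - f / (z_i^2 - f). At a point of the quadric on no other component this pole survives in
  \<open>conn21\<close>, because f is nonzero on U. A line would leave the quadric, so that point is
  reached along a rational parametrization.\<close>

lemma regular_on_quadric_nonzero:
  assumes reg: "regular_on lam U" and X: "X \<in> U" and m: "m \<in> {3..CARD('n)}"
    and lam: "coeff_lam e lam m \<noteq> 0"
  shows "(linf e m X)\<^sup>2 \<noteq> fhom e X"
proof
  assume x0: "(linf e m X)\<^sup>2 = fhom e X"
  define C where "C i j V Y = conn lam Y V $ i $ j" for i j Y V
  define c where "c = coeff_lam e lam"
  have C_lim: "(C i j V \<longlongrightarrow> C i j V Y) (at Y)" if "Y \<in> U" for i j V Y
    using regular_on_isCont[OF reg that] unfolding C_def isCont_def .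
  have U: "open U" using reg by (simp add: regular_on_def)
  have em: "e (m - 1) \<noteq> e 0" "e (m - 1) \<noteq> e 1" "\<And>k. k \<in> {3..CARD('n)} \<Longrightarrow> e (k - 1) = e (m - 1) \<longleftrightarrow> k = m"
    using m card_ge_2 by (auto simp: numbering_eq_iff)
  \<comment> \<open>The quadric \<open>f = z\<^sub>i\<^sup>2\<close> is \<open>p q = y t\<close> with \<open>p, q = (x - y - t) / 2 \<plusminus> z\<^sub>i / 2\<close>, parametrized by rank 1 matrices.\<close>
  obtain a0 b0 c0 d0 where par: "hy e X = a0 * c0" "ht X = b0 * d0"
    "linf e 1 X - linf e m X = 2 * (a0 * b0)" "linf e 1 X + linf e m X = 2 * (c0 * d0)"
  proof -
    define p where "p = (linf e 1 X - linf e m X) / 2"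
    define q where "q = (linf e 1 X + linf e m X) / 2"
    have pq: "p * q = hy e X * ht X"
      using linf_square_minus_fhom(2)[of e X] x0 by (simp add: p_def q_def power2_eq_square algebra_simps)
    have pq2: "linf e 1 X - linf e m X = 2 * p" "linf e 1 X + linf e m X = 2 * q"
      by (simp_all add: p_def q_def)
    show thesis
    proof (cases "hy e X = 0")
      case False
      then show thesis using that[of 1 "hy e X" p "q / hy e X"] pq pq2 by (simp add: field_simps)
    next
      case True
      with pq consider "p = 0" | "q = 0" by auto
      then show thesis
      proof cases
        case 1
        then show thesis using that[of 0 q "ht X" 1] True pq2 by simp
      next
        case 2
        then show thesis using that[of p 0 1 "ht X"] True pq2 by simp
      qed
    qed
  qed
  define a where "a s = a0 + s * (1 - a0)" for s
  define b where "b s = b0 + s * (1 - b0)" for s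
  define c' where "c' s = c0 + s * (1 - c0)" for s
  define d where "d s = d0 + s * (2 - d0)" for s
  define \<gamma> where "\<gamma> s = hpoint e (a s * b s + c' s * d s + a s * c' s + b s * d s) (a s * c' s) (b s * d s)
      (\<lambda>i. if i = e (m - 1) then c' s * d s - a s * b s else X $ Some i + s * (5 - X $ Some i))" for s
  have g0: "\<gamma> 0 = X"
  proof -
    have z: "X $ Some (e (m - 1)) = c0 * d0 - a0 * b0"
    proof -
      have "2 * linf e m X = (linf e 1 X + linf e m X) - (linf e 1 X - linf e m X)" by simp
      also have "\<dots> = 2 * (c0 * d0 - a0 * b0)" unfolding par by simp
      finally have "linf e m X = c0 * d0 - a0 * b0" by (metis mult_cancel_left zero_neq_numeral)
      then show ?thesis using m by (simp add: linf_coordinate)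
    qed
    have x: "hx e X = a0 * b0 + c0 * d0 + a0 * c0 + b0 * d0"
    proof -
      have "2 * hx e X = (linf e 1 X + linf e m X) + (linf e 1 X - linf e m X) + 2 * (hy e X + ht X)"
        by simp
      also have "\<dots> = 2 * (a0 * b0 + c0 * d0 + a0 * c0 + b0 * d0)" unfolding par by simp
      finally show ?thesis by (metis mult_cancel_left zero_neq_numeral)
    qed
    show ?thesis
      using par(1,2) x z
      by (simp add: \<gamma>_def a_def b_def c'_def d_def vec_eq_iff hpoint_def hx_def hy_def ht_def
          split: option.split)
  qed
  have pc: "polycurve \<gamma>"
    unfolding \<gamma>_def a_def b_def c'_def d_def
  proof (intro polycurve_hpoint polyfun_intros)
    show "is_polyfun (\<lambda>s. if i = e (m - 1) then (c0 + s * (1 - c0)) * (d0 + s * (2 - d0)) -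
        (a0 + s * (1 - a0)) * (b0 + s * (1 - b0)) else X $ Some i + s * (5 - X $ Some i))" for i
      by (cases "i = e (m - 1)") (simp_all add: polyfun_intros)
  qed
  have quad: "(linf e m (\<gamma> s))\<^sup>2 = fhom e (\<gamma> s)" for s
    using m by (simp add: \<gamma>_def fpoly_def power2_eq_square algebra_simps)
  \<comment> \<open>Here f(6, 1, 2) = 1, the square of the coordinate with index m, whereas the
    other z_i are 5.\<close>
  have g1: "\<gamma> 1 = hpoint e 6 1 2 (\<lambda>i. if i = e (m - 1) then 1 else 5)"
    by (auto simp: \<gamma>_def a_def b_def c'_def d_def hpoint_def vec_eq_iff split: option.split)
  have "\<forall>\<^sub>F s in at 0. \<forall>k\<in>{3..CARD('n)} - {m}. (linf e k (\<gamma> s))\<^sup>2 \<noteq> fhom e (\<gamma> s)"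
    by (rule polycurve_eventually(5)[OF pc]) (auto simp: g1 em[unfolded One_nat_def] fpoly_def)
  moreover have "\<forall>\<^sub>F s in at 0. hx e (\<gamma> s) \<noteq> 0" "\<forall>\<^sub>F s in at 0. hy e (\<gamma> s) \<noteq> 0"
    "\<forall>\<^sub>F s in at 0. ht (\<gamma> s) \<noteq> 0"
    by (rule polycurve_eventually[OF pc]; simp add: g1)+
  moreover have "\<forall>\<^sub>F s in at 0. \<gamma> s \<in> U"
    using polycurve_eventually_in[OF pc U] X g0 by simp
  ultimately have "\<forall>\<^sub>F s in at 0. (\<forall>k\<in>{3..CARD('n)} - {m}. (linf e k (\<gamma> s))\<^sup>2 \<noteq> fhom e (\<gamma> s)) \<and>
      hx e (\<gamma> s) \<noteq> 0 \<and> hy e (\<gamma> s) \<noteq> 0 \<and> ht (\<gamma> s) \<noteq> 0 \<and> \<gamma> s \<in> U"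
    by eventually_elim blast
  then obtain s where s: "\<forall>k\<in>{3..CARD('n)} - {m}. (linf e k (\<gamma> s))\<^sup>2 \<noteq> fhom e (\<gamma> s)"
      "hx e (\<gamma> s) \<noteq> 0" "hy e (\<gamma> s) \<noteq> 0" "ht (\<gamma> s) \<noteq> 0" "\<gamma> s \<in> U"
    using eventually_happens'[OF trivial_limit_at] by blast
  define Y where "Y = \<gamma> s"
  note Y = s[folded Y_def]
  have qY: "(linf e m Y)\<^sup>2 = fhom e Y" by (simp add: Y_def quad)
  define V where "V = hpoint e 0 0 0 (\<lambda>i. if i = e (m - 1) then 1 else 0)"
  have V: "dfhom e Z V = 0" "linf e m V = 1" for Z using m by (simp_all add: V_def dfhom_def)
  define g where "g Z = ((linf e m Z)\<^sup>2 - fhom e Z) * C 2 1 V Z * fhom e Z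
    - hy e Z * (((linf e m Z)\<^sup>2 - fhom e Z) * (c 1 * sig e 1 Z V + c 2 * sig e 2 Z V
      + (\<Sum>k\<in>{3..CARD('n)} - {m}. c k * sig e k Z V)) - c m * fhom e Z)" for Z
  have "g Y = 0"
  proof (rule continuous_zero_generic[OF _ U Y(5)])
    have "(linf e 1 Y)\<^sup>2 \<noteq> fhom e Y" "(linf e 2 Y)\<^sup>2 \<noteq> fhom e Y"
      using linf_square_minus_fhom(2,3)[of e Y] Y by auto
    then show "isCont g Y"
      using Y(1) unfolding g_def isCont_def
      by (intro tendsto_intros C_lim Y(5)) auto
    show "g Z = 0" if Z: "Z \<in> U" "generic e Z" for Z
    proof -
      note nz = genericD[OF Z(2)]
      define R where "R = c 1 * sig e 1 Z V + c 2 * sig e 2 Z V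
        + (\<Sum>k\<in>{3..CARD('n)} - {m}. c k * sig e k Z V)"
      have "tau e c Z V = R + c m * sig e m Z V"
        unfolding tau_split[OF card_ge_2] R_def using m sum.remove[of "{3..CARD('n)}" m "\<lambda>k. c k * sig e k Z V"]
        by (simp add: c_def)
      then have "((linf e m Z)\<^sup>2 - fhom e Z) * tau e c Z V = ((linf e m Z)\<^sup>2 - fhom e Z) * R - c m * fhom e Z"
        using nz(5)[of m] m by (simp add: sig_def V right_diff_distrib)
      moreover have "((linf e m Z)\<^sup>2 - fhom e Z) * C 2 1 V Z * fhom e Z =
          hy e Z * (((linf e m Z)\<^sup>2 - fhom e Z) * tau e c Z V)"
        unfolding C_def regular_on_generic[OF reg Z] conn_mat_nth conn21_def c_def using nz by simp
      ultimately show ?thesis by (simp add: g_def R_def)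
    qed
  qed
  then have "fhom e Y = 0" using Y lam by (simp add: g_def qY c_def)
  with regular_on_fhom_nonzero[OF reg Y(5)] show False by simp
qed

end

section \<open>Explicit horizontal sections\<close>

text \<open>
  With \<open>q\<^sup>2 = f\<close>, the connection is diagonal in the frame \<open>(gA c e X q, gB c e X q)\<close>,
  \<open>(gA c e X (- q), gB c e X (- q))\<close>. The three values \<open>c = 0, 1, - 1\<close> give the same pair of lines, but
  the frame degenerates along \<open>y = 0\<close>, \<open>x = 0\<close>, \<open>t = 0\<close> respectively.
\<close>

definition colA :: "complex \<Rightarrow> (nat \<Rightarrow> 'n::finite) \<Rightarrow> 'n homog \<Rightarrow> complex"
  where "colA c e X = - (hx e X - ht X) + c * (hy e X - 2 * (hx e X + ht X))"

definition colB :: "complex \<Rightarrow> (nat \<Rightarrow> 'n::finite) \<Rightarrow> 'n homog \<Rightarrow> complex"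
  where "colB c e X = hy e X + c * (hx e X - ht X)"

text \<open>The determinant of the frame is \<open>2 * q * colR c e X\<close>.\<close>

definition colR :: "complex \<Rightarrow> (nat \<Rightarrow> 'n::finite) \<Rightarrow> 'n homog \<Rightarrow> complex"
  where "colR c e X = colB c e X - c * colA c e X"

definition gA :: "complex \<Rightarrow> (nat \<Rightarrow> 'n::finite) \<Rightarrow> 'n homog \<Rightarrow> complex \<Rightarrow> complex"
  where "gA c e X q = colA c e X + q"

text \<open>For c = 1 and c = - 1 this is \<open>q - linf e 0 X\<close> and
  \<open>- (q + linf e 1 X)\<close>, up to sign one of the functions P + q, P - q. Rescaling the
  frame by \<open>gB / y\<close> thus shifts one exponent by 1.\<close>

definition gB :: "complex \<Rightarrow> (nat \<Rightarrow> 'n::finite) \<Rightarrow> 'n homog \<Rightarrow> complex \<Rightarrow> complex"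
  where "gB c e X q = colB c e X + c * q"

text \<open>Minus the logarithmic derivative of the scalar factor in a horizontal section. The last
  two terms belong to the square root of \<open>q * colR\<close>, which makes the Wronskian of the
  two sections constant.\<close>

definition log_slope :: "complex \<Rightarrow> (nat \<Rightarrow> 'n::finite) \<Rightarrow> (nat \<Rightarrow> complex) \<Rightarrow> 'n homog \<Rightarrow> 'n homog \<Rightarrow> complex \<Rightarrow> complex"
  where "log_slope c e g X V q =
    tau e g X V / q + dfhom e X V / (4 * fhom e X) + colR c e V / (2 * colR c e X)"

lemma colR_simps: "colR 0 e X = hy e X" "colR 1 e X = 4 * hx e X" "colR (- 1) e X = 4 * ht X"
  by (simp_all add: colR_def colA_def colB_def)

lemma col_linear:
  "colA c e (X + Y) = colA c e X + colA c e Y" "colA c e (a *s X) = a * colA c e X"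
  "colB c e (X + Y) = colB c e X + colB c e Y" "colB c e (a *s X) = a * colB c e X"
  "colR c e (X + Y) = colR c e X + colR c e Y" "colR c e (a *s X) = a * colR c e X"
  by (simp_all add: colR_def colA_def colB_def hom_linear algebra_simps)

lemma col_tendsto [tendsto_intros]:
  assumes "(\<psi> \<longlongrightarrow> X) F"
  shows "((\<lambda>u. colA c e (\<psi> u)) \<longlongrightarrow> colA c e X) F" "((\<lambda>u. colB c e (\<psi> u)) \<longlongrightarrow> colB c e X) F"
    "((\<lambda>u. colR c e (\<psi> u)) \<longlongrightarrow> colR c e X) F"
  unfolding colA_def colB_def colR_def by (intro tendsto_intros assms)+

lemma col_has_derivative:
  assumes "(\<psi> has_derivative \<psi>') F"
  shows "((\<lambda>u. colA c e (\<psi> u)) has_derivative (\<lambda>v. colA c e (\<psi>' v))) F"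
    "((\<lambda>u. colB c e (\<psi> u)) has_derivative (\<lambda>v. colB c e (\<psi>' v))) F"
    "((\<lambda>u. colR c e (\<psi> u)) has_derivative (\<lambda>v. colR c e (\<psi>' v))) F"
  unfolding colA_def colB_def colR_def
  by (auto intro!: derivative_intros hom_has_derivative[OF assms])

text \<open>Equivalently, the product of (\<open>linf e k\<close> + q) / (\<open>linf e k\<close> -
  q) over k = 0, 1, 2 is locally constant; the exponents for k <= 2 matter only up to a common
  summand.\<close>

lemma sig_sum:
  assumes "hx e X \<noteq> 0" "hy e X \<noteq> 0" "ht X \<noteq> 0"
  shows "sig e 0 X V + sig e 1 X V + sig e 2 X V = 0"
  unfolding sig_formula(1)[OF assms(1,2)] sig_formula(2)[OF assms(2,3)] sig_formula(3)[OF assms(1,3)]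
  using assms by (simp add: divide_simps) (simp add: algebra_simps)

text \<open>The exponents of the gauge given by \<open>c\<close>; the parameter \<open>\<mu>\<close> is free by \<open>sig_sum\<close>.\<close>

definition gcoeff :: "complex \<Rightarrow> complex \<Rightarrow> (nat \<Rightarrow> 'n::finite) \<Rightarrow> complex ^ 'n \<Rightarrow> nat \<Rightarrow> complex"
  where "gcoeff c \<mu> e lam k = coeff_lam e lam k + (if k \<le> 2 then \<mu> else 0)
    - (if k = 0 \<and> c = 1 then 1 else 0) + (if k = 1 \<and> c = - 1 then 1 else 0)"

text \<open>(p + q)^2 is 4 u v times (p + q) / (p - q); halving logarithmic derivatives gives the
  formula. \<open>D\<close> plays the part of the differential of q^2.\<close>

lemma log_derivative_factor:
  fixes p q u v :: complex
  assumes "p\<^sup>2 - q\<^sup>2 = 4 * (u * v)" "u \<noteq> 0" "v \<noteq> 0" "q \<noteq> 0"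
    and d: "2 * p * dp - D = 4 * (u * dv + v * du)"
  shows "dp + D / (2 * q) = (p + q) * ((p * D / 2 - q\<^sup>2 * dp) / (p\<^sup>2 - q\<^sup>2) / q + du / (2 * u) + dv / (2 * v))"
proof -
  have pq: "(p - q) * (p + q) = 4 * (u * v)" using assms(1) by (simp add: power2_eq_square algebra_simps)
  with assms have nz: "p - q \<noteq> 0" "p + q \<noteq> 0" by auto
  have "du / (2 * u) + dv / (2 * v) = (4 * (u * dv + v * du)) / (2 * (4 * (u * v)))"
    using assms by (simp add: divide_simps)
  also have "\<dots> = (2 * p * dp - D) / (2 * ((p - q) * (p + q)))" unfolding d pq ..
  finally have 1: "du / (2 * u) + dv / (2 * v) = (2 * p * dp - D) / (2 * ((p - q) * (p + q)))" .
  have 2: "p\<^sup>2 - q\<^sup>2 = (p - q) * (p + q)" by (simp add: power2_eq_square algebra_simps)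
  show ?thesis unfolding add.assoc 1 2
    using nz \<open>q \<noteq> 0\<close> by (simp add: divide_simps) (simp add: power2_eq_square algebra_simps)
qed

context numbering
begin

lemma tau_gcoeff:
  assumes "generic e X"
  shows "tau e (gcoeff c \<mu> e lam) X V = tau e (coeff_lam e lam) X V
    - (if c = 1 then sig e 0 X V else 0) + (if c = - 1 then sig e 1 X V else 0)"
proof -
  note nz = genericD[OF assms]
  have "tau e (gcoeff c \<mu> e lam) X V = tau e (coeff_lam e lam) X V
      + \<mu> * (sig e 0 X V + sig e 1 X V + sig e 2 X V)
      - (if c = 1 then sig e 0 X V else 0) + (if c = - 1 then sig e 1 X V else 0)"
    unfolding tau_split[OF card_ge_2] by (simp add: gcoeff_def algebra_simps)
  then show ?thesis using sig_sum[OF nz(1-3)] by simp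
qed

text \<open>The frame for c is the frame for 0 times \<open>gB / y\<close>, so the two slopes must
  differ by the logarithmic derivative of \<open>gB / y\<close>. It is computed by
  \<open>log_derivative_factor\<close> with 4 u v = 4 x y or 4 y t.\<close>

lemma gB_derivative:
  assumes gen: "generic e X" and c: "c \<in> {0, 1, - 1}" and q: "q\<^sup>2 = fhom e X"
  shows "colB c e V + c * (dfhom e X V / (2 * q)) = gB c e X q *
    (log_slope c e (gcoeff c \<mu> e lam) X V q - log_slope 0 e (coeff_lam e lam) X V q + hy e V / hy e X)"
proof -
  note nz = genericD[OF gen]
  have q0: "q \<noteq> 0" using nz q by auto
  have slope: "log_slope c e (gcoeff c \<mu> e lam) X V q - log_slope 0 e (coeff_lam e lam) X V q + hy e V / hy e X
      = ((if c = - 1 then sig e 1 X V else 0) - (if c = 1 then sig e 0 X V else 0)) / q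
        + colR c e V / (2 * colR c e X) + hy e V / (2 * hy e X)"
    unfolding log_slope_def tau_gcoeff[OF gen] colR_simps
    using nz q0 by (simp add: diff_divide_distrib add_divide_distrib)
  from c consider "c = 0" | "c = 1" | "c = - 1" by auto
  then show ?thesis
  proof cases
    case 1
    then show ?thesis unfolding slope using nz by (simp add: colB_def gB_def colR_simps)
  next
    case 2
    have "- linf e 0 V + dfhom e X V / (2 * q) = (- linf e 0 X + q) *
        ((- linf e 0 X * dfhom e X V / 2 - q\<^sup>2 * (- linf e 0 V)) / ((- linf e 0 X)\<^sup>2 - q\<^sup>2) / q
          + hx e V / (2 * hx e X) + hy e V / (2 * hy e X))"
    proof (rule log_derivative_factor)
      show "(- linf e 0 X)\<^sup>2 - q\<^sup>2 = 4 * (hx e X * hy e X)"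
        unfolding q power2_minus by (rule linf_square_minus_fhom)
    qed (use nz q0 in \<open>auto simp: dfhom_def algebra_simps\<close>)
    also have "(- linf e 0 X * dfhom e X V / 2 - q\<^sup>2 * (- linf e 0 V)) / ((- linf e 0 X)\<^sup>2 - q\<^sup>2) = - sig e 0 X V"
    proof -
      have "(- l * D / 2 - F * (- w)) / d = - ((l * D / 2 - F * w) / d)" for l D F w d :: complex
      proof -
        have "- l * D / 2 - F * (- w) = - (l * D / 2 - F * w)" by simp
        then show ?thesis by (simp only: minus_divide_left)
      qed
      then show ?thesis unfolding sig_def q power2_minus by blast
    qed
    finally show ?thesis
      unfolding slope using 2 nz by (simp add: gB_def colB_def colR_simps algebra_simps)
  next
    case 3
    have "linf e 1 V + dfhom e X V / (2 * q) = (linf e 1 X + q) *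
        ((linf e 1 X * dfhom e X V / 2 - q\<^sup>2 * linf e 1 V) / ((linf e 1 X)\<^sup>2 - q\<^sup>2) / q
          + hy e V / (2 * hy e X) + ht V / (2 * ht X))"
    proof (rule log_derivative_factor)
      show "(linf e 1 X)\<^sup>2 - q\<^sup>2 = 4 * (hy e X * ht X)"
        unfolding q by (rule linf_square_minus_fhom)
    qed (use nz q0 in \<open>auto simp: dfhom_def algebra_simps\<close>)
    also have "(linf e 1 X * dfhom e X V / 2 - q\<^sup>2 * linf e 1 V) / ((linf e 1 X)\<^sup>2 - q\<^sup>2) = sig e 1 X V"
      unfolding sig_def q ..
    finally have "linf e 1 V + dfhom e X V / (2 * q) = (linf e 1 X + q) *
        (sig e 1 X V / q + hy e V / (2 * hy e X) + ht V / (2 * ht X))" .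
    from arg_cong[OF this, of uminus] have "- (linf e 1 V + dfhom e X V / (2 * q)) = - (linf e 1 X + q) *
        (sig e 1 X V / q + hy e V / (2 * hy e X) + ht V / (2 * ht X))"
      by (simp only: minus_mult_left)
    then show ?thesis
      unfolding slope using 3 nz by (simp add: gB_def colB_def colR_simps algebra_simps)
  qed
qed

text \<open>This says that a frame column times a function with logarithmic derivative - L is
  horizontal. The rows are computed for c = 0, and \<open>gB_derivative\<close> carries them to the
  other gauges.\<close>

lemma column_identity_generic:
  fixes c q \<mu> :: complex and X V :: "'n homog" and lam :: "complex ^ 'n"
  assumes gen: "generic e X" and c: "c \<in> {0, 1, - 1}" and q: "q\<^sup>2 = fhom e X"
  defines "L \<equiv> log_slope c e (gcoeff c \<mu> e lam) X V q" and "M i j \<equiv> conn_mat e (coeff_lam e lam) X V $ i $ j"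
  shows "colA c e V + dfhom e X V / (2 * q) - gA c e X q * L
      = - (M 1 1 * gA c e X q + M 1 2 * gB c e X q)"
    and "colB c e V + c * (dfhom e X V / (2 * q)) - gB c e X q * L
      = - (M 2 1 * gA c e X q + M 2 2 * gB c e X q)"
proof -
  note nz = genericD[OF gen]
  have q0: "q \<noteq> 0" using nz q by auto
  define y where "y = hy e X"
  define dy where "dy = hy e V"
  define a where "a = - (hx e X - ht X)"
  define da where "da = - (hx e V - ht V)"
  define D where "D = dfhom e X V"
  define \<tau> where "\<tau> = tau e (coeff_lam e lam) X V"
  define L0 where "L0 = log_slope 0 e (coeff_lam e lam) X V q"
  define K where "K = gB c e X q"
  have y0: "y \<noteq> 0" using nz by (simp add: y_def)
  have L0: "L0 = \<tau> / q + D / (4 * q\<^sup>2) + dy / (2 * y)"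
    by (simp add: L0_def log_slope_def colR_simps q \<tau>_def D_def dy_def y_def)
  have M: "M 1 1 = - D / (4 * q\<^sup>2) + dy / (2 * y) + a * \<tau> / q\<^sup>2" "M 2 2 = - M 1 1"
    "M 2 1 = y * \<tau> / q\<^sup>2"
    "M 1 2 = - da / y + a * D / (2 * y * q\<^sup>2) + (q\<^sup>2 - a\<^sup>2) * \<tau> / (y * q\<^sup>2)"
    unfolding M_def conn_mat_nth conn11_def conn12_def conn21_def q
    by (simp_all add: D_def dy_def y_def a_def da_def \<tau>_def power2_eq_square algebra_simps flip: minus_divide_left)
       (simp_all flip: add_divide_distrib)
  have row1: "da + D / (2 * q) - (a + q) * L0 = - (M 1 1 * (a + q) + M 1 2 * y)"
    unfolding L0 M using q0 y0 by (simp add: divide_simps) (simp add: power2_eq_square algebra_simps)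
  have row2: "dy - y * L0 = - (M 2 1 * (a + q) + M 2 2 * y)"
    unfolding L0 M using q0 y0 by (simp add: divide_simps) (simp add: power2_eq_square algebra_simps)
  have dK: "colB c e V + c * (D / (2 * q)) = K * (L - L0 + dy / y)"
    unfolding K_def L_def L0_def D_def dy_def y_def by (rule gB_derivative[OF gen c q])
  \<comment> \<open>The frames for c and 0 are proportional because q^2 = f; \<open>dA\<close> is
    the derivative of this relation.\<close>
  have A: "gA c e X q * y = K * (a + q)"
  proof -
    have "gA c e X q * y - K * (a + q) = c * (fhom e X - q\<^sup>2)"
      unfolding gA_def K_def gB_def a_def y_def colA_def colB_def fhom_def fpoly_def
      by (simp add: power2_eq_square algebra_simps)
    then show ?thesis using q by simp
  qed
  have dA: "(colA c e V + D / (2 * q)) * y + gA c e X q * dy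
      = (colB c e V + c * (D / (2 * q))) * (a + q) + K * (da + D / (2 * q))"
  proof -
    define w where "w = D / (2 * q)"
    have 1: "colA c e V * y + colA c e X * dy = colB c e V * a + colB c e X * da + c * D"
      and 2: "colB c e V + c * da = dy" "c * a + colB c e X = y"
      unfolding a_def da_def y_def dy_def D_def dfhom_def colA_def colB_def
      by (simp_all add: algebra_simps)
    have 3: "q * w = D / 2" using q0 by (simp add: w_def)
    have "(colA c e V + w) * y + (colA c e X + q) * dy = (colA c e V * y + colA c e X * dy) + w * y + q * dy"
      by (simp add: algebra_simps)
    also have "\<dots> = (colB c e V * a + colB c e X * da) + q * (colB c e V + c * da) + w * (c * a + colB c e X)
        + 2 * c * (q * w)"
      unfolding 1 2 3 by (simp add: algebra_simps)
    also have "\<dots> = (colB c e V + c * w) * (a + q) + (colB c e X + c * q) * (da + w)"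
      by (simp add: algebra_simps)
    finally show ?thesis unfolding gA_def K_def gB_def w_def .
  qed
  have "(colA c e V + D / (2 * q)) * y - gA c e X q * L * y
      = K * (da + D / (2 * q) - (a + q) * L0)"
  proof -
    have 1: "(colA c e V + D / (2 * q)) * y
        = K * (L - L0 + dy / y) * (a + q) + K * (da + D / (2 * q)) - gA c e X q * dy"
      using dA unfolding dK by (simp only: eq_diff_eq)
    have 2: "gA c e X q = K * (a + q) / y" using A y0 by (simp add: eq_divide_eq)
    show ?thesis unfolding 1 2 using y0 by (simp add: field_simps)
  qed
  also have "\<dots> = - (M 1 1 * (gA c e X q * y) + M 1 2 * K * y)"
    unfolding row1 A by (simp add: algebra_simps)
  finally have "(colA c e V + D / (2 * q) - gA c e X q * L) * y
      = - (M 1 1 * gA c e X q + M 1 2 * K) * y"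
    by (simp add: algebra_simps)
  then show "colA c e V + dfhom e X V / (2 * q) - gA c e X q * L
      = - (M 1 1 * gA c e X q + M 1 2 * gB c e X q)"
    using y0 by (simp add: D_def K_def)
  have "(colB c e V + c * (D / (2 * q)) - K * L) * y = K * (dy - y * L0)"
    unfolding dK using y0 by (simp add: algebra_simps)
  also have "\<dots> = - (M 2 1 * (gA c e X q * y) + M 2 2 * K * y)"
    unfolding row2 A by (simp add: algebra_simps)
  finally have "(colB c e V + c * (D / (2 * q)) - K * L) * y = - (M 2 1 * gA c e X q + M 2 2 * K) * y"
    by (simp add: algebra_simps)
  then show "colB c e V + c * (dfhom e X V / (2 * q)) - gB c e X q * L
      = - (M 2 1 * gA c e X q + M 2 2 * gB c e X q)"
    using y0 by (simp add: D_def K_def)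
qed

text \<open>Poles are known along y = 0 if lam_0 differs from 1, along x = 0 if lam_1 is nonzero,
  and along t = 0 if lam_0 + lam_1 is nonzero. The frame has to degenerate along one of these, and
  an exponent with k <= 2 has to vanish unless both coordinates in P^2 - f = 4 u v are among
  them.\<close>

lemma gauge_choice:
  obtains c \<mu> where "c \<in> {0, 1, - 1}"
    "\<And>U X. regular_on lam U \<Longrightarrow> X \<in> U \<Longrightarrow> colR c e X \<noteq> 0"
    "\<And>U X k. regular_on lam U \<Longrightarrow> X \<in> U \<Longrightarrow> k \<le> CARD('n) \<Longrightarrow> gcoeff c \<mu> e lam k \<noteq> 0 \<Longrightarrow>
      (linf e k X)\<^sup>2 \<noteq> fhom e X"
proof -
  note gauge = that
  have quad: "(linf e k X)\<^sup>2 \<noteq> fhom e X"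
    if "regular_on lam U" "X \<in> U" "k \<le> CARD('n)" "gcoeff c \<mu> e lam k \<noteq> 0" "\<not> k \<le> 2" for U X k c \<mu>
    using that regular_on_quadric_nonzero[OF that(1,2), of k] by (simp add: gcoeff_def)
  have low: "(linf e k X)\<^sup>2 \<noteq> fhom e X"
    if "k \<le> 2" "k = 0 \<Longrightarrow> hx e X \<noteq> 0 \<and> hy e X \<noteq> 0" "k = 1 \<Longrightarrow> hy e X \<noteq> 0 \<and> ht X \<noteq> 0"
      "k = 2 \<Longrightarrow> hx e X \<noteq> 0 \<and> ht X \<noteq> 0" for k X
  proof -
    from that(1) consider "k = 0" | "k = 1" | "k = 2" by linarith
    then have "(linf e k X)\<^sup>2 - fhom e X \<noteq> 0"
      by cases (use that linf_square_minus_fhom[of e X] in simp_all)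
    then show ?thesis by simp
  qed
  have choose: thesis if "c \<in> {0, 1, - 1}"
    "\<And>U X. regular_on lam U \<Longrightarrow> X \<in> U \<Longrightarrow> colR c e X \<noteq> 0"
    "\<And>U X. regular_on lam U \<Longrightarrow> X \<in> U \<Longrightarrow> gcoeff c \<mu> e lam 0 \<noteq> 0 \<Longrightarrow> hx e X \<noteq> 0 \<and> hy e X \<noteq> 0"
    "\<And>U X. regular_on lam U \<Longrightarrow> X \<in> U \<Longrightarrow> gcoeff c \<mu> e lam 1 \<noteq> 0 \<Longrightarrow> hy e X \<noteq> 0 \<and> ht X \<noteq> 0"
    "\<And>U X. regular_on lam U \<Longrightarrow> X \<in> U \<Longrightarrow> gcoeff c \<mu> e lam 2 \<noteq> 0 \<Longrightarrow> hx e X \<noteq> 0 \<and> ht X \<noteq> 0" for c \<mu>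
  proof -
    note ch = that
    show thesis
    proof (rule gauge[OF ch(1,2)])
    show "(linf e k X)\<^sup>2 \<noteq> fhom e X" if r: "regular_on lam U" "X \<in> U" "k \<le> CARD('n)" "gcoeff c \<mu> e lam k \<noteq> 0"
      for U X k
    proof (cases "k \<le> 2")
      case True
      then show ?thesis by (rule low) (use r ch(3-5)[OF r(1,2)] in auto)
    qed (rule quad[OF r])
    qed
  qed
  consider "lam $ e 0 \<noteq> 1" "lam $ e 0 + lam $ e 1 = 0" | "lam $ e 0 \<noteq> 1" "lam $ e 0 + lam $ e 1 \<noteq> 0"
    | "lam $ e 0 = 1" "lam $ e 1 \<noteq> - 1" | "lam $ e 0 = 1" "lam $ e 1 = - 1" by blast
  then show thesis
  proof cases
    \<comment> \<open>t = 0 is not known to be a pole; \<mu> = - lam_1 kills the exponents 1 and 2,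
      which involve t.\<close>
    case 1
    then have l0: "lam $ e 0 = - (lam $ e 1)" by (simp add: eq_neg_iff_add_eq_0)
    show thesis
    proof (rule choose[of 0 "- (lam $ e 1)"])
      show "hx e X \<noteq> 0 \<and> hy e X \<noteq> 0"
        if "regular_on lam U" "X \<in> U" "gcoeff 0 (- (lam $ e 1)) e lam 0 \<noteq> 0" for U X
        using that 1 regular_on_hx_nonzero[OF that(1,2)] regular_on_hy_nonzero[OF that(1,2)]
        by (simp add: gcoeff_def)
    qed (use 1 l0 regular_on_hy_nonzero in \<open>auto simp: gcoeff_def colR_simps\<close>)
  next
    \<comment> \<open>y = 0 and t = 0 are poles; the exponent 2 is lam_1, which is nonzero only if x
      = 0 is a pole as well.\<close>
    case 2
    show thesis
    proof (rule choose[of 0 0])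
      show "hx e X \<noteq> 0 \<and> ht X \<noteq> 0" if "regular_on lam U" "X \<in> U" "gcoeff 0 0 e lam 2 \<noteq> 0" for U X
        using that 2 regular_on_hx_nonzero[OF that(1,2)] regular_on_ht_nonzero[OF that(1,2)]
        by (simp add: gcoeff_def)
      show "hy e X \<noteq> 0 \<and> ht X \<noteq> 0" if "regular_on lam U" "X \<in> U" for U X
        using 2 regular_on_hy_nonzero[OF that] regular_on_ht_nonzero[OF that] by simp
    qed (use 2 regular_on_hy_nonzero in \<open>auto simp: gcoeff_def colR_simps\<close>)
  next
    \<comment> \<open>y = 0 is not known to be a pole; c = - 1 raises the exponent - lam_0 = - 1 at
      k = 1, which involves y, to 0.\<close>
    case 3
    then have l: "lam $ e 0 + lam $ e 1 \<noteq> 0" by (simp add: add_eq_0_iff)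
    show thesis
    proof (rule choose[of "- 1" 0])
      show "hx e X \<noteq> 0 \<and> ht X \<noteq> 0" if "regular_on lam U" "X \<in> U" "gcoeff (- 1) 0 e lam 2 \<noteq> 0" for U X
        using that l regular_on_hx_nonzero[OF that(1,2)] regular_on_ht_nonzero[OF that(1,2)]
        by (simp add: gcoeff_def)
    qed (use 3 l regular_on_ht_nonzero in \<open>auto simp: gcoeff_def colR_simps\<close>)
  next
    \<comment> \<open>x = 0 is the only coordinate hyperplane known to be a pole; c = \<mu> = 1
      makes all three exponents vanish.\<close>
    case 4
    show thesis
    proof (rule choose[of 1 1])
      show "colR 1 e X \<noteq> 0" if "regular_on lam U" "X \<in> U" for U X
        using 4 regular_on_hx_nonzero[OF that] by (simp add: colR_simps)
    qed (use 4 in \<open>auto simp: gcoeff_def\<close>)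
  qed
qed

lemma column_identity:
  fixes c q \<mu> :: complex and X V :: "'n homog" and lam :: "complex ^ 'n"
  assumes reg: "regular_on lam U" and X: "X \<in> U" and c: "c \<in> {0, 1, - 1}" and q: "q\<^sup>2 = fhom e X"
    and R: "colR c e X \<noteq> 0"
    and den: "\<And>k. k \<le> CARD('n) \<Longrightarrow> gcoeff c \<mu> e lam k \<noteq> 0 \<Longrightarrow> (linf e k X)\<^sup>2 \<noteq> fhom e X"
  defines "L \<equiv> log_slope c e (gcoeff c \<mu> e lam) X V q" and "M i j \<equiv> conn lam X V $ i $ j"
  shows "colA c e V + dfhom e X V / (2 * q) - gA c e X q * L
      = - (M 1 1 * gA c e X q + M 1 2 * gB c e X q)"
    and "colB c e V + c * (dfhom e X V / (2 * q)) - gB c e X q * L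
      = - (M 2 1 * gA c e X q + M 2 2 * gB c e X q)"
proof -
  define C where "C i j Y = conn lam Y V $ i $ j" for i j Y
  \<comment> \<open>The branch of the square root of f through q; near X the argument of
    \<open>csqrt\<close> is close to 1, away from the cut.\<close>
  define Q where "Q Y = q * csqrt (fhom e Y / fhom e X)" for Y
  define Sl where "Sl Y = log_slope c e (gcoeff c \<mu> e lam) Y V (Q Y)" for Y
  have F: "fhom e X \<noteq> 0" by (rule regular_on_fhom_nonzero[OF reg X])
  then have q0: "q \<noteq> 0" using q by auto
  have U: "open U" using reg by (simp add: regular_on_def)
  have QX: "Q X = q" using F by (simp add: Q_def)
  have QQ: "(Q Y)\<^sup>2 = fhom e Y" for Y using F by (simp add: Q_def power_mult_distrib q)
  have C_lim: "(C i j \<longlongrightarrow> C i j X) (at X)" for i j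
    using regular_on_isCont[OF reg X] unfolding C_def isCont_def .
  have Q_lim: "(Q \<longlongrightarrow> Q X) (at X)"
  proof -
    have "((\<lambda>Y. fhom e Y / fhom e X) \<longlongrightarrow> fhom e X / fhom e X) (at X)"
      by (intro tendsto_intros F)
    moreover have "isCont csqrt (fhom e X / fhom e X)"
      using F by (intro continuous_at_csqrt) simp
    ultimately have "((\<lambda>Y. csqrt (fhom e Y / fhom e X)) \<longlongrightarrow> csqrt (fhom e X / fhom e X)) (at X)"
      by (rule isCont_tendsto_compose[rotated])
    then show ?thesis unfolding Q_def by (rule tendsto_mult[OF tendsto_const])
  qed
  have Sl_lim: "(Sl \<longlongrightarrow> Sl X) (at X)"
  proof -
    have "((\<lambda>Y. tau e (gcoeff c \<mu> e lam) Y V) \<longlongrightarrow> tau e (gcoeff c \<mu> e lam) X V) (at X)"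
      by (rule tau_tendsto[OF tendsto_ident_at den])
    then show ?thesis
      unfolding Sl_def log_slope_def using F q0 R QX by (intro tendsto_intros Q_lim) auto
  qed
  define g1 where "g1 Y = colA c e V + dfhom e Y V / (2 * Q Y) - gA c e Y (Q Y) * Sl Y
    + (C 1 1 Y * gA c e Y (Q Y) + C 1 2 Y * gB c e Y (Q Y))" for Y
  define g2 where "g2 Y = colB c e V + c * (dfhom e Y V / (2 * Q Y)) - gB c e Y (Q Y) * Sl Y
    + (C 2 1 Y * gA c e Y (Q Y) + C 2 2 Y * gB c e Y (Q Y))" for Y
  have gen: "C i j Y = conn_mat e (coeff_lam e lam) Y V $ i $ j" if "Y \<in> U" "generic e Y" for i j Y
    unfolding C_def regular_on_generic[OF reg that] ..
  have "g1 X = 0"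
  proof (rule continuous_zero_generic[OF _ U X])
    show "isCont g1 X"
      unfolding isCont_def g1_def gA_def gB_def using q0 QX
      by (intro tendsto_intros C_lim Q_lim Sl_lim) auto
    show "g1 Y = 0" if "Y \<in> U" "generic e Y" for Y
      unfolding g1_def Sl_def gen[OF that] column_identity_generic(1)[OF that(2) c QQ] by simp
  qed
  then show "colA c e V + dfhom e X V / (2 * q) - gA c e X q * L
      = - (M 1 1 * gA c e X q + M 1 2 * gB c e X q)"
    unfolding g1_def QX L_def M_def Sl_def C_def by (rule eq_neg_iff_add_eq_0[THEN iffD2])
  have "g2 X = 0"
  proof (rule continuous_zero_generic[OF _ U X])
    show "isCont g2 X"
      unfolding isCont_def g2_def gA_def gB_def using q0 QX
      by (intro tendsto_intros C_lim Q_lim Sl_lim) auto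
    show "g2 Y = 0" if "Y \<in> U" "generic e Y" for Y
      unfolding g2_def Sl_def gen[OF that] column_identity_generic(2)[OF that(2) c QQ] by simp
  qed
  then show "colB c e V + c * (dfhom e X V / (2 * q)) - gB c e X q * L
      = - (M 2 1 * gA c e X q + M 2 2 * gB c e X q)"
    unfolding g2_def QX L_def M_def Sl_def C_def by (rule eq_neg_iff_add_eq_0[THEN iffD2])
qed

end

section \<open>Horizontal sections along a map and their growth\<close>

lemma has_derivative_vec:
  fixes \<psi> :: "'a::real_normed_vector \<Rightarrow> complex ^ 'm::finite"
  assumes "\<And>j. ((\<lambda>u. \<psi> u $ j) has_derivative (\<lambda>v. \<psi>' v $ j)) (at u)"
  shows "(\<psi> has_derivative \<psi>') (at u)"
proof -
  have "((\<lambda>u. \<Sum>j\<in>UNIV. (\<psi> u $ j) *s axis j 1) has_derivative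
      (\<lambda>v. \<Sum>j\<in>UNIV. (\<psi>' v $ j) *s axis j 1)) (at u)"
    by (intro has_derivative_sum bounded_linear.has_derivative[OF bounded_linear_vector_scalar_mult] assms)
  then show ?thesis by (simp add: basis_expansion)
qed

lemma holomorphic_sev_vec:
  fixes \<psi> :: "complex ^ 'k::finite \<Rightarrow> complex ^ 'm::finite"
  assumes \<psi>: "\<And>j. holomorphic_sev (\<lambda>u. \<psi> u $ j) S" and u: "u \<in> S"
  shows "(\<psi> has_derivative ext_deriv \<psi> u) (at u)"
    and "ext_deriv \<psi> u (a *s v) = a *s ext_deriv \<psi> u v"
proof -
  have d: "(\<psi> has_derivative (\<lambda>v. \<chi> j. ext_deriv (\<lambda>u. \<psi> u $ j) u v)) (at u)"
    by (rule has_derivative_vec) (simp add: holomorphic_sev_has_derivative[OF \<psi> u])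
  then show "(\<psi> has_derivative ext_deriv \<psi> u) (at u)" by (simp add: ext_deriv_eq)
  show "ext_deriv \<psi> u (a *s v) = a *s ext_deriv \<psi> u v"
    unfolding ext_deriv_eq[OF d] by (simp add: vec_eq_iff holomorphic_sev_ext_deriv_scale[OF \<psi> u])
qed

lemma has_derivative_exp_complex:
  fixes g :: "'a::real_normed_vector \<Rightarrow> complex"
  assumes "(g has_derivative g') (at u)"
  shows "((\<lambda>x. exp (g x)) has_derivative (\<lambda>v. g' v * exp (g u))) (at u)"
proof -
  have "(exp has_derivative (\<lambda>h. h * exp (g u))) (at (g u))"
    by (rule has_derivative_eq_rhs[OF DERIV_exp[unfolded has_field_derivative_def]])
       (simp add: fun_eq_iff mult.commute)
  from diff_chain_at[OF assms this] show ?thesis by (simp add: o_def)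
qed

abbreviation pull_conn where
  "pull_conn A \<psi> u v i j \<equiv> conn_matrix A (\<psi> u) (ext_deriv \<psi> u v) $ i $ j"

definition horizontal_pair :: "'n::finite matrix_form \<Rightarrow> ('a::real_normed_vector \<Rightarrow> 'n homog) \<Rightarrow> 'a set \<Rightarrow>
    ('a \<Rightarrow> complex) \<Rightarrow> ('a \<Rightarrow> complex) \<Rightarrow> bool"
  where "horizontal_pair A \<psi> S y1 y2 \<longleftrightarrow> (\<forall>u\<in>S.
    (y1 has_derivative (\<lambda>v. - (pull_conn A \<psi> u v 1 1 * y1 u +
      pull_conn A \<psi> u v 1 2 * y2 u))) (at u) \<and>
    (y2 has_derivative (\<lambda>v. - (pull_conn A \<psi> u v 2 1 * y1 u +
      pull_conn A \<psi> u v 2 2 * y2 u))) (at u))"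

lemma horizontal_pair_wronskian:
  assumes "horizontal_pair A \<psi> S y1 y2" "horizontal_pair A \<psi> S z1 z2" "u \<in> S"
  shows "((\<lambda>u. y1 u * z2 u - y2 u * z1 u) has_derivative
    (\<lambda>v. - (pull_conn A \<psi> u v 1 1 + pull_conn A \<psi> u v 2 2)
      * (y1 u * z2 u - y2 u * z1 u))) (at u)"
proof -
  let ?C = "\<lambda>v i j. pull_conn A \<psi> u v i j"
  have d: "(y1 has_derivative (\<lambda>v. - (?C v 1 1 * y1 u + ?C v 1 2 * y2 u))) (at u)"
    "(y2 has_derivative (\<lambda>v. - (?C v 2 1 * y1 u + ?C v 2 2 * y2 u))) (at u)"
    "(z1 has_derivative (\<lambda>v. - (?C v 1 1 * z1 u + ?C v 1 2 * z2 u))) (at u)"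
    "(z2 has_derivative (\<lambda>v. - (?C v 2 1 * z1 u + ?C v 2 2 * z2 u))) (at u)"
    using assms unfolding horizontal_pair_def by blast+
  show ?thesis
    by (rule has_derivative_eq_rhs[OF has_derivative_diff[OF has_derivative_mult[OF d(1,4)] has_derivative_mult[OF d(2,3)]]])
       (simp add: fun_eq_iff algebra_simps)
qed

text \<open>Growth measured against a set of logarithms. It is requested only where \<psi> is
  bounded, since factors such as \<open>gA\<close> are controlled only there.\<close>

definition exp_bounded :: "('a \<Rightarrow> 'b::real_normed_vector) \<Rightarrow> 'a set \<Rightarrow> ('a \<Rightarrow> complex) set \<Rightarrow> ('a \<Rightarrow> complex) \<Rightarrow> bool"
  where "exp_bounded \<psi> S Ls y \<longleftrightarrow> (\<forall>T\<subseteq>S. bounded (\<psi> ` T) \<longrightarrow>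
    (\<exists>M\<ge>0. \<forall>u\<in>T. norm (y u) \<le> M * exp (M * (\<Sum>l\<in>Ls. norm (l u)))))"

lemma bounded_continuous_image_UNIV:
  fixes f :: "complex ^ 'm::finite \<Rightarrow> complex"
  assumes "continuous_on UNIV f" "bounded (\<psi> ` T)"
  obtains B where "B \<ge> 0" "\<And>u. u \<in> T \<Longrightarrow> norm (f (\<psi> u)) \<le> B"
proof -
  have "compact (f ` closure (\<psi> ` T))"
    using assms by (intro compact_continuous_image) (auto intro: continuous_on_subset simp: compact_closure)
  then obtain B where B: "\<And>x. x \<in> f ` closure (\<psi> ` T) \<Longrightarrow> norm x \<le> B"
    using compact_imp_bounded bounded_iff by metis
  have "norm (f (\<psi> u)) \<le> \<bar>B\<bar>" if "u \<in> T" for u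
    using B[of "f (\<psi> u)"] that closure_subset by force
  then show thesis using that[of "\<bar>B\<bar>"] by simp
qed

lemma hom_continuous_on:
  "continuous_on UNIV (fhom e)" "continuous_on UNIV (linf e k)"
  "continuous_on UNIV (colA c e)" "continuous_on UNIV (colB c e)" "continuous_on UNIV (colR c e)"
  unfolding continuous_on_def by (auto intro!: tendsto_intros)

text \<open>A function may tend to 0 at the polar divisor, so its logarithm has its real part
  bounded from above only; this is what \<open>log_polydisc_linear_growth\<close> asks for.\<close>

definition log_bounded_above :: "('a \<Rightarrow> 'b::real_normed_vector) \<Rightarrow> 'a set \<Rightarrow> ('a \<Rightarrow> complex) \<Rightarrow> bool"
  where "log_bounded_above \<psi> S l \<longleftrightarrow> (\<forall>T\<subseteq>S. bounded (\<psi> ` T) \<longrightarrow> (\<exists>m. \<forall>u\<in>T. Re (l u) \<le> m))"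

lemma log_bounded_aboveI:
  assumes "\<And>u. u \<in> S \<Longrightarrow> exp (l u) = g u"
    and "\<And>T. T \<subseteq> S \<Longrightarrow> bounded (\<psi> ` T) \<Longrightarrow> \<exists>B. \<forall>u\<in>T. norm (g u) \<le> B"
  shows "log_bounded_above \<psi> S l"
  unfolding log_bounded_above_def
proof (intro allI impI)
  fix T assume T: "T \<subseteq> S" "bounded (\<psi> ` T)"
  obtain B where B: "\<forall>u\<in>T. norm (g u) \<le> B" using assms(2)[OF T] by blast
  have "Re (l u) \<le> ln (\<bar>B\<bar> + 1)" if "u \<in> T" for u
  proof -
    have "exp (Re (l u)) = norm (g u)"
      using assms(1)[of u] T that by (metis norm_exp_eq_Re subsetD)
    also have "\<dots> \<le> \<bar>B\<bar> + 1" using B that by force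
    finally show ?thesis by (simp add: ln_ge_iff)
  qed
  then show "\<exists>m. \<forall>u\<in>T. Re (l u) \<le> m" by blast
qed

lemma exp_boundedI:
  assumes "finite Ls" "H \<ge> 0"
    and g: "\<And>T. T \<subseteq> S \<Longrightarrow> bounded (\<psi> ` T) \<Longrightarrow> \<exists>B. \<forall>u\<in>T. norm (g u) \<le> B"
    and h: "\<And>u. u \<in> S \<Longrightarrow> norm (h u) \<le> H * (\<Sum>l\<in>Ls. norm (l u))"
  shows "exp_bounded \<psi> S Ls (\<lambda>u. g u * exp (h u))"
  unfolding exp_bounded_def
proof (intro allI impI)
  fix T assume T: "T \<subseteq> S" "bounded (\<psi> ` T)"
  obtain B where B: "\<forall>u\<in>T. norm (g u) \<le> B" using g[OF T] by blast
  define M where "M = \<bar>B\<bar> + H"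
  have "norm (g u * exp (h u)) \<le> M * exp (M * (\<Sum>l\<in>Ls. norm (l u)))" if "u \<in> T" for u
  proof -
    define N where "N = (\<Sum>l\<in>Ls. norm (l u))"
    have N: "N \<ge> 0" unfolding N_def by (intro sum_nonneg) auto
    have "norm (exp (h u)) \<le> exp (norm (h u))" by (rule norm_exp)
    also have "\<dots> \<le> exp (M * N)"
    proof -
      have "norm (h u) \<le> H * N" unfolding N_def using h T that by blast
      also have "\<dots> \<le> M * N" using N by (intro mult_right_mono) (auto simp: M_def)
      finally show ?thesis by simp
    qed
    finally have "norm (exp (h u)) \<le> exp (M * N)" .
    moreover have "norm (g u) \<le> M" using B that \<open>H \<ge> 0\<close> unfolding M_def by force
    ultimately show ?thesis
      unfolding norm_mult N_def[symmetric] using \<open>H \<ge> 0\<close> by (intro mult_mono) (auto simp: M_def)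
  qed
  moreover have "M \<ge> 0" using \<open>H \<ge> 0\<close> by (simp add: M_def)
  ultimately show "\<exists>M\<ge>0. \<forall>u\<in>T. norm (g u * exp (h u)) \<le> M * exp (M * (\<Sum>l\<in>Ls. norm (l u)))" by blast
qed

context numbering
begin

text \<open>Convexity of S yields the logarithms, and \<open>gauge_choice\<close> guarantees that no
  function whose logarithm is taken has a zero on S. Flatness uses it for the identity on a ball,
  moderate growth for a test map pulled back to the universal cover.\<close>

lemma fundamental_system:
  fixes \<psi> :: "complex ^ 'k::finite \<Rightarrow> 'n homog" and lam :: "complex ^ 'n"
  assumes S: "open S" "convex S" and \<psi>: "\<And>j. holomorphic_sev (\<lambda>u. \<psi> u $ j) S"
    and reg: "\<And>u. u \<in> S \<Longrightarrow> \<psi> u \<noteq> 0 \<and> \<psi> u \<notin> polar lam"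
  obtains y1 y2 z1 z2 Ls where
    "horizontal_pair (A_lambda e lam) \<psi> S y1 y2" "horizontal_pair (A_lambda e lam) \<psi> S z1 z2"
    "\<And>u. u \<in> S \<Longrightarrow> y1 u * z2 u - y2 u * z1 u = 2"
    "finite Ls" "\<And>l. l \<in> Ls \<Longrightarrow> holomorphic_sev l S" "\<And>l. l \<in> Ls \<Longrightarrow> log_bounded_above \<psi> S l"
    "exp_bounded \<psi> S Ls y1" "exp_bounded \<psi> S Ls y2" "exp_bounded \<psi> S Ls z1" "exp_bounded \<psi> S Ls z2"
proof -
  obtain c \<mu> where c: "c \<in> {0, 1, - 1}"
    and colR_nz: "\<And>U X. regular_on lam U \<Longrightarrow> X \<in> U \<Longrightarrow> colR c e X \<noteq> 0"
    and linf_nz: "\<And>U X k. regular_on lam U \<Longrightarrow> X \<in> U \<Longrightarrow> k \<le> CARD('n) \<Longrightarrow> gcoeff c \<mu> e lam k \<noteq> 0 \<Longrightarrow>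
      (linf e k X)\<^sup>2 \<noteq> fhom e X"
    using gauge_choice by metis
  define G where "G = gcoeff c \<mu> e lam"
  \<comment> \<open>For the other indices P + q or P - q may vanish on S and have no
    logarithm.\<close>
  define J where "J = {k. k \<le> CARD('n) \<and> G k \<noteq> 0}"
  have fin: "finite J" unfolding J_def by simp
  have regU: "\<exists>U. \<psi> u \<in> U \<and> regular_on lam U" if "u \<in> S" for u
    using regular_on_neighbourhood[of "\<psi> u" lam] reg[OF that] by metis
  have nz: "fhom e (\<psi> u) \<noteq> 0" "colR c e (\<psi> u) \<noteq> 0" if "u \<in> S" for u
    using regU[OF that] regular_on_fhom_nonzero colR_nz by blast+
  have nzJ: "(linf e k (\<psi> u))\<^sup>2 \<noteq> fhom e (\<psi> u)" if "u \<in> S" "k \<in> J" for u k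
    using regU[OF that(1)] linf_nz that(2) unfolding J_def G_def by blast
  define V where "V u v = ext_deriv \<psi> u v" for u v
  let ?D = "\<lambda>u v. dfhom e (\<psi> u) (V u v)"
  have d\<psi>: "(\<psi> has_derivative V u) (at u)" if "u \<in> S" for u
    using holomorphic_sev_vec(1)[OF \<psi> that] by (simp add: V_def[abs_def])
  have V_scale: "V u (a *s v) = a *s V u v" if "u \<in> S" for u a v
    unfolding V_def by (rule holomorphic_sev_vec(2)[OF \<psi> that])
  have hF: "holomorphic_sev (\<lambda>u. fhom e (\<psi> u)) S"
    by (rule holomorphic_sevI[OF fhom_has_derivative[OF d\<psi>]]) (simp_all add: V_scale dfhom_linear)
  obtain l0 where l0: "holomorphic_sev l0 S" "\<And>u. u \<in> S \<Longrightarrow> exp (l0 u) = fhom e (\<psi> u)"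
    using holomorphic_sev_logarithm[OF S hF nz(1)] by blast
  have hR: "holomorphic_sev (\<lambda>u. colR c e (\<psi> u)) S"
    by (rule holomorphic_sevI[OF col_has_derivative(3)[OF d\<psi>]]) (simp_all add: V_scale col_linear)
  obtain lR where lR: "holomorphic_sev lR S" "\<And>u. u \<in> S \<Longrightarrow> exp (lR u) = colR c e (\<psi> u)"
    using holomorphic_sev_logarithm[OF S hR nz(2)] by blast
  define q where "q u = exp (l0 u / 2)" for u
  have q2: "(q u)\<^sup>2 = fhom e (\<psi> u)" if "u \<in> S" for u
    using l0(2)[OF that] by (simp add: q_def flip: exp_of_nat_mult)
  have q0: "q u \<noteq> 0" for u by (simp add: q_def)
  have dl0: "(l0 has_derivative (\<lambda>v. ?D u v / fhom e (\<psi> u))) (at u)" if "u \<in> S" for u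
    by (rule has_derivative_logarithm[OF S(1) that holomorphic_sev_continuous_on[OF l0(1)] l0(2)
          fhom_has_derivative[OF d\<psi>[OF that]]])
  have dlR: "(lR has_derivative (\<lambda>v. colR c e (V u v) / colR c e (\<psi> u))) (at u)" if "u \<in> S" for u
    by (rule has_derivative_logarithm[OF S(1) that holomorphic_sev_continuous_on[OF lR(1)] lR(2)
          col_has_derivative(3)[OF d\<psi>[OF that]]])
  have dq: "(q has_derivative (\<lambda>v. ?D u v / (2 * q u))) (at u)" if "u \<in> S" for u
  proof -
    have "(q has_derivative (\<lambda>v. ?D u v / fhom e (\<psi> u) / 2 * q u)) (at u)"
      unfolding q_def
      by (intro has_derivative_exp_complex bounded_linear.has_derivative[OF bounded_linear_divide] dl0 that)
    then show ?thesis
      unfolding q2[OF that, symmetric] using q0[of u]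
      by (simp add: power2_eq_square field_simps)
  qed
  have dP: "((\<lambda>u. linf e k (\<psi> u) + \<sigma> * q u) has_derivative
      (\<lambda>v. linf e k (V u v) + \<sigma> * (?D u v / (2 * q u)))) (at u)" if "u \<in> S" for u k \<sigma>
    by (intro has_derivative_add has_derivative_mult_right hom_has_derivative(4) d\<psi> dq that)
  have ex_log: "\<exists>l. holomorphic_sev l S \<and> (\<forall>u\<in>S. exp (l u) = linf e k (\<psi> u) + \<sigma> * q u)"
    if k: "k \<in> J" and \<sigma>: "\<sigma> = 1 \<or> \<sigma> = - 1" for k \<sigma>
  proof -
    have hol: "holomorphic_sev (\<lambda>u. linf e k (\<psi> u) + \<sigma> * q u) S"
      by (rule holomorphic_sevI[OF dP]) (simp_all add: V_scale dfhom_linear hom_linear distrib_left mult_ac)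
    have nonzero: "linf e k (\<psi> u) + \<sigma> * q u \<noteq> 0" if "u \<in> S" for u
    proof
      assume "linf e k (\<psi> u) + \<sigma> * q u = 0"
      then have "linf e k (\<psi> u) = - (\<sigma> * q u)" by (simp add: eq_neg_iff_add_eq_0)
      then have "(linf e k (\<psi> u))\<^sup>2 = (q u)\<^sup>2" using \<sigma> by auto
      then show False using nzJ[OF that k] q2[OF that] by simp
    qed
    obtain l where "holomorphic_sev l S" "\<And>u. u \<in> S \<Longrightarrow> exp (l u) = linf e k (\<psi> u) + \<sigma> * q u"
      using holomorphic_sev_logarithm[OF S hol nonzero] by blast
    then show ?thesis by blast
  qed
  have "\<forall>k\<in>J. \<exists>l. holomorphic_sev l S \<and> (\<forall>u\<in>S. exp (l u) = linf e k (\<psi> u) + 1 * q u)"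
    by (intro ballI ex_log) auto
  then obtain lp where "\<forall>k\<in>J. holomorphic_sev (lp k) S \<and> (\<forall>u\<in>S. exp (lp k u) = linf e k (\<psi> u) + 1 * q u)"
    by (rule bchoice[THEN exE])
  then have lp: "\<And>k. k \<in> J \<Longrightarrow> holomorphic_sev (lp k) S"
      "\<And>k u. k \<in> J \<Longrightarrow> u \<in> S \<Longrightarrow> exp (lp k u) = linf e k (\<psi> u) + 1 * q u" by blast+
  have "\<forall>k\<in>J. \<exists>l. holomorphic_sev l S \<and> (\<forall>u\<in>S. exp (l u) = linf e k (\<psi> u) + (- 1) * q u)"
    by (intro ballI ex_log) auto
  then obtain lm where "\<forall>k\<in>J. holomorphic_sev (lm k) S \<and> (\<forall>u\<in>S. exp (lm k u) = linf e k (\<psi> u) + (- 1) * q u)"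
    by (rule bchoice[THEN exE])
  then have lm: "\<And>k. k \<in> J \<Longrightarrow> holomorphic_sev (lm k) S"
      "\<And>k u. k \<in> J \<Longrightarrow> u \<in> S \<Longrightarrow> exp (lm k u) = linf e k (\<psi> u) + (- 1) * q u" by blast+
  \<comment> \<open>A primitive of the pullback of \<open>tau / q\<close>.\<close>
  define h where "h u = (\<Sum>k\<in>J. G k * ((lp k u - lm k u) / 2))" for u
  have dh: "(h has_derivative (\<lambda>v. tau e G (\<psi> u) (V u v) / q u)) (at u)" if u: "u \<in> S" for u
  proof -
    have "((\<lambda>u. G k * ((lp k u - lm k u) / 2)) has_derivative (\<lambda>v. G k * (sig e k (\<psi> u) (V u v) / q u))) (at u)"
      if k: "k \<in> J" for k
    proof -
      have dlp: "(lp k has_derivative (\<lambda>v. (linf e k (V u v) + 1 * (?D u v / (2 * q u))) /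
          (linf e k (\<psi> u) + 1 * q u))) (at u)"
        by (rule has_derivative_logarithm[OF S(1) u holomorphic_sev_continuous_on[OF lp(1)[OF k]] lp(2)[OF k] dP[OF u]])
      have dlm: "(lm k has_derivative (\<lambda>v. (linf e k (V u v) + (- 1) * (?D u v / (2 * q u))) /
          (linf e k (\<psi> u) + (- 1) * q u))) (at u)"
        by (rule has_derivative_logarithm[OF S(1) u holomorphic_sev_continuous_on[OF lm(1)[OF k]] lm(2)[OF k] dP[OF u]])
      have "((dp + 1 * (D / (2 * r))) / (p + 1 * r) - (dp + (- 1) * (D / (2 * r))) / (p + (- 1) * r)) / 2
          = (p * D / 2 - r\<^sup>2 * dp) / (p\<^sup>2 - r\<^sup>2) / r"
        if "r \<noteq> 0" "p\<^sup>2 \<noteq> r\<^sup>2" for p r dp D :: complex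
      proof -
        have f: "p\<^sup>2 - r\<^sup>2 = (p + r) * (p - r)" by (simp add: power2_eq_square algebra_simps)
        have n: "p + r \<noteq> 0" "p - r \<noteq> 0" using that f by auto
        show ?thesis
          unfolding f using n \<open>r \<noteq> 0\<close> by (simp add: divide_simps) (simp add: power2_eq_square algebra_simps)
      qed
      then have *: "((linf e k (V u v) + 1 * (?D u v / (2 * q u))) / (linf e k (\<psi> u) + 1 * q u)
          - (linf e k (V u v) + (- 1) * (?D u v / (2 * q u))) / (linf e k (\<psi> u) + (- 1) * q u)) / 2
          = sig e k (\<psi> u) (V u v) / q u" for v
        unfolding sig_def q2[OF u, symmetric] using q0 nzJ[OF u k] q2[OF u] by metis
      show ?thesis
        by (rule has_derivative_eq_rhs[OF has_derivative_mult_right[OF bounded_linear.has_derivative[OF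
              bounded_linear_divide has_derivative_diff[OF dlp dlm]]]])
           (simp only: *)
    qed
    then have "(h has_derivative (\<lambda>v. \<Sum>k\<in>J. G k * (sig e k (\<psi> u) (V u v) / q u))) (at u)"
      unfolding h_def by (rule has_derivative_sum)
    moreover have "(\<Sum>k\<in>J. G k * (sig e k (\<psi> u) (V u v) / q u)) = tau e G (\<psi> u) (V u v) / q u" for v
      unfolding tau_def sum_divide_distrib times_divide_eq_right by (rule sum.mono_neutral_left) (auto simp: J_def)
    ultimately show ?thesis by simp
  qed
  \<comment> \<open>exp (2 w) = q * colR, so the determinant 2 * q * colR of the frame turns into
    the constant Wronskian 2.\<close>
  define w where "w u = l0 u / 4 + lR u / 2" for u
  have dw: "(w has_derivative (\<lambda>v. ?D u v / fhom e (\<psi> u) / 4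
      + colR c e (V u v) / colR c e (\<psi> u) / 2)) (at u)" if "u \<in> S" for u
    unfolding w_def
    by (intro has_derivative_add bounded_linear.has_derivative[OF bounded_linear_divide] dl0 dlR that)
  define E where "E \<sigma> u = exp (- \<sigma> * h u - w u)" for \<sigma> u
  have pair: "horizontal_pair (A_lambda e lam) \<psi> S (\<lambda>u. gA c e (\<psi> u) (\<sigma> * q u) * E \<sigma> u)
      (\<lambda>u. gB c e (\<psi> u) (\<sigma> * q u) * E \<sigma> u)" if \<sigma>: "\<sigma> = 1 \<or> \<sigma> = - 1" for \<sigma>
    unfolding horizontal_pair_def
  proof
    fix u assume u: "u \<in> S"
    obtain U where U: "\<psi> u \<in> U" "regular_on lam U" using regU[OF u] by blast
    have sq: "(\<sigma> * q u)\<^sup>2 = fhom e (\<psi> u)" using \<sigma> q2[OF u] by (auto simp: power_mult_distrib)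
    have \<sigma>1: "\<sigma> * (x / (2 * q u)) = x / (2 * (\<sigma> * q u))" "\<sigma> * (x / q u) = x / (\<sigma> * q u)" for x
      using \<sigma> by auto
    have dE: "(E \<sigma> has_derivative (\<lambda>v. - log_slope c e G (\<psi> u) (V u v) (\<sigma> * q u) * E \<sigma> u)) (at u)"
    proof -
      have "(E \<sigma> has_derivative (\<lambda>v. (- \<sigma> * (tau e G (\<psi> u) (V u v) / q u) - (?D u v / fhom e (\<psi> u) / 4
          + colR c e (V u v) / colR c e (\<psi> u) / 2)) * E \<sigma> u)) (at u)"
        unfolding E_def
        by (intro has_derivative_exp_complex has_derivative_diff has_derivative_mult_right dh dw u)
      moreover have "- \<sigma> * (tau e G (\<psi> u) (V u v) / q u) - (?D u v / fhom e (\<psi> u) / 4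
          + colR c e (V u v) / colR c e (\<psi> u) / 2) = - log_slope c e G (\<psi> u) (V u v) (\<sigma> * q u)" for v
        unfolding log_slope_def \<sigma>1(2)[symmetric] by (simp add: mult.commute)
      ultimately show ?thesis by simp
    qed
    have dA: "((\<lambda>u. gA c e (\<psi> u) (\<sigma> * q u)) has_derivative
        (\<lambda>v. colA c e (V u v) + ?D u v / (2 * (\<sigma> * q u)))) (at u)"
      unfolding gA_def \<sigma>1(1)[symmetric]
      by (intro has_derivative_add has_derivative_mult_right col_has_derivative d\<psi> dq u)
    have dB: "((\<lambda>u. gB c e (\<psi> u) (\<sigma> * q u)) has_derivative
        (\<lambda>v. colB c e (V u v) + c * (?D u v / (2 * (\<sigma> * q u))))) (at u)"
      unfolding gB_def \<sigma>1(1)[symmetric]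
      by (intro has_derivative_add has_derivative_mult_right col_has_derivative d\<psi> dq u)
    let ?L = "\<lambda>v. log_slope c e G (\<psi> u) (V u v) (\<sigma> * q u)"
    let ?C = "\<lambda>v i j. pull_conn (A_lambda e lam) \<psi> u v i j"
    let ?a = "gA c e (\<psi> u) (\<sigma> * q u)" and ?b = "gB c e (\<psi> u) (\<sigma> * q u)"
    have id: "colA c e (V u v) + ?D u v / (2 * (\<sigma> * q u))
          - ?a * ?L v = - (?C v 1 1 * ?a + ?C v 1 2 * ?b)"
      "colB c e (V u v) + c * (?D u v / (2 * (\<sigma> * q u)))
          - ?b * ?L v = - (?C v 2 1 * ?a + ?C v 2 2 * ?b)" for v
      unfolding V_def[symmetric] G_def
      by (rule column_identity[OF U(2,1) c sq colR_nz[OF U(2,1)] linf_nz[OF U(2,1)]]; assumption)+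
    have "((\<lambda>u. gA c e (\<psi> u) (\<sigma> * q u) * E \<sigma> u) has_derivative
        (\<lambda>v. - (?C v 1 1 * (?a * E \<sigma> u) + ?C v 1 2 * (?b * E \<sigma> u)))) (at u)"
    proof (rule has_derivative_eq_rhs[OF has_derivative_mult[OF dA dE]], rule ext)
      fix v
      have "?a * (- ?L v * E \<sigma> u)
          + (colA c e (V u v) + ?D u v / (2 * (\<sigma> * q u))) * E \<sigma> u
          = (colA c e (V u v) + ?D u v / (2 * (\<sigma> * q u))
            - ?a * ?L v) * E \<sigma> u"
        by (simp add: left_diff_distrib)
      also have "\<dots> = - (?C v 1 1 * ?a + ?C v 1 2 * ?b) * E \<sigma> u"
        unfolding id(1) ..
      finally show "?a * (- ?L v * E \<sigma> u)
          + (colA c e (V u v) + ?D u v / (2 * (\<sigma> * q u))) * E \<sigma> u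
          = - (?C v 1 1 * (?a * E \<sigma> u) + ?C v 1 2 * (?b * E \<sigma> u))"
        by (simp add: algebra_simps)
    qed
    moreover have "((\<lambda>u. gB c e (\<psi> u) (\<sigma> * q u) * E \<sigma> u) has_derivative
        (\<lambda>v. - (?C v 2 1 * (?a * E \<sigma> u) + ?C v 2 2 * (?b * E \<sigma> u)))) (at u)"
    proof (rule has_derivative_eq_rhs[OF has_derivative_mult[OF dB dE]], rule ext)
      fix v
      have "?b * (- ?L v * E \<sigma> u)
          + (colB c e (V u v) + c * (?D u v / (2 * (\<sigma> * q u)))) * E \<sigma> u
          = (colB c e (V u v) + c * (?D u v / (2 * (\<sigma> * q u)))
            - ?b * ?L v) * E \<sigma> u"
        by (simp add: left_diff_distrib)
      also have "\<dots> = - (?C v 2 1 * ?a + ?C v 2 2 * ?b) * E \<sigma> u"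
        unfolding id(2) ..
      finally show "?b * (- ?L v * E \<sigma> u)
          + (colB c e (V u v) + c * (?D u v / (2 * (\<sigma> * q u)))) * E \<sigma> u
          = - (?C v 2 1 * (?a * E \<sigma> u) + ?C v 2 2 * (?b * E \<sigma> u))"
        by (simp add: algebra_simps)
    qed
    ultimately show "((\<lambda>u. gA c e (\<psi> u) (\<sigma> * q u) * E \<sigma> u) has_derivative
        (\<lambda>v. - (?C v 1 1 * (?a * E \<sigma> u) + ?C v 1 2 * (?b * E \<sigma> u)))) (at u) \<and>
      ((\<lambda>u. gB c e (\<psi> u) (\<sigma> * q u) * E \<sigma> u) has_derivative
        (\<lambda>v. - (?C v 2 1 * (?a * E \<sigma> u) + ?C v 2 2 * (?b * E \<sigma> u)))) (at u)" by blast
  qed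
  have det: "gA c e (\<psi> u) (1 * q u) * E 1 u * (gB c e (\<psi> u) ((- 1) * q u) * E (- 1) u)
      - gB c e (\<psi> u) (1 * q u) * E 1 u * (gA c e (\<psi> u) ((- 1) * q u) * E (- 1) u) = 2" if u: "u \<in> S" for u
  proof -
    have "E 1 u * E (- 1) u = exp (- (l0 u / 2 + lR u))"
      unfolding E_def w_def exp_add[symmetric] by (simp add: algebra_simps flip: mult_2)
    also have "\<dots> = inverse (q u * colR c e (\<psi> u))"
      by (simp only: exp_minus exp_add q_def lR(2)[OF u, symmetric])
    finally have EE: "E 1 u * E (- 1) u = inverse (q u * colR c e (\<psi> u))" .
    have "gA c e (\<psi> u) (1 * q u) * E 1 u * (gB c e (\<psi> u) ((- 1) * q u) * E (- 1) u)
      - gB c e (\<psi> u) (1 * q u) * E 1 u * (gA c e (\<psi> u) ((- 1) * q u) * E (- 1) u)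
      = (2 * (q u * colR c e (\<psi> u))) * (E 1 u * E (- 1) u)"
      unfolding gA_def gB_def colR_def by (simp add: algebra_simps)
    then show ?thesis unfolding EE using q0[of u] nz(2)[OF u] by (simp add: field_simps)
  qed
  define Ls where "Ls = {l0, lR} \<union> lp ` J \<union> lm ` J"
  have finL: "finite Ls" unfolding Ls_def using fin by simp
  have holL: "holomorphic_sev l S" if "l \<in> Ls" for l
    using that l0(1) lR(1) lp(1) lm(1) unfolding Ls_def by blast
  have bd: "\<exists>B. \<forall>u\<in>T. norm (f (\<psi> u)) \<le> B" if "bounded (\<psi> ` T)" "continuous_on UNIV f"
    for T and f :: "'n homog \<Rightarrow> complex"
    using bounded_continuous_image_UNIV[OF that(2,1)] by metis
  have bdq: "\<exists>B. \<forall>u\<in>T. norm (q u) \<le> B" if T: "T \<subseteq> S" "bounded (\<psi> ` T)" for T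
  proof -
    obtain B where B: "\<forall>u\<in>T. norm (fhom e (\<psi> u)) \<le> B" using bd[OF T(2) hom_continuous_on(1)] by blast
    have "norm (q u) \<le> B + 1" if "u \<in> T" for u
    proof -
      have "(norm (q u))\<^sup>2 \<le> B" using B that q2[of u] T(1) by (metis norm_power subsetD)
      moreover have "2 * norm (q u) \<le> (norm (q u))\<^sup>2 + 1"
        using sum_squares_ge_zero[of "norm (q u) - 1" 0] by (simp add: power2_eq_square algebra_simps)
      moreover have "norm (q u) \<ge> 0" by simp
      ultimately show ?thesis using zero_le_power2[of "norm (q u)"] by linarith
    qed
    then show ?thesis by blast
  qed
  have bd_sum: "\<exists>B. \<forall>u\<in>T. norm (f (\<psi> u) + \<sigma> * q u) \<le> B"
    if T: "T \<subseteq> S" "bounded (\<psi> ` T)" and f: "continuous_on UNIV f" for T \<sigma> and f :: "'n homog \<Rightarrow> complex"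
  proof -
    obtain B1 B2 where B: "\<forall>u\<in>T. norm (f (\<psi> u)) \<le> B1" "\<forall>u\<in>T. norm (q u) \<le> B2"
      using bd[OF T(2) f] bdq[OF T] by blast
    have "norm (f (\<psi> u) + \<sigma> * q u) \<le> B1 + norm \<sigma> * B2" if "u \<in> T" for u
      using B that by (intro order_trans[OF norm_triangle_ineq] add_mono) (auto simp: norm_mult intro: mult_left_mono)
    then show ?thesis by blast
  qed
  have boundL: "log_bounded_above \<psi> S l" if "l \<in> Ls" for l
  proof -
    have "log_bounded_above \<psi> S l0" by (rule log_bounded_aboveI[OF l0(2)], assumption, rule bd[OF _ hom_continuous_on(1)])
    moreover have "log_bounded_above \<psi> S lR" by (rule log_bounded_aboveI[OF lR(2)], assumption, rule bd[OF _ hom_continuous_on(5)])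
    moreover have "log_bounded_above \<psi> S (lp k)" if "k \<in> J" for k
      by (rule log_bounded_aboveI[OF lp(2)[OF that]], assumption, rule bd_sum[OF _ _ hom_continuous_on(2)])
    moreover have "log_bounded_above \<psi> S (lm k)" if "k \<in> J" for k
      by (rule log_bounded_aboveI[OF lm(2)[OF that]], assumption, rule bd_sum[OF _ _ hom_continuous_on(2)])
    ultimately show ?thesis using that unfolding Ls_def by blast
  qed
  define H where "H = (\<Sum>k\<in>J. norm (G k)) + 2"
  have "H \<ge> 0" unfolding H_def by (intro add_nonneg_nonneg sum_nonneg) auto
  have hb: "norm (- \<sigma> * h u - w u) \<le> H * (\<Sum>l\<in>Ls. norm (l u))" if \<sigma>: "\<sigma> = 1 \<or> \<sigma> = - 1" for \<sigma> u
  proof -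
    define N where "N = (\<Sum>l\<in>Ls. norm (l u))"
    have le: "norm (l u) \<le> N" if "l \<in> Ls" for l
      unfolding N_def using finL that by (intro member_le_sum) auto
    have "norm (h u) \<le> (\<Sum>k\<in>J. norm (G k) * N)"
      unfolding h_def
    proof (rule order_trans[OF norm_sum], rule sum_mono)
      fix k assume k: "k \<in> J"
      have "norm (lp k u - lm k u) \<le> norm (lp k u) + norm (lm k u)" by (rule norm_triangle_ineq4)
      also have "\<dots> \<le> N + N" using k by (intro add_mono le) (auto simp: Ls_def)
      finally have "norm ((lp k u - lm k u) / 2) \<le> N" by (simp add: norm_divide)
      then show "norm (G k * ((lp k u - lm k u) / 2)) \<le> norm (G k) * N"
        unfolding norm_mult by (intro mult_left_mono) auto
    qed
    moreover have "norm (w u) \<le> norm (l0 u / 4) + norm (lR u / 2)"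
      unfolding w_def by (rule norm_triangle_ineq)
    moreover have "norm (l0 u) \<le> N" "norm (lR u) \<le> N" by (auto intro!: le simp: Ls_def)
    moreover have "norm (- \<sigma> * h u) = norm (h u)" using \<sigma> by auto
    moreover have "norm (- \<sigma> * h u - w u) \<le> norm (- \<sigma> * h u) + norm (w u)" by (rule norm_triangle_ineq4)
    moreover have "0 \<le> norm (l0 u)" "norm (l0 u / 4) = norm (l0 u) / 4" "norm (lR u / 2) = norm (lR u) / 2"
      by (simp_all add: norm_divide)
    ultimately have "norm (- \<sigma> * h u - w u) \<le> (\<Sum>k\<in>J. norm (G k) * N) + 2 * N"
      by linarith
    then show ?thesis unfolding N_def[symmetric] H_def by (simp add: sum_distrib_right distrib_right)
  qed
  have ebA: "exp_bounded \<psi> S Ls (\<lambda>u. gA c e (\<psi> u) (\<sigma> * q u) * E \<sigma> u)" if \<sigma>: "\<sigma> = 1 \<or> \<sigma> = - 1" for \<sigma>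
    unfolding E_def gA_def
    by (rule exp_boundedI[OF finL \<open>H \<ge> 0\<close> _ hb[OF \<sigma>]], rule bd_sum[OF _ _ hom_continuous_on(3)])
  have ebB: "exp_bounded \<psi> S Ls (\<lambda>u. gB c e (\<psi> u) (\<sigma> * q u) * E \<sigma> u)" if \<sigma>: "\<sigma> = 1 \<or> \<sigma> = - 1" for \<sigma>
    unfolding E_def gB_def mult.assoc[symmetric, of c]
    by (rule exp_boundedI[OF finL \<open>H \<ge> 0\<close> _ hb[OF \<sigma>]], rule bd_sum[OF _ _ hom_continuous_on(4)])
  show thesis
    by (rule that[OF pair[of 1] pair[of "- 1"] det finL holL boundL ebA[of 1] ebB[of 1] ebA[of "- 1"] ebB[of "- 1"]]) auto
qed

end

section \<open>Flatness\<close>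

lemma holomorphic_sev_divide_const:
  assumes "holomorphic_sev F U" shows "holomorphic_sev (\<lambda>X. F X / c) U"
  by (rule holomorphic_sevI[OF bounded_linear.has_derivative[OF bounded_linear_divide
        holomorphic_sev_has_derivative[OF assms]]])
     (simp_all add: holomorphic_sev_ext_deriv_scale[OF assms])

lemma ext_deriv_cong_open:
  assumes "open S" "X \<in> S" "\<And>Y. Y \<in> S \<Longrightarrow> F Y = G Y" "(G has_derivative G') (at X)"
  shows "ext_deriv F X = G'"
  by (rule ext_deriv_eq[OF has_derivative_transform_within_open[OF assms(4,1,2)]]) (simp add: assms(3))

lemma matrix_vector_mult_2:
  "(M *v x) $ i = M $ i $ 1 * x $ 1 + M $ i $ 2 * x $ 2" for M :: "complex ^ 2 ^ 2"
  by (simp add: matrix_vector_mult_def sum_2)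

lemma ext_deriv_id: "ext_deriv (\<lambda>x. x) X = (\<lambda>v. v)"
  by (rule ext_deriv_eq) (rule has_derivative_ident)

lemma horizontal_pair_holomorphic:
  fixes \<psi> :: "complex ^ 'k::finite \<Rightarrow> 'n::finite homog"
  assumes y: "horizontal_pair A \<psi> S y1 y2"
    and lin: "\<And>u v a i j. u \<in> S \<Longrightarrow> conn_matrix A (\<psi> u) (ext_deriv \<psi> u (a *s v)) $ i $ j
      = a * pull_conn A \<psi> u v i j"
  shows "holomorphic_sev y1 S" "holomorphic_sev y2 S"
proof -
  show "holomorphic_sev y1 S"
    by (rule holomorphic_sevI[where L = "\<lambda>u v. - (pull_conn A \<psi> u v 1 1 * y1 u +
        pull_conn A \<psi> u v 1 2 * y2 u)"])
       (use y in \<open>auto simp: horizontal_pair_def lin algebra_simps\<close>)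
  show "holomorphic_sev y2 S"
    by (rule holomorphic_sevI[where L = "\<lambda>u v. - (pull_conn A \<psi> u v 2 1 * y1 u +
        pull_conn A \<psi> u v 2 2 * y2 u)"])
       (use y in \<open>auto simp: horizontal_pair_def lin algebra_simps\<close>)
qed

context numbering
begin

lemma conn_matrix_scale:
  assumes "X \<noteq> 0" "X \<notin> polar lam"
  shows "conn lam X (a *s v) $ i $ j = a * conn lam X v $ i $ j"
proof -
  obtain U where "X \<in> U" "regular_on lam U" using regular_on_neighbourhood[OF assms] by blast
  then show ?thesis unfolding regular_on_def complex_linear_iff by blast
qed

text \<open>
  In terms of a local frame of horizontal sections a section \<open>s\<close> has coordinates \<open>g1\<close>, \<open>g2\<close>, and
  \<open>\<nabla>\<close> becomes the exterior derivative of these, so flatness reduces to the symmetry of second derivatives.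
\<close>

lemma flat_A_lambda: "flat_connection (A_lambda e lam)"
  unfolding flat_connection_def
proof (intro allI impI ballI)
  fix U and s :: "'n homog \<Rightarrow> complex ^ 2" and X V W
  assume asm: "open U \<and> 0 \<notin> U \<and> U \<inter> polar lam = {} \<and> (\<forall>i. holomorphic_sev (\<lambda>X. s X $ i) U)"
    and X: "X \<in> U"
  define A where "A = A_lambda e lam"
  define C where "C Q V i j = conn_matrix A Q V $ i $ j" for Q V i j
  obtain R where R: "R > 0" "ball X R \<subseteq> U" using asm X openE by blast
  define S where "S = ball X R"
  have S: "open S" "convex S" "X \<in> S" "S \<subseteq> U" using R by (auto simp: S_def)
  have reg: "Y \<noteq> 0 \<and> Y \<notin> polar_locus A" if "Y \<in> S" for Y
    using that asm S by (auto simp: A_def)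
  have holid: "holomorphic_sev (\<lambda>u. u $ j) S" for j :: "'n option"
    by (rule holomorphic_sevI[OF bounded_linear.has_derivative[OF bounded_linear_vec_nth has_derivative_ident]]) simp
  obtain y1 y2 z1 z2 and Ls :: "('n homog \<Rightarrow> complex) set" where
    y: "horizontal_pair A (\<lambda>x. x) S y1 y2" and z: "horizontal_pair A (\<lambda>x. x) S z1 z2"
    and det: "\<And>u. u \<in> S \<Longrightarrow> y1 u * z2 u - y2 u * z1 u = 2"
  proof (rule fundamental_system[OF S(1,2) holid, of lam])
    show "u \<noteq> 0 \<and> u \<notin> polar lam" if "u \<in> S" for u
      using reg[OF that] by (simp add: A_def)
  qed (rule that; simp add: A_def)
  have lin: "conn_matrix A u (ext_deriv (\<lambda>x. x) u (a *s v)) $ i $ j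
      = a * conn_matrix A u (ext_deriv (\<lambda>x. x) u v) $ i $ j" if "u \<in> S" for u v a i j
    using conn_matrix_scale reg[OF that] unfolding ext_deriv_id A_def by blast
  have hol: "holomorphic_sev y1 S" "holomorphic_sev y2 S" "holomorphic_sev z1 S" "holomorphic_sev z2 S"
    by (rule horizontal_pair_holomorphic[OF y] horizontal_pair_holomorphic[OF z], rule lin, assumption)+
  have d: "(y1 has_derivative (\<lambda>v. - (C u v 1 1 * y1 u + C u v 1 2 * y2 u))) (at u)"
    "(y2 has_derivative (\<lambda>v. - (C u v 2 1 * y1 u + C u v 2 2 * y2 u))) (at u)"
    "(z1 has_derivative (\<lambda>v. - (C u v 1 1 * z1 u + C u v 1 2 * z2 u))) (at u)"
    "(z2 has_derivative (\<lambda>v. - (C u v 2 1 * z1 u + C u v 2 2 * z2 u))) (at u)" if "u \<in> S" for u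
    using y z that unfolding horizontal_pair_def ext_deriv_id C_def by blast+
  have s: "holomorphic_sev (\<lambda>X. s X $ i) S" for i
    using asm S(4) holomorphic_sev_subset by blast
  \<comment> \<open>Cramer's rule, with Wronskian 2.\<close>
  define g1 where "g1 u = (s u $ 1 * z2 u - s u $ 2 * z1 u) / 2" for u
  define g2 where "g2 u = (y1 u * s u $ 2 - y2 u * s u $ 1) / 2" for u
  have g: "holomorphic_sev g1 S" "holomorphic_sev g2 S"
    unfolding g1_def g2_def
    by (rule holomorphic_sev_divide_const[OF holomorphic_sev_diff[OF
          holomorphic_sev_mult[OF s hol(4)] holomorphic_sev_mult[OF s hol(3)]]])
       (rule holomorphic_sev_divide_const[OF holomorphic_sev_diff[OF
          holomorphic_sev_mult[OF hol(1) s] holomorphic_sev_mult[OF hol(2) s]]])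
  have s_eq: "s u $ 1 = y1 u * g1 u + z1 u * g2 u" "s u $ 2 = y2 u * g1 u + z2 u * g2 u" if "u \<in> S" for u
  proof -
    have "y1 u * g1 u + z1 u * g2 u = (y1 u * z2 u - y2 u * z1 u) * s u $ 1 / 2"
      "y2 u * g1 u + z2 u * g2 u = (y1 u * z2 u - y2 u * z1 u) * s u $ 2 / 2"
      unfolding g1_def g2_def by (simp_all add: field_simps)
    then show "s u $ 1 = y1 u * g1 u + z1 u * g2 u" "s u $ 2 = y2 u * g1 u + z2 u * g2 u"
      by (simp_all add: det[OF that])
  qed
  \<comment> \<open>As the frame is horizontal, \<open>nabla A s\<close> is the frame applied to the
    differentials of \<open>g1\<close> and \<open>g2\<close>.\<close>
  define n where "n Q W = (vector [y1 Q * ext_deriv g1 Q W + z1 Q * ext_deriv g2 Q W,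
    y2 Q * ext_deriv g1 Q W + z2 Q * ext_deriv g2 Q W] :: complex ^ 2)" for Q W
  have nabla: "nabla A s Q W = n Q W" if Q: "Q \<in> S" for Q W
  proof -
    note dg = holomorphic_sev_has_derivative[OF g(1) Q] holomorphic_sev_has_derivative[OF g(2) Q]
    have "ext_deriv (\<lambda>X. s X $ 1) Q = (\<lambda>v. (y1 Q * ext_deriv g1 Q v + - (C Q v 1 1 * y1 Q + C Q v 1 2 * y2 Q) * g1 Q)
        + (z1 Q * ext_deriv g2 Q v + - (C Q v 1 1 * z1 Q + C Q v 1 2 * z2 Q) * g2 Q))"
      by (rule ext_deriv_cong_open[OF S(1) Q s_eq(1)]) (assumption | intro has_derivative_add has_derivative_mult d Q dg)+
    moreover have "ext_deriv (\<lambda>X. s X $ 2) Q = (\<lambda>v. (y2 Q * ext_deriv g1 Q v + - (C Q v 2 1 * y1 Q + C Q v 2 2 * y2 Q) * g1 Q)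
        + (z2 Q * ext_deriv g2 Q v + - (C Q v 2 1 * z1 Q + C Q v 2 2 * z2 Q) * g2 Q))"
      by (rule ext_deriv_cong_open[OF S(1) Q s_eq(2)]) (assumption | intro has_derivative_add has_derivative_mult d Q dg)+
    moreover have "ext_deriv s Q W $ i = ext_deriv (\<lambda>X. s X $ i) Q W" for i
    proof -
      have "(s has_derivative (\<lambda>v. \<chi> j. ext_deriv (\<lambda>X. s X $ j) Q v)) (at Q)"
        by (rule has_derivative_vec) (simp add: holomorphic_sev_has_derivative[OF s Q])
      then show ?thesis by (simp add: ext_deriv_eq)
    qed
    ultimately show ?thesis
      unfolding vec_eq_iff forall_2 nabla_def vector_add_component matrix_vector_mult_2 s_eq[OF Q] n_def
        C_def[symmetric] vector_2
      by (simp add: algebra_simps)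
  qed
  define dn where "dn V W i = (if i = 1 then
      (y1 X * ext_deriv (\<lambda>Q. ext_deriv g1 Q W) X V + - (C X V 1 1 * y1 X + C X V 1 2 * y2 X) * ext_deriv g1 X W) +
      (z1 X * ext_deriv (\<lambda>Q. ext_deriv g2 Q W) X V + - (C X V 1 1 * z1 X + C X V 1 2 * z2 X) * ext_deriv g2 X W)
    else
      (y2 X * ext_deriv (\<lambda>Q. ext_deriv g1 Q W) X V + - (C X V 2 1 * y1 X + C X V 2 2 * y2 X) * ext_deriv g1 X W) +
      (z2 X * ext_deriv (\<lambda>Q. ext_deriv g2 Q W) X V + - (C X V 2 1 * z1 X + C X V 2 2 * z2 X) * ext_deriv g2 X W))"
    for V W and i :: 2
  have dn: "ext_deriv (\<lambda>Q. nabla A s Q W) X V $ i = dn V W i" for V W i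
  proof -
    note dg = holomorphic_sev_has_derivative[OF holomorphic_sev_ext_deriv[OF g(1) S(1)] S(3)]
      holomorphic_sev_has_derivative[OF holomorphic_sev_ext_deriv[OF g(2) S(1)] S(3)]
    have "((\<lambda>Q. n Q W) has_derivative (\<lambda>V. \<chi> i. dn V W i)) (at X)"
    proof (rule has_derivative_vec)
      fix j :: 2
      show "((\<lambda>Q. n Q W $ j) has_derivative (\<lambda>V. (\<chi> i. dn V W i) $ j)) (at X)"
      proof (cases "j = 1")
        case True
        then show ?thesis
          unfolding n_def dn_def True vector_2 vec_lambda_beta if_True simp_thms
          by (simp, intro has_derivative_add has_derivative_mult d[simplified] S(3) dg)
      next
        case False
        then have j: "j = 2" using exhaust_2 by blast
        show ?thesis
          unfolding n_def dn_def j vector_2 vec_lambda_beta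
          by (simp, intro has_derivative_add has_derivative_mult d[simplified] S(3) dg)
      qed
    qed
    from ext_deriv_cong_open[OF S(1,3) nabla this] show ?thesis by simp
  qed
  have sym: "ext_deriv (\<lambda>Q. ext_deriv g1 Q W) X V = ext_deriv (\<lambda>Q. ext_deriv g1 Q V) X W"
    "ext_deriv (\<lambda>Q. ext_deriv g2 Q W) X V = ext_deriv (\<lambda>Q. ext_deriv g2 Q V) X W"
    using ext_deriv_symmetric[OF g(1) S(1,3)] ext_deriv_symmetric[OF g(2) S(1,3)] by blast+
  have "nabla1 A (nabla A s) X V W $ i = 0" for i
  proof -
    have "nabla1 A (nabla A s) X V W $ i = (dn V W i - dn W V i)
      + ((C X V i 1 * n X W $ 1 + C X V i 2 * n X W $ 2) - (C X W i 1 * n X V $ 1 + C X W i 2 * n X V $ 2))"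
      unfolding nabla1_def vector_add_component vector_minus_component dn matrix_vector_mult_2
        nabla[OF S(3)] C_def by simp
    \<comment> \<open>Differentiating the frame cancels the connection terms; the remaining second
      derivatives of \<open>g1\<close> and \<open>g2\<close> cancel by \<open>sym\<close>.\<close>
    also have "\<dots> = 0"
      using exhaust_2[of i] by (auto simp: dn_def n_def vector_2 sym algebra_simps)
    finally show ?thesis .
  qed
  then show "nabla1 (A_lambda e lam) (nabla (A_lambda e lam) s) X V W = 0"
    by (simp add: vec_eq_iff A_def)
qed

end

section \<open>Moderate growth\<close>

definition partial_exp :: "'k set \<Rightarrow> complex ^ 'k::finite \<Rightarrow> complex ^ 'k"
  where "partial_exp K u = (\<chi> i. if i \<in> K then exp (u $ i) else u $ i)"

definition dpartial_exp :: "'k set \<Rightarrow> complex ^ 'k::finite \<Rightarrow> complex ^ 'k \<Rightarrow> complex ^ 'k"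
  where "dpartial_exp K u v = (\<chi> i. if i \<in> K then v $ i * exp (u $ i) else v $ i)"

lemma partial_exp_has_derivative: "(partial_exp K has_derivative dpartial_exp K u) (at u)"
proof (rule has_derivative_vec)
  fix i
  show "((\<lambda>u. partial_exp K u $ i) has_derivative (\<lambda>v. dpartial_exp K u v $ i)) (at u)"
    by (cases "i \<in> K")
       (auto simp: partial_exp_def dpartial_exp_def
         intro!: has_derivative_exp_complex bounded_linear_imp_has_derivative bounded_linear_vec_nth)
qed

lemma dpartial_exp_scale: "dpartial_exp K u (a *s v) = a *s dpartial_exp K u v"
  by (simp add: dpartial_exp_def vec_eq_iff)

lemma partial_exp_polydisc:
  assumes "u \<in> log_polydisc K c" shows "partial_exp K u \<in> polydisc (exp (- c))"
  unfolding polydisc_def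
proof (intro CollectI allI)
  fix i
  have "if i \<in> K then Re (u $ i) < - c else norm (u $ i) < exp (- c)"
    using assms by (simp add: log_polydisc_def)
  then show "norm (partial_exp K u $ i) < exp (- c)" by (auto simp: partial_exp_def split: if_splits)
qed

lemma polydisc_bounded_image:
  fixes \<phi> :: "complex ^ 'k::finite \<Rightarrow> complex ^ 'm::finite"
  assumes "continuous_on (polydisc 1) \<phi>" "r < 1"
  shows "bounded (\<phi> ` polydisc r)"
proof -
  define B where "B = {w :: complex ^ 'k. \<forall>i. w $ i \<in> cball 0 r}"
  have "compact B" unfolding B_def by (rule compact_vec_Pi) simp
  moreover have "B \<subseteq> polydisc 1" using assms(2) by (auto simp: B_def polydisc_def intro: order.strict_trans1)
  ultimately have "bounded (\<phi> ` B)"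
    using assms(1) by (meson compact_continuous_image compact_imp_bounded continuous_on_subset)
  moreover have "polydisc r \<subseteq> B" by (auto simp: B_def polydisc_def intro: less_imp_le)
  ultimately show ?thesis by (meson bounded_subset image_mono)
qed

context numbering
begin

text \<open>On the universal cover s is a constant combination of a fundamental system, which is
  bounded by exponentials of logarithms. On sectors these are linear in the - ln |w_i|, so the
  exponentials are powers of the inverse distances.\<close>

lemma regular_A_lambda: "regular_singularities (A_lambda e lam)"
  unfolding regular_singularities_def
proof (intro allI impI)
  fix K :: "'n set" and \<phi> a b and s :: "complex ^ 'n \<Rightarrow> complex ^ 2"
  assume asm: "adapted_map (A_lambda e lam) K \<phi> \<and> (\<forall>i\<in>K. a i < b i \<and> b i \<le> a i + 2 * pi) \<and>
    horizontal_along (A_lambda e lam) \<phi> (polysector K a b) s"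
  define A where "A = A_lambda e lam"
  let ?G = "\<lambda>u :: complex ^ 'n. 1 + (\<Sum>i\<in>K. - Re (u $ i))"
  have \<phi>: "\<And>j. holomorphic_sev (\<lambda>w. \<phi> w $ j) (polydisc 1)"
    and \<phi>0: "\<And>w. w \<in> polydisc 1 \<Longrightarrow> \<phi> w \<noteq> 0"
    and \<phi>p: "\<And>w. w \<in> polydisc 1 \<Longrightarrow> \<phi> w \<in> polar_locus A \<longleftrightarrow> (\<exists>i\<in>K. w $ i = 0)"
    using asm by (auto simp: adapted_map_def A_def)
  define S :: "(complex ^ 'n) set" where "S = log_polydisc K 0"
  have S: "open S" "convex S" unfolding S_def by (rule open_log_polydisc convex_log_polydisc)+
  define E where "E = (partial_exp K :: complex ^ 'n \<Rightarrow> _)"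
  have ES: "E u \<in> polydisc 1" if "u \<in> S" for u
    using partial_exp_polydisc[of u K 0] that by (simp add: S_def E_def)
  define \<psi> where "\<psi> u = \<phi> (E u)" for u
  have d\<phi>: "(\<phi> has_derivative ext_deriv \<phi> w) (at w)" "ext_deriv \<phi> w (c *s v) = c *s ext_deriv \<phi> w v"
    if "w \<in> polydisc 1" for w c v
    using holomorphic_sev_vec[OF \<phi> that] by blast+
  have d\<psi>: "(\<psi> has_derivative (\<lambda>v. ext_deriv \<phi> (E u) (dpartial_exp K u v))) (at u)" if "u \<in> S" for u
    using diff_chain_at[OF partial_exp_has_derivative d\<phi>(1)[OF ES[OF that, unfolded E_def]]]
    by (simp add: o_def \<psi>_def[abs_def] E_def)
  have \<psi>: "holomorphic_sev (\<lambda>u. \<psi> u $ j) S" for j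
    by (rule holomorphic_sevI[OF bounded_linear.has_derivative[OF bounded_linear_vec_nth d\<psi>]])
       (simp_all add: dpartial_exp_scale d\<phi>(2) ES)
  have reg: "\<psi> u \<noteq> 0 \<and> \<psi> u \<notin> polar_locus A" if "u \<in> S" for u
    using \<phi>0[OF ES[OF that]] \<phi>p[OF ES[OF that]] by (auto simp: \<psi>_def E_def partial_exp_def)
  obtain y1 y2 z1 z2 Ls where
    y: "horizontal_pair A \<psi> S y1 y2" and z: "horizontal_pair A \<psi> S z1 z2"
    and det: "\<And>u. u \<in> S \<Longrightarrow> y1 u * z2 u - y2 u * z1 u = 2"
    and Ls: "finite Ls" "\<And>l. l \<in> Ls \<Longrightarrow> holomorphic_sev l S" "\<And>l. l \<in> Ls \<Longrightarrow> log_bounded_above \<psi> S l"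
    and eb: "exp_bounded \<psi> S Ls y1" "exp_bounded \<psi> S Ls y2" "exp_bounded \<psi> S Ls z1" "exp_bounded \<psi> S Ls z2"
    by (rule fundamental_system[OF S \<psi> reg[unfolded A_def], folded A_def], assumption) (rule that)
  \<comment> \<open>Over T the test map is evaluated on a polydisc of radius below 1, where it is
    bounded by compactness.\<close>
  define T :: "(complex ^ 'n) set" where "T = log_polydisc K 1"
  have TS: "T \<subseteq> S" unfolding T_def S_def by (rule log_polydisc_1_subset)
  have bT: "bounded (\<psi> ` T)"
  proof -
    have "continuous_on (polydisc 1) \<phi>"
      using d\<phi>(1) has_derivative_continuous continuous_at_imp_continuous_on by blast
    then have "bounded (\<phi> ` polydisc (exp (- 1)))" by (rule polydisc_bounded_image) simp
    moreover have "\<psi> ` T \<subseteq> \<phi> ` polydisc (exp (- 1))"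
      using partial_exp_polydisc[of _ K 1] by (auto simp: \<psi>_def E_def T_def)
    ultimately show ?thesis by (rule bounded_subset)
  qed
  \<comment> \<open>The region of \<open>log_polydisc_linear_growth\<close>; its bound - 2 is the
    origin of the radius exp (- 2) at the end.\<close>
  define Q where "Q = {u :: complex ^ 'n. \<forall>i. if i \<in> K then Re (u $ i) \<le> - 2 \<and> a i \<le> Im (u $ i) \<and> Im (u $ i) \<le> b i
        else norm (u $ i) \<le> exp (- 2)}"
  have "\<exists>C\<ge>0. \<forall>u\<in>Q. norm (l u) \<le> C * ?G u" if l: "l \<in> Ls" for l
  proof -
    obtain m where "\<forall>u\<in>T. Re (l u) \<le> m"
      using Ls(3)[OF l] TS bT unfolding log_bounded_above_def by blast
    then show ?thesis
      using log_polydisc_linear_growth[of l K m a b] Ls(2)[OF l] unfolding Q_def S_def T_def by blast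
  qed
  then have "\<forall>l\<in>Ls. \<exists>C. C \<ge> 0 \<and> (\<forall>u\<in>Q. norm (l u) \<le> C * ?G u)" by blast
  then obtain C where C: "\<forall>l\<in>Ls. C l \<ge> 0 \<and> (\<forall>u\<in>Q. norm (l u) \<le> C l * ?G u)"
    by (rule bchoice[THEN exE])
  define C0 where "C0 = (\<Sum>l\<in>Ls. C l)"
  have C0: "C0 \<ge> 0" unfolding C0_def using C by (intro sum_nonneg) auto
  have sumL: "(\<Sum>l\<in>Ls. norm (l u)) \<le> C0 * ?G u" if "u \<in> Q" for u
    unfolding C0_def sum_distrib_right using C that by (intro sum_mono) auto
  have "\<exists>M\<ge>0. \<forall>u\<in>Q \<inter> T. norm (y u) \<le> M * exp (M * ?G u)"
    if y: "exp_bounded \<psi> S Ls y" for y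
  proof -
    obtain M where M: "M \<ge> 0" "\<And>u. u \<in> T \<Longrightarrow> norm (y u) \<le> M * exp (M * (\<Sum>l\<in>Ls. norm (l u)))"
      using y TS bT unfolding exp_bounded_def by blast
    define M' where "M' = M + M * C0"
    have M': "M' \<ge> M" "M' \<ge> M * C0" "M' \<ge> 0" using M(1) C0 by (auto simp: M'_def)
    have "norm (y u) \<le> M' * exp (M' * ?G u)" if u: "u \<in> Q \<inter> T" for u
    proof -
      have pos: "0 \<le> ?G u"
      proof -
        have "Re (u $ i) \<le> 0" if "i \<in> K" for i
        proof -
          have "Re (u $ i) \<le> - 2" using u that by (auto simp: Q_def)
          then show ?thesis by simp
        qed
        then have "0 \<le> (\<Sum>i\<in>K. - Re (u $ i))" by (intro sum_nonneg) auto
        then show ?thesis by simp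
      qed
      have "norm (y u) \<le> M * exp (M * (\<Sum>l\<in>Ls. norm (l u)))" using M(2) u by blast
      also have "\<dots> \<le> M * exp (M * (C0 * ?G u))"
        using M(1) sumL u by (intro mult_left_mono exp_le_cancel_iff[THEN iffD2]) auto
      also have "\<dots> \<le> M' * exp (M' * ?G u)"
      proof -
        have "M * (C0 * ?G u) \<le> M' * ?G u"
          unfolding mult.assoc[symmetric] by (rule mult_right_mono[OF M'(2) pos])
        then show ?thesis using M' by (intro mult_mono) auto
      qed
      finally show ?thesis .
    qed
    with M'(3) show ?thesis by blast
  qed
  note bd = this
  obtain M1 where M1: "M1 \<ge> 0"
    "\<And>u. u \<in> Q \<inter> T \<Longrightarrow> norm (y1 u) \<le> M1 * exp (M1 * ?G u)"
    using bd[OF eb(1)] by blast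
  obtain M2 where M2: "M2 \<ge> 0"
    "\<And>u. u \<in> Q \<inter> T \<Longrightarrow> norm (y2 u) \<le> M2 * exp (M2 * ?G u)"
    using bd[OF eb(2)] by blast
  obtain M3 where M3: "M3 \<ge> 0"
    "\<And>u. u \<in> Q \<inter> T \<Longrightarrow> norm (z1 u) \<le> M3 * exp (M3 * ?G u)"
    using bd[OF eb(3)] by blast
  obtain M4 where M4: "M4 \<ge> 0"
    "\<And>u. u \<in> Q \<inter> T \<Longrightarrow> norm (z2 u) \<le> M4 * exp (M4 * ?G u)"
    using bd[OF eb(4)] by blast
  \<comment> \<open>A single exponent that dominates all four bounds.\<close>
  obtain N :: nat where N: "real N \<ge> M1 + M2 + M3 + M4" using real_arch_simple by blast
  \<comment> \<open>The lift of the polysector; being convex it is connected, so functions with zero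
    derivative are constant on it.\<close>
  define S' where "S' = {u \<in> S. \<forall>i\<in>K. a i < Im (u $ i) \<and> Im (u $ i) < b i}"
  have S'S: "S' \<subseteq> S" by (auto simp: S'_def)
  have convS': "convex S'"
    unfolding convex_alt
  proof (intro ballI allI impI)
    fix x y and t :: real assume xy: "x \<in> S'" "y \<in> S'" and t: "0 \<le> t \<and> t \<le> 1"
    have "(1 - t) *\<^sub>R x + t *\<^sub>R y \<in> S"
      using S(2) xy t unfolding convex_alt S'_def by blast
    moreover have "a i < Im (((1 - t) *\<^sub>R x + t *\<^sub>R y) $ i) \<and> Im (((1 - t) *\<^sub>R x + t *\<^sub>R y) $ i) < b i"
      if "i \<in> K" for i
      using xy t that convex_bound_lt[of "Im (x $ i)" "b i" "Im (y $ i)" "1 - t" t]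
        convex_bound_lt[of "- Im (x $ i)" "- a i" "- Im (y $ i)" "1 - t" t]
      by (auto simp: S'_def)
    ultimately show "(1 - t) *\<^sub>R x + t *\<^sub>R y \<in> S'" by (simp add: S'_def)
  qed
  have E_sector: "E u \<in> polysector K a b" if u: "u \<in> S'" for u
  proof -
    have "E u $ i \<noteq> 0 \<and> (\<exists>\<theta>. a i < \<theta> \<and> \<theta> < b i \<and> E u $ i = of_real (norm (E u $ i)) * cis \<theta>)" if "i \<in> K" for i
    proof -
      have Ei: "E u $ i = exp (u $ i)" using that by (simp add: E_def partial_exp_def)
      have "E u $ i = of_real (norm (E u $ i)) * cis (Im (u $ i))"
        unfolding Ei norm_exp_eq_Re by (rule exp_eq_polar)
      moreover have "E u $ i \<noteq> 0" by (simp add: Ei)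
      ultimately show ?thesis using u that unfolding S'_def by blast
    qed
    then show ?thesis using ES u S'S by (auto simp: polysector_def)
  qed
  define t1 where "t1 u = s (E u) $ 1" for u
  define t2 where "t2 u = s (E u) $ 2" for u
  have t: "horizontal_pair A \<psi> S' t1 t2"
    unfolding horizontal_pair_def
  proof
    fix u assume u: "u \<in> S'"
    have "(s has_derivative (\<lambda>v. - (conn_matrix A (\<phi> (E u)) (ext_deriv \<phi> (E u) v) *v s (E u)))) (at (E u))"
      using asm E_sector[OF u] unfolding horizontal_along_def A_def by blast
    from diff_chain_at[OF partial_exp_has_derivative this[unfolded E_def]]
    have ds: "((\<lambda>u. s (E u)) has_derivative (\<lambda>v. - (conn_matrix A (\<psi> u) (ext_deriv \<psi> u v) *v s (E u)))) (at u)"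
      using ext_deriv_eq[OF d\<psi>[of u]] u S'S by (auto simp: o_def E_def \<psi>_def)
    note dcomp = bounded_linear.has_derivative[OF bounded_linear_vec_nth ds]
    show "(t1 has_derivative (\<lambda>v. - (pull_conn A \<psi> u v 1 1 * t1 u +
        pull_conn A \<psi> u v 1 2 * t2 u))) (at u) \<and>
      (t2 has_derivative (\<lambda>v. - (pull_conn A \<psi> u v 2 1 * t1 u +
        pull_conn A \<psi> u v 2 2 * t2 u))) (at u)"
      using dcomp[of 1] dcomp[of 2] unfolding t1_def t2_def by (simp add: matrix_vector_mult_2)
  qed
  \<comment> \<open>The trace is read off from the constant Wronskian of the fundamental
    system.\<close>
  have trace: "pull_conn A \<psi> u v 1 1 + pull_conn A \<psi> u v 2 2 = 0"
    if u: "u \<in> S" for u v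
  proof -
    have "((\<lambda>u. 2) has_derivative (\<lambda>v. 0)) (at u)" by simp
    then have "((\<lambda>u. y1 u * z2 u - y2 u * z1 u) has_derivative (\<lambda>v. 0)) (at u)"
      by (rule has_derivative_transform_within_open[OF _ S(1) u]) (simp add: det)
    from fun_cong[OF has_derivative_unique[OF this horizontal_pair_wronskian[OF y z u]], of v]
    have "0 = - (pull_conn A \<psi> u v 1 1
        + pull_conn A \<psi> u v 2 2) * 2"
      unfolding det[OF u] .
    moreover have "x = 0" if "0 = - x * 2" for x :: complex using that by simp
    ultimately show ?thesis by blast
  qed
  have const: "\<exists>k. \<forall>u\<in>S'. t1 u * f2 u - t2 u * f1 u = k" if f: "horizontal_pair A \<psi> S f1 f2" for f1 f2
  proof -
    have f': "horizontal_pair A \<psi> S' f1 f2" using f S'S unfolding horizontal_pair_def by blast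
    have "((\<lambda>u. t1 u * f2 u - t2 u * f1 u) has_derivative (\<lambda>v. 0)) (at u within S')" if "u \<in> S'" for u
      using horizontal_pair_wronskian[OF t f' that] trace[OF subsetD[OF S'S that]]
      by (simp add: has_derivative_at_withinI)
    from has_derivative_zero_constant[OF convS' this] show ?thesis by blast
  qed
  obtain k1 k2 where k: "\<forall>u\<in>S'. t1 u * z2 u - t2 u * z1 u = k1" "\<forall>u\<in>S'. t1 u * y2 u - t2 u * y1 u = k2"
    using const[OF z] const[OF y] by blast
  define D where "D = (norm k1 + norm k2) * (M1 + M2 + M3 + M4) * exp (real N)"
  have bound: "norm (s w) \<le> D / (\<Prod>i\<in>K. norm (w $ i)) ^ N"
    if w: "w \<in> polysector K a b \<inter> polydisc (exp (- 2))" for w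
  proof -
    have "\<forall>i\<in>K. \<exists>\<theta>. a i < \<theta> \<and> \<theta> < b i \<and> w $ i = of_real (norm (w $ i)) * cis \<theta>"
      using w by (auto simp: polysector_def)
    then obtain \<theta> where \<theta>: "\<forall>i\<in>K. a i < \<theta> i \<and> \<theta> i < b i \<and> w $ i = of_real (norm (w $ i)) * cis (\<theta> i)"
      by (rule bchoice[THEN exE])
    have w0: "norm (w $ i) > 0" if "i \<in> K" for i using w that by (auto simp: polysector_def)
    have w2: "norm (w $ i) < exp (- 2)" for i using w by (auto simp: polydisc_def)
    \<comment> \<open>The lift of w whose imaginary parts are the arguments within the
      sector.\<close>
    define u where "u = (\<chi> i. if i \<in> K then Complex (ln (norm (w $ i))) (\<theta> i) else w $ i)"
    have Eu: "E u = w"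
      using \<theta> w0 by (auto simp: E_def partial_exp_def u_def vec_eq_iff exp_eq_polar)
    have ln2: "ln (norm (w $ i)) < - 2" if "i \<in> K" for i
      using w0[OF that] w2[of i] by (metis ln_exp ln_less_cancel_iff exp_gt_zero)
    have exp2: "r < exp (- 1) \<and> r < 1" if "r < exp (- 2)" for r :: real
    proof -
      have "exp (- 2) < exp (- 1 :: real)" "exp (- 2) < (1 :: real)" by simp_all
      with that show ?thesis by linarith
    qed
    have u1: "u \<in> T"
      unfolding T_def log_polydisc_def using ln2 exp2[OF w2] by (force simp: u_def)
    have u2: "u \<in> Q"
      unfolding Q_def using ln2 \<theta> w2 by (force simp: u_def intro: less_imp_le)
    have u3: "u \<in> S'"
      using u1 TS \<theta> by (auto simp: S'_def u_def)
    define P where "P = (\<Prod>i\<in>K. norm (w $ i))"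
    have P0: "P > 0" unfolding P_def using w0 by (intro prod_pos) auto
    have sum_eq: "(\<Sum>i\<in>K. - Re (u $ i)) = - ln P"
      unfolding P_def using w0 by (subst ln_prod) (auto simp: u_def sum_negf)
    have pos: "0 \<le> - ln P"
      unfolding sum_eq[symmetric] using ln2 by (intro sum_nonneg) (force simp: u_def)
    define B where "B = exp (real N) / P ^ N"
    have B: "exp (M * ?G u) \<le> B" if "M \<le> real N" for M
    proof -
      have "exp (M * ?G u) \<le> exp (real N * (1 + - ln P))"
        unfolding sum_eq using that pos by (intro exp_le_cancel_iff[THEN iffD2] mult_right_mono) auto
      also have "\<dots> = exp (real N) * exp (- (real N * ln P))"
        by (simp add: exp_add[symmetric] algebra_simps)
      also have "exp (- (real N * ln P)) = inverse (P ^ N)"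
        using P0 by (simp add: exp_minus exp_of_nat_mult)
      finally show ?thesis by (simp add: B_def divide_inverse)
    qed
    have Bpos: "B > 0" using P0 by (simp add: B_def)
    have fb: "norm x \<le> M * B" if "M \<ge> 0" "norm x \<le> M * exp (M * ?G u)"
      "M \<le> real N" for M and x :: complex
      using that(2) mult_left_mono[OF B[OF that(3)] that(1)] by linarith
    have uQT: "u \<in> Q \<inter> T" using u1 u2 by blast
    have y1b: "norm (y1 u) \<le> M1 * B" and y2b: "norm (y2 u) \<le> M2 * B"
      and z1b: "norm (z1 u) \<le> M3 * B" and z2b: "norm (z2 u) \<le> M4 * B"
      using fb[OF M1(1) M1(2)[OF uQT]] fb[OF M2(1) M2(2)[OF uQT]] fb[OF M3(1) M3(2)[OF uQT]]
        fb[OF M4(1) M4(2)[OF uQT]] N M1(1) M2(1) M3(1) M4(1) by auto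
    have uS: "u \<in> S" using u1 TS by blast
    have ku: "k1 = t1 u * z2 u - t2 u * z1 u" "k2 = t1 u * y2 u - t2 u * y1 u"
      using k u3 by auto
    \<comment> \<open>Cramer's rule again: \<open>k1\<close> and \<open>k2\<close> are the constant
      Wronskians of s with the fundamental system.\<close>
    have t1: "2 * t1 u = k1 * y1 u - k2 * z1 u"
    proof -
      have "k1 * y1 u - k2 * z1 u = t1 u * (y1 u * z2 u - y2 u * z1 u)"
        unfolding ku by (simp add: algebra_simps)
      then show ?thesis by (simp add: det[OF uS])
    qed
    have t2: "2 * t2 u = k1 * y2 u - k2 * z2 u"
    proof -
      have "k1 * y2 u - k2 * z2 u = t2 u * (y1 u * z2 u - y2 u * z1 u)"
        unfolding ku by (simp add: algebra_simps)
      then show ?thesis by (simp add: det[OF uS])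
    qed
    have comb: "norm (x :: complex) \<le> norm k1 * norm p + norm k2 * norm r"
      if "2 * x = k1 * p - k2 * r" for x p r
    proof -
      have "2 * norm x = norm (k1 * p - k2 * r)" unfolding that[symmetric] by (simp add: norm_mult)
      also have "\<dots> \<le> norm k1 * norm p + norm k2 * norm r"
        by (metis norm_mult norm_triangle_ineq4)
      finally show ?thesis using norm_ge_zero[of x] by linarith
    qed
    have "norm (s w) \<le> norm (t1 u) + norm (t2 u)"
    proof -
      have "norm (s w) \<le> (\<Sum>i\<in>UNIV. norm (s w $ i))"
        unfolding norm_vec_def by (rule L2_set_le_sum) auto
      then show ?thesis by (simp add: sum_2 t1_def t2_def Eu)
    qed
    also have "\<dots> \<le> (norm k1 * (M1 * B) + norm k2 * (M3 * B)) + (norm k1 * (M2 * B) + norm k2 * (M4 * B))"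
      by (intro add_mono order_trans[OF comb[OF t1]] order_trans[OF comb[OF t2]] mult_left_mono y1b y2b z1b z2b) auto
    also have "\<dots> \<le> (norm k1 + norm k2) * (M1 + M2 + M3 + M4) * B"
    proof -
      have "norm k1 * (M1 + M2) + norm k2 * (M3 + M4) \<le> (norm k1 + norm k2) * (M1 + M2 + M3 + M4)"
        unfolding distrib_right[of "norm k1"] using M1(1) M2(1) M3(1) M4(1)
        by (intro add_mono[OF mult_left_mono mult_left_mono]) auto
      from mult_right_mono[OF this, of B] show ?thesis using Bpos by (simp add: algebra_simps)
    qed
    also have "\<dots> = D / P ^ N" by (simp add: D_def B_def)
    finally show ?thesis unfolding P_def .
  qed
  show "\<exists>r>0. \<exists>C. \<exists>N::nat. \<forall>w\<in>polysector K a b \<inter> polydisc r. norm (s w) \<le> C / (\<Prod>i\<in>K. norm (w $ i)) ^ N"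
    by (rule exI[of _ "exp (- 2)"]) (use bound in auto)
qed

end

theorem theorem1p1:
  fixes lam :: "complex ^ 'n::finite"
    and e :: "nat \<Rightarrow> 'n"
  assumes "CARD('n) \<ge> 2"
    and "bij_betw e {..<CARD('n)} UNIV"
  shows "flat_connection (A_lambda e lam) \<and> regular_singularities (A_lambda e lam)"
proof -
  interpret numbering e by unfold_locales fact+
  show ?thesis using flat_A_lambda regular_A_lambda by blast
qed

end
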